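(* Consider the decentralized multi-armed bandit with $N$ arms and $M$ distributed players ($M<N$) described in the context. Under both collision models, the optimal order of the system regret growth rate of the decentralized multi-armed bandit is logarithmic, i.e., for an optimal decentralized policy $\pi^*$, we have $$L(\Theta)\le\liminf_{T\to\infty}\frac{R_T^{\pi^*}(\Theta)}{\log T}\le\limsup_{T\to\infty}\frac{R_T^{\pi^*}(\Theta)}{\log T}\le U(\Theta)$$ for some constants $L(\Theta)$ and $U(\Theta)$ that depend on $\Theta$.
   Context: **Arms.** There are $N$ independent arms. At times $t=1,2,\dots$ arm $i$ has state $S_i(t)$, i.i.d. over $t$ with univariate density $f(s;\theta_i)$, where $\theta_i$ is an unknown element of the set $\mathcal H$ of all possible parameter values; the parameter set $\Theta=(\theta_1,\dots,\theta_N)$ is unknown to the players. $\mu(\theta)$ is the mean of $f(\cdot;\theta)$ and $I(\theta,\theta')=\mathbb E_\theta[\log(f(y;\theta)/f(y;\theta'))]$ (with $y\sim f(\cdot;\theta)$) is the Kullback–Leibler distance. $\sigma$ is a permutation of $\{1,\dots,N\}$ (depending on $\Theta$) with $\mu(\theta_{\sigma(1)})\ge\dots\ge\mu(\theta_{\sigma(N)})$; $\sigma(i)$ is the $i$th best arm. It is assumed that the $M$ best arms have distinct nonnegative means (this condition can be relaxed to the case that a tie occurs at the $M$th largest mean). **Players and policies.** At each time $t$ each player $i\in\{1,\dots,M\}$ chooses one arm $a_i(t)\in\{1,\dots,N\}$ to play and observes its state $S_{a_i(t)}(t)$. Players do not exchange information. A local policy $\pi_i=\{\pi_i(t)\}_{t\ge1}$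 of player $i$ is a sequence of functions, where $\pi_i(t)$ maps player $i$'s own past observations (including its collision history, a collision being the event that several players choose the same arm) and decisions to $a_i(t)$. A decentralized policy is $\pi=[\pi_1,\dots,\pi_M]$. **Collision models.** $Y(t)$ is the total reward accrued by all players at time $t$. Collision model 1 (players choosing the same arm share its reward in an arbitrary way): $Y(t)=\sum_{j=1}^N \mathbb I_j(t)S_j(t)$, where $\mathbb I_j(t)=1$ if arm $j$ is played by at least one player and $0$ otherwise. Collision model 2 (players choosing the same arm obtain no reward): $Y(t)=\sum_{j=1}^N\hat{\mathbb I}_j(t)S_j(t)$, where $\hat{\mathbb I}_j(t)=1$ if arm $j$ is played by exactly one player and $0$ otherwise. **Regret and objective.** The system regret of $\pi$ is $R_T^\pi(\Theta)=T\sum_{j=1}^M\mu(\theta_{\sigma(j)})-\mathbb E_\pi[\sum_{t=1}^T Y(t)]$. The objective is to minimize the rate at which $R_T(\Theta)$ grows with time $T$ under any parameter set $\Theta$ by choosing an optimal decentralized policy. A decentralized policy is uniformly good if for any parameter set $\Theta$, $R_T(\Theta)=o(T^b)$ for any $b>0$; to address the optimal order of the regret, attention is restricted to uniformly good decentralized policies. **Standing conditions.** C1: $\mu(\theta)$ exists for any $\theta\in\mathcal H$. C2: $0<I(\theta,\theta')<\infty$ whenever $\mu(\theta)<\mu(\theta')$. C3: for all $\epsilon>0$ and $\mu(\theta)<\mu(\theta')$ there is $\delta>0$ such that $|I(\theta,\theta')-I(\theta,\theta'')|<\epsilon$ whenever $\mu(\theta')\le\mu(\theta'')\le\mu(\theta')+\delta$.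 C4: for all $\theta\in\mathcal H$ and $\delta>0$ there is $\theta'\in\mathcal H$ with $\mu(\theta)<\mu(\theta')<\mu(\theta)+\delta$. C5: there are functions $h_k$ (point estimate) and $g_{t,k}$ (confidence upper bound) of $k$ observations $S(1),\dots,S(k)$ of an arm such that for any $\theta\in\mathcal H$: (i) $\Pr_\theta\{g_{t,k}(S(1),\dots,S(k))\ge r\text{ for all }k<t\}=1-o(t^{-1})$ for every $r<\mu(\theta)$; (ii) $\lim_{\epsilon\downarrow0}\big(\limsup_{t\to\infty}\sum_{k=1}^{t-1}\Pr_\theta\{g_{t,k}(S(1),\dots,S(k))\ge\mu(\theta')-\epsilon\}/\log t\big)\le 1/I(\theta,\theta')$ whenever $\mu(\theta')>\mu(\theta)$; (iii) $g_{t,k}$ is nondecreasing in $t$ for every fixed $k$; (iv) $g_{t,k}\ge h_k$ for all $t$; (v) $\Pr_\theta\{\max_{\delta t\le k\le t}|h_k-\mu(\theta)|>\epsilon\}=o(t^{-1})$ for all $\epsilon>0$, $0<\delta<1$. Here $\Pr_\theta$ is the probability when the observations are i.i.d. from $f(\cdot;\theta)$. *)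

theory Defs
  imports
    "HOL-Probability.Probability"
    "HOL-Library.Landau_Symbols"
    "HOL-Combinatorics.Permutations"
begin

section \<open>Arm distributions\<close>

text \<open>Densities are taken with respect to a common sigma-finite measure \<open>\<nu>\<close> on the real line, which
  covers both continuous (Lebesgue measure) and discrete (counting measure) families.\<close>

definition density_family :: "real measure \<Rightarrow> 'p set \<Rightarrow> ('p \<Rightarrow> real \<Rightarrow> real) \<Rightarrow> bool" where
  "density_family \<nu> H f \<longleftrightarrow>
     sigma_finite_measure \<nu> \<and> sets \<nu> = sets borel \<and>
     (\<forall>\<theta>\<in>H. f \<theta> \<in> borel_measurable \<nu> \<and> (\<forall>s. 0 \<le> f \<theta> s) \<and> (\<integral>\<^sup>+s. ennreal (f \<theta> s) \<partial>\<nu>) = 1)"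

definition arm_law :: "real measure \<Rightarrow> ('p \<Rightarrow> real \<Rightarrow> real) \<Rightarrow> 'p \<Rightarrow> real measure" where
  "arm_law \<nu> f \<theta> = density \<nu> (\<lambda>s. ennreal (f \<theta> s))"

definition arm_mean :: "real measure \<Rightarrow> ('p \<Rightarrow> real \<Rightarrow> real) \<Rightarrow> 'p \<Rightarrow> real" where
  "arm_mean \<nu> f \<theta> = (\<integral>s. s \<partial>arm_law \<nu> f \<theta>)"

text \<open>The negative part of \<open>ln (f \<theta> y / f \<theta>' y)\<close> is always integrable under \<open>\<theta>\<close>, so the expectation
  is \<open>\<infinity>\<close> exactly when the logarithm is infinite with positive probability or is not integrable.
  The first case has to be singled out because \<open>x / 0 = 0\<close> and \<open>ln 0 = 0\<close>.\<close>

definition kl_dist :: "real measure \<Rightarrow> ('p \<Rightarrow> real \<Rightarrow> real) \<Rightarrow> 'p \<Rightarrow> 'p \<Rightarrow> ereal" where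
  "kl_dist \<nu> f \<theta> \<theta>' =
     (if (AE y in arm_law \<nu> f \<theta>. 0 < f \<theta>' y) \<and>
         integrable (arm_law \<nu> f \<theta>) (\<lambda>y. ln (f \<theta> y / f \<theta>' y))
      then ereal (\<integral>y. ln (f \<theta> y / f \<theta>' y) \<partial>arm_law \<nu> f \<theta>)
      else \<infinity>)"

definition obs_space :: "real measure \<Rightarrow> ('p \<Rightarrow> real \<Rightarrow> real) \<Rightarrow> 'p \<Rightarrow> (nat \<Rightarrow> real) measure" where
  "obs_space \<nu> f \<theta> = Pi\<^sub>M {1..} (\<lambda>_. arm_law \<nu> f \<theta>)"


section \<open>Point estimates and confidence upper bounds\<close>

text \<open>\<open>h k\<close> and \<open>g t k\<close> are Borel functions of the \<open>k\<close> observations \<open>S 1, \<dots>, S k\<close>, given as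
  the extensional function \<open>restrict S {1..k}\<close>.\<close>

definition estimators ::
  "real measure \<Rightarrow> 'p set \<Rightarrow> ('p \<Rightarrow> real \<Rightarrow> real) \<Rightarrow>
   (nat \<Rightarrow> (nat \<Rightarrow> real) \<Rightarrow> real) \<Rightarrow> (nat \<Rightarrow> nat \<Rightarrow> (nat \<Rightarrow> real) \<Rightarrow> real) \<Rightarrow> bool" where
  "estimators \<nu> H f h g \<longleftrightarrow>
     (\<forall>k\<ge>1. h k \<in> borel_measurable (Pi\<^sub>M {1..k} (\<lambda>_. borel))) \<and>
     (\<forall>t\<ge>1. \<forall>k\<ge>1. g t k \<in> borel_measurable (Pi\<^sub>M {1..k} (\<lambda>_. borel))) \<and>
     (\<forall>\<theta>\<in>H. \<forall>r<arm_mean \<nu> f \<theta>.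
        (\<lambda>t. 1 - measure (obs_space \<nu> f \<theta>)
                  {S \<in> space (obs_space \<nu> f \<theta>). \<forall>k\<in>{1..<t}. r \<le> g t k (restrict S {1..k})})
        \<in> o(\<lambda>t. 1 / real t)) \<and>
     (\<forall>\<theta>\<in>H. \<forall>\<theta>'\<in>H. arm_mean \<nu> f \<theta> < arm_mean \<nu> f \<theta>' \<longrightarrow>
        (\<exists>l. ((\<lambda>\<epsilon>. limsup (\<lambda>t. ereal
                 ((\<Sum>k\<in>{1..<t}. measure (obs_space \<nu> f \<theta>)
                     {S \<in> space (obs_space \<nu> f \<theta>).
                        arm_mean \<nu> f \<theta>' - \<epsilon> \<le> g t k (restrict S {1..k})}) / ln (real t))))
              \<longlongrightarrow> l) (at_right 0) \<and>
             l \<le> 1 / kl_dist \<nu> f \<theta> \<theta>')) \<and>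
     (\<forall>k\<ge>1. \<forall>t\<ge>1. \<forall>t'\<ge>t. \<forall>S. g t k (restrict S {1..k}) \<le> g t' k (restrict S {1..k})) \<and>
     (\<forall>k\<ge>1. \<forall>t\<ge>1. \<forall>S. h k (restrict S {1..k}) \<le> g t k (restrict S {1..k})) \<and>
     (\<forall>\<theta>\<in>H. \<forall>\<epsilon>>0. \<forall>\<delta>. 0 < \<delta> \<and> \<delta> < 1 \<longrightarrow>
        (\<lambda>t. measure (obs_space \<nu> f \<theta>)
               {S \<in> space (obs_space \<nu> f \<theta>).
                  \<epsilon> < (MAX k\<in>{k. \<delta> * real t \<le> real k \<and> k \<le> t}.
                         \<bar>h k (restrict S {1..k}) - arm_mean \<nu> f \<theta>\<bar>)})
        \<in> o(\<lambda>t. 1 / real t))"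


section \<open>Parameter sets\<close>

definition ranking ::
  "real measure \<Rightarrow> ('p \<Rightarrow> real \<Rightarrow> real) \<Rightarrow> nat \<Rightarrow> (nat \<Rightarrow> 'p) \<Rightarrow> (nat \<Rightarrow> nat) \<Rightarrow> bool" where
  "ranking \<nu> f N \<Theta> \<sigma> \<longleftrightarrow>
     \<sigma> permutes {1..N} \<and>
     (\<forall>i\<in>{1..N}. \<forall>j\<in>{1..N}. i \<le> j \<longrightarrow> arm_mean \<nu> f (\<Theta> (\<sigma> j)) \<le> arm_mean \<nu> f (\<Theta> (\<sigma> i)))"

lemma ranking_exists: "\<exists>\<sigma>. ranking \<nu> f N \<Theta> \<sigma>"
proof -
  define xs where "xs = sort_key (\<lambda>j. - arm_mean \<nu> f (\<Theta> j)) [1..<Suc N]"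
  define \<sigma> where "\<sigma> i = (if i \<in> {1..N} then xs ! (i - 1) else i)" for i
  have len: "length xs = N" and dist: "distinct xs" and set: "set xs = {1..N}"
    by (auto simp: xs_def simp del: upt_Suc)
  have sorted: "sorted (map (\<lambda>j. - arm_mean \<nu> f (\<Theta> j)) xs)"
    by (simp add: xs_def)
  have "inj_on \<sigma> {1..N}"
    using dist len by (auto simp: inj_on_def \<sigma>_def nth_eq_iff_index_eq)
  moreover have sub: "\<sigma> ` {1..N} \<subseteq> {1..N}"
  proof
    fix j assume "j \<in> \<sigma> ` {1..N}"
    then obtain i where "i \<in> {1..N}" "j = xs ! (i - 1)"
      by (auto simp: \<sigma>_def)
    then have "j \<in> set xs"
      using len by auto
    then show "j \<in> {1..N}"
      using set by simp
  qed
  ultimately have "bij_betw \<sigma> {1..N} {1..N}"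
    by (simp add: bij_betw_def endo_inj_surj)
  then have "\<sigma> permutes {1..N}"
    by (rule bij_imp_permutes) (simp only: \<sigma>_def if_False)
  moreover have "arm_mean \<nu> f (\<Theta> (\<sigma> j)) \<le> arm_mean \<nu> f (\<Theta> (\<sigma> i))"
    if "i \<in> {1..N}" "j \<in> {1..N}" "i \<le> j" for i j
    using sorted_nth_mono[OF sorted, of "i - 1" "j - 1"] that len by (auto simp: \<sigma>_def)
  ultimately show ?thesis
    unfolding ranking_def by blast
qed

text \<open>\<open>best_arm \<nu> f N \<Theta> i\<close> is the \<open>i\<close>th best arm, ties being broken in an arbitrary way.\<close>

definition best_arm ::
  "real measure \<Rightarrow> ('p \<Rightarrow> real \<Rightarrow> real) \<Rightarrow> nat \<Rightarrow> (nat \<Rightarrow> 'p) \<Rightarrow> nat \<Rightarrow> nat" where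
  "best_arm \<nu> f N \<Theta> = (SOME \<sigma>. ranking \<nu> f N \<Theta> \<sigma>)"

text \<open>No tie may involve one of the \<open>M\<close> best arms: neither among themselves nor, at the \<open>M\<close>th largest
  mean, with one of the remaining \<open>N - M\<close> arms.\<close>

definition param_sets ::
  "real measure \<Rightarrow> 'p set \<Rightarrow> ('p \<Rightarrow> real \<Rightarrow> real) \<Rightarrow> nat \<Rightarrow> nat \<Rightarrow> (nat \<Rightarrow> 'p) set" where
  "param_sets \<nu> H f N M =
     {\<Theta> \<in> {1..N} \<rightarrow> H. \<forall>i\<in>{1..M}.
        0 \<le> arm_mean \<nu> f (\<Theta> (best_arm \<nu> f N \<Theta> i)) \<and>
        (\<forall>j\<in>{1..N}. i < j \<longrightarrow>
           arm_mean \<nu> f (\<Theta> (best_arm \<nu> f N \<Theta> j)) < arm_mean \<nu> f (\<Theta> (best_arm \<nu> f N \<Theta> i)))}"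


section \<open>Decentralized policies\<close>

text \<open>The local history of a player before time \<open>t\<close> assigns to each past time in \<open>{1..<t}\<close> the arm it
  played, the state it observed and whether it was involved in a collision. \<open>\<pi> i t\<close> maps the local
  history of player \<open>i\<close> before time \<open>t\<close> to the arm it plays at time \<open>t\<close>. Measurability makes the
  expected reward meaningful.\<close>

type_synonym history = "nat \<Rightarrow> nat \<times> real \<times> bool"
type_synonym local_policy = "nat \<Rightarrow> history \<Rightarrow> nat"
type_synonym policy = "nat \<Rightarrow> local_policy"

definition history_space :: "nat \<Rightarrow> history measure" where
  "history_space t =
     Pi\<^sub>M {1..<t} (\<lambda>_. count_space UNIV \<Otimes>\<^sub>M (borel \<Otimes>\<^sub>M count_space UNIV))"

definition decentralized_policy :: "nat \<Rightarrow> nat \<Rightarrow> policy \<Rightarrow> bool" where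
  "decentralized_policy N M \<pi> \<longleftrightarrow>
     (\<forall>i\<in>{1..M}. \<forall>t\<ge>1. \<pi> i t \<in> history_space t \<rightarrow>\<^sub>M count_space {1..N})"

lemma restrict_cong_fundef [fundef_cong]:
  "A = B \<Longrightarrow> (\<And>x. x \<in> B \<Longrightarrow> f x = g x) \<Longrightarrow> restrict f A = restrict g B"
  by (auto simp: restrict_def)

text \<open>\<open>action M \<pi> S t i\<close> is the arm played by player \<open>i\<close> at time \<open>t\<close> when \<open>S (j, t)\<close> is the state of
  arm \<open>j\<close> at time \<open>t\<close>.\<close>

function action :: "nat \<Rightarrow> policy \<Rightarrow> (nat \<times> nat \<Rightarrow> real) \<Rightarrow> nat \<Rightarrow> nat \<Rightarrow> nat" where
  "action M \<pi> S t i =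
     \<pi> i t (\<lambda>r\<in>{1..<t}.
       (action M \<pi> S r i,
        S (action M \<pi> S r i, r),
        \<exists>j\<in>{1..M}. j \<noteq> i \<and> action M \<pi> S r j = action M \<pi> S r i))"
  by pat_completeness auto
termination
  by (relation "Wellfounded.measure (\<lambda>(M, \<pi>, S, t, i). t)") auto

declare action.simps [simp del]


section \<open>Rewards and regret\<close>

text \<open>\<open>Shared\<close>: colliding players share the reward of the arm, so that it is accrued once.
  \<open>Lost\<close>: colliding players obtain no reward.\<close>

datatype collision_model = Shared | Lost

fun rewarded :: "collision_model \<Rightarrow> nat \<Rightarrow> (nat \<Rightarrow> nat) \<Rightarrow> nat \<Rightarrow> bool" where
  "rewarded Shared M a j \<longleftrightarrow> (\<exists>i\<in>{1..M}. a i = j)"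
| "rewarded Lost M a j \<longleftrightarrow> (\<exists>!i. i \<in> {1..M} \<and> a i = j)"

definition total_reward ::
  "collision_model \<Rightarrow> nat \<Rightarrow> nat \<Rightarrow> policy \<Rightarrow> (nat \<times> nat \<Rightarrow> real) \<Rightarrow> nat \<Rightarrow> real" where
  "total_reward c N M \<pi> S t =
     (\<Sum>j\<in>{1..N}. of_bool (rewarded c M (action M \<pi> S t) j) * S (j, t))"

definition state_space ::
  "real measure \<Rightarrow> ('p \<Rightarrow> real \<Rightarrow> real) \<Rightarrow> nat \<Rightarrow> (nat \<Rightarrow> 'p) \<Rightarrow> (nat \<times> nat \<Rightarrow> real) measure" where
  "state_space \<nu> f N \<Theta> = Pi\<^sub>M ({1..N} \<times> {1..}) (\<lambda>(j, t). arm_law \<nu> f (\<Theta> j))"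

definition regret ::
  "real measure \<Rightarrow> ('p \<Rightarrow> real \<Rightarrow> real) \<Rightarrow> nat \<Rightarrow> nat \<Rightarrow> collision_model \<Rightarrow> policy \<Rightarrow>
   (nat \<Rightarrow> 'p) \<Rightarrow> nat \<Rightarrow> real" where
  "regret \<nu> f N M c \<pi> \<Theta> T =
     real T * (\<Sum>j\<in>{1..M}. arm_mean \<nu> f (\<Theta> (best_arm \<nu> f N \<Theta> j)))
     - (\<integral>S. (\<Sum>t\<in>{1..T}. total_reward c N M \<pi> S t) \<partial>state_space \<nu> f N \<Theta>)"

definition uniformly_good ::
  "real measure \<Rightarrow> 'p set \<Rightarrow> ('p \<Rightarrow> real \<Rightarrow> real) \<Rightarrow> nat \<Rightarrow> nat \<Rightarrow> collision_model \<Rightarrow> policy \<Rightarrow> bool" where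
  "uniformly_good \<nu> H f N M c \<pi> \<longleftrightarrow>
     decentralized_policy N M \<pi> \<and>
     (\<forall>\<Theta>\<in>param_sets \<nu> H f N M. \<forall>b>0. regret \<nu> f N M c \<pi> \<Theta> \<in> o(\<lambda>T. real T powr b))"

text \<open>Optimality refers to the order of growth: under no parameter set does any uniformly good
  decentralized policy achieve a smaller order of the regret.\<close>

definition optimal_policy ::
  "real measure \<Rightarrow> 'p set \<Rightarrow> ('p \<Rightarrow> real \<Rightarrow> real) \<Rightarrow> nat \<Rightarrow> nat \<Rightarrow> collision_model \<Rightarrow> policy \<Rightarrow> bool" where
  "optimal_policy \<nu> H f N M c \<pi> \<longleftrightarrow>
     uniformly_good \<nu> H f N M c \<pi> \<and>
     (\<forall>\<pi>'. uniformly_good \<nu> H f N M c \<pi>' \<longrightarrow>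
        (\<forall>\<Theta>\<in>param_sets \<nu> H f N M. regret \<nu> f N M c \<pi> \<Theta> \<in> O(regret \<nu> f N M c \<pi>' \<Theta>)))"

end

theory Submission
  imports Defs "HOL-Real_Asymp.Real_Asymp"
begin

text \<open>
  Which arms are rewarded at time \<open>t\<close> is decided by the past, hence independent of the states at time
  \<open>t\<close>. The regret is therefore the expected sum over time of a \<^emph>\<open>gap\<close>, the difference between the sum
  of the \<open>M\<close> largest means and the sum of the means of the rewarded arms
  (\<open>regret_eq_expected_gap\<close>). The gap is nonnegative, bounded, and takes finitely many values, so
  both bounds come down to counting the times at which it is positive. An optimal policy exists as
  soon as some uniformly good policy has regret \<open>O(ln T)\<close> while every uniformly good policy has regret
  at least \<open>L ln T\<close>; every other optimal policy then inherits the upper bound from the definition of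
  optimality.

  \<^bold>\<open>Lower bound.\<close> Take an arm \<open>j\<close> outside the \<open>M\<close> best and change its parameter so that it becomes the
  best arm with a positive mean. Under the original parameters each time at which some player plays \<open>j\<close>
  costs a positive constant; under the changed ones each time at which nobody plays \<open>j\<close> does. A policy
  that is good under both must tell the two apart, and the evidence it collects, the log-likelihood
  ratio of the observed states of \<open>j\<close>, has an expected absolute value of at most a constant times the
  expected number of plays of \<open>j\<close>. An error probability of order \<open>T powr (- 1 / 2)\<close> under the changed parameters forces this
  number to be of order \<open>ln T\<close> (\<open>change_of_measure\<close>, \<open>plays_needed_to_separate\<close>,
  \<open>regret_at_least_logarithmic\<close>). Since only the order matters, Markov's inequality for the absolute
  log-likelihood ratio replaces a law of large numbers.

  \<^bold>\<open>Upper bound.\<close> Each player works on its own observations and divides time into rounds of \<open>M\<close> periods.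
  At the start of a round it selects the \<open>M\<close> arms with the largest confidence upper bounds, sorts them
  by their point estimates, and plays each of them once during the round, starting at a position that
  depends on the index of the player. If all players have the right list then no two of them collide
  and the gap is zero. Rotating through the list, instead of assigning one rank to each player, is what
  makes the confidence \<^emph>\<open>upper\<close> bounds sufficient: to recognise the second best arm one must know that
  the best one is better, and the round makes sure that both are sampled.

  A wrong list can be blamed on one of three events (\<open>wrong_plan_charged\<close>): the upper bound of one of
  the \<open>M\<close> best arms is too small; an arm outside the \<open>M\<close> best is on the list because its upper bound
  is large; or an arm on the list has an inaccurate point estimate. In the last two cases the arm
  is sampled in that very round, so the event occurs at most once for each number \<open>k\<close> of samples of the arm
  (\<open>sum_over_planned_rounds\<close>), and the sum over rounds becomes a sum over \<open>k\<close>, to which the conditions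
  on the estimators apply. The conditions concern i.i.d. observations, whereas a player selects the times at which
  it samples an arm; optional skipping (\<open>optional_skipping\<close>) shows that the selected observations may
  be treated as an i.i.d. sequence.
\<close>

section \<open>Product measures one coordinate at a time\<close>

text \<open>Fubini for one coordinate of a possibly infinite product. The outer measure does not involve
  \<open>\<mu> i\<close>, so two products that differ in the factor \<open>i\<close> only can be compared by comparing the inner
  integrals.\<close>
lemma nn_integral_PiM_split:
  assumes \<mu>: "\<And>a. a \<in> I \<Longrightarrow> prob_space (\<mu> a)" and i: "i \<in> I"
    and F: "F \<in> borel_measurable (PiM I \<mu>)"
  shows "(\<integral>\<^sup>+S. F S \<partial>PiM I \<mu>) = (\<integral>\<^sup>+X. (\<integral>\<^sup>+x. F (X(i := x)) \<partial>\<mu> i) \<partial>PiM (I - {i}) \<mu>)"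
proof -
  interpret i: prob_space "\<mu> i" using \<mu> i by blast
  interpret R: prob_space "PiM (I - {i}) \<mu>" using \<mu> by (intro prob_space_PiM) auto
  interpret P: pair_sigma_finite "\<mu> i" "PiM (I - {i}) \<mu>" ..
  have ins: "insert i (I - {i}) = I" using i by blast
  have upd [measurable]: "(\<lambda>(x, X). X(i := x)) \<in> \<mu> i \<Otimes>\<^sub>M PiM (I - {i}) \<mu> \<rightarrow>\<^sub>M PiM I \<mu>"
    using i unfolding split_beta' by (intro measurable_fun_upd[of I "I - {i}" i]) auto
  have "(\<integral>\<^sup>+S. F S \<partial>PiM I \<mu>) = (\<integral>\<^sup>+S. F S \<partial>distr (\<mu> i \<Otimes>\<^sub>M PiM (I - {i}) \<mu>) (PiM I \<mu>) (\<lambda>(x, X). X(i := x)))"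
    using distr_pair_PiM_eq_PiM[of "I - {i}" \<mu> i] \<mu> i by (simp add: insert_absorb)
  also have "\<dots> = (\<integral>\<^sup>+z. F ((\<lambda>(x, X). X(i := x)) z) \<partial>(\<mu> i \<Otimes>\<^sub>M PiM (I - {i}) \<mu>))"
    using F by (intro nn_integral_distr upd) simp
  also have "\<dots> = (\<integral>\<^sup>+X. (\<integral>\<^sup>+x. F (X(i := x)) \<partial>\<mu> i) \<partial>PiM (I - {i}) \<mu>)"
    using measurable_compose[OF upd F] by (subst P.nn_integral_snd[symmetric]) (simp_all add: split_beta')
  finally show ?thesis .
qed

text \<open>A predictable event at the time of coordinate \<open>i\<close> is independent of the state drawn there; this is
  the form in which independence over time enters the rewards and the log-likelihood ratio.\<close>
lemma expectation_PiM_of_bool_mult: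
  fixes v :: "'b \<Rightarrow> real"
  assumes \<mu>: "\<And>a. a \<in> I \<Longrightarrow> prob_space (\<mu> a)" and i: "i \<in> I"
    and P [measurable]: "Measurable.pred (PiM I \<mu>) P"
    and indep: "\<And>S x. P (S(i := x)) \<longleftrightarrow> P S"
    and v: "integrable (\<mu> i) v"
  shows "integrable (PiM I \<mu>) (\<lambda>S. of_bool (P S) * v (S i))" (is ?int)
    and "(\<integral>S. of_bool (P S) * v (S i) \<partial>PiM I \<mu>) = measure (PiM I \<mu>) {S \<in> space (PiM I \<mu>). P S} * (\<integral>x. v x \<partial>\<mu> i)" (is ?eq)
proof -
  interpret PI: prob_space "PiM I \<mu>" using \<mu> by (intro prob_space_PiM) auto
  interpret i: prob_space "\<mu> i" using \<mu> i by blast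
  have vm [measurable]: "v \<in> borel_measurable (\<mu> i)" using v by auto
  have sm [measurable]: "(\<lambda>S. S i) \<in> PiM I \<mu> \<rightarrow>\<^sub>M \<mu> i" using i by simp
  define p where "p = emeasure (PiM I \<mu>) {S \<in> space (PiM I \<mu>). P S}"
  have p: "p = ennreal (measure (PiM I \<mu>) {S \<in> space (PiM I \<mu>). P S})"
    by (simp add: p_def PI.emeasure_eq_measure)
  have key: "(\<integral>\<^sup>+S. of_bool (P S) * w (S i) \<partial>PiM I \<mu>) = p * (\<integral>\<^sup>+x. w x \<partial>\<mu> i)"
    if w [measurable]: "w \<in> borel_measurable (\<mu> i)" for w :: "'b \<Rightarrow> ennreal"
  proof -
    have F: "(\<integral>\<^sup>+S. of_bool (P S) * u (S i) \<partial>PiM I \<mu>)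
        = (\<integral>\<^sup>+X. of_bool (P X) * (\<integral>\<^sup>+x. u x \<partial>\<mu> i) \<partial>PiM (I - {i}) \<mu>)"
      if u [measurable]: "u \<in> borel_measurable (\<mu> i)" for u :: "'b \<Rightarrow> ennreal"
      by (subst nn_integral_PiM_split[OF \<mu> i]) (simp_all add: indep nn_integral_cmult)
    have "p = (\<integral>\<^sup>+S. of_bool (P S) * 1 \<partial>PiM I \<mu>)"
      unfolding p_def by (simp add: of_bool_def flip: nn_integral_indicator)
        (intro nn_integral_cong, auto simp: indicator_def)
    also have "\<dots> = (\<integral>\<^sup>+X. of_bool (P X) \<partial>PiM (I - {i}) \<mu>)"
      using F[of "\<lambda>_. 1"] by (simp add: i.emeasure_space_1)
    finally have p': "p = (\<integral>\<^sup>+X. of_bool (P X) \<partial>PiM (I - {i}) \<mu>)" .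
    obtain x0 where x0: "x0 \<in> space (\<mu> i)" using i.not_empty by blast
    have "(\<lambda>X. X(i := x0)) \<in> PiM (I - {i}) \<mu> \<rightarrow>\<^sub>M PiM I \<mu>"
      using i x0
      by (intro measurable_fun_upd[of I "I - {i}" i]) auto
    from measurable_compose[OF this P] have [measurable]: "Measurable.pred (PiM (I - {i}) \<mu>) P"
      by (simp add: indep)
    show ?thesis
      unfolding F[OF w] p' by (subst nn_integral_multc) simp_all
  qed
  show ?int
  proof (rule integrableI_bounded)
    have "(\<integral>\<^sup>+S. ennreal (norm (of_bool (P S) * v (S i))) \<partial>PiM I \<mu>)
        = (\<integral>\<^sup>+S. of_bool (P S) * ennreal \<bar>v (S i)\<bar> \<partial>PiM I \<mu>)"
      by (intro nn_integral_cong) (auto simp: abs_mult)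
    also have "\<dots> = p * (\<integral>\<^sup>+x. ennreal \<bar>v x\<bar> \<partial>\<mu> i)" by (intro key) simp
    also have "\<dots> < \<infinity>"
      using v by (auto simp: p ennreal_mult_less_top integrable_iff_bounded)
    finally show "(\<integral>\<^sup>+S. ennreal (norm (of_bool (P S) * v (S i))) \<partial>PiM I \<mu>) < \<infinity>" .
  qed simp
  have pos: "(\<integral>\<^sup>+S. ennreal (of_bool (P S) * v (S i)) \<partial>PiM I \<mu>) = p * (\<integral>\<^sup>+x. ennreal (v x) \<partial>\<mu> i)"
    by (subst key[symmetric]) (auto intro!: nn_integral_cong)
  have neg: "(\<integral>\<^sup>+S. ennreal (- (of_bool (P S) * v (S i))) \<partial>PiM I \<mu>) = p * (\<integral>\<^sup>+x. ennreal (- v x) \<partial>\<mu> i)"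
    by (subst key[symmetric]) (auto intro!: nn_integral_cong)
  show ?eq
    unfolding real_lebesgue_integral_def[OF \<open>?int\<close>] real_lebesgue_integral_def[OF v] pos neg
    by (simp add: p enn2real_mult right_diff_distrib)
qed

text \<open>Invariance under replacing a fresh value by an observed one, which drives optional skipping.\<close>
lemma nn_integral_PiM_resample:
  assumes \<mu>: "\<And>a. a \<in> I \<Longrightarrow> prob_space (\<mu> a)" and i: "i \<in> I"
    and F: "F \<in> borel_measurable (PiM I \<mu>)"
  shows "(\<integral>\<^sup>+x. (\<integral>\<^sup>+S. F (S(i := x)) \<partial>PiM I \<mu>) \<partial>\<mu> i) = (\<integral>\<^sup>+S. F S \<partial>PiM I \<mu>)"
proof -
  interpret i: prob_space "\<mu> i" using \<mu> i by blast
  interpret R: prob_space "PiM (I - {i}) \<mu>" using \<mu> by (intro prob_space_PiM) auto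
  interpret P: pair_sigma_finite "\<mu> i" "PiM (I - {i}) \<mu>" ..
  have upd: "(\<lambda>(x, X). X(i := x)) \<in> \<mu> i \<Otimes>\<^sub>M PiM (I - {i}) \<mu> \<rightarrow>\<^sub>M PiM I \<mu>"
    using i unfolding split_beta' by (intro measurable_fun_upd[of I "I - {i}" i]) auto
  have "(\<integral>\<^sup>+S. F (S(i := x)) \<partial>PiM I \<mu>) = (\<integral>\<^sup>+X. F (X(i := x)) \<partial>PiM (I - {i}) \<mu>)"
    if x: "x \<in> space (\<mu> i)" for x
  proof -
    have "(\<lambda>S. S(i := x)) \<in> PiM I \<mu> \<rightarrow>\<^sub>M PiM I \<mu>"
      using i x by (intro measurable_fun_upd[of I I i]) auto
    then show ?thesis
      by (subst nn_integral_PiM_split[OF \<mu> i]) (simp_all add: measurable_compose[OF _ F] i.emeasure_space_1)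
  qed
  then have "(\<integral>\<^sup>+x. (\<integral>\<^sup>+S. F (S(i := x)) \<partial>PiM I \<mu>) \<partial>\<mu> i)
      = (\<integral>\<^sup>+x. (\<integral>\<^sup>+X. F (X(i := x)) \<partial>PiM (I - {i}) \<mu>) \<partial>\<mu> i)"
    by (intro nn_integral_cong) simp
  also have "\<dots> = (\<integral>\<^sup>+X. (\<integral>\<^sup>+x. F (X(i := x)) \<partial>\<mu> i) \<partial>PiM (I - {i}) \<mu>)"
    using measurable_compose[OF upd F] by (intro P.Fubini'[symmetric]) (simp add: split_beta')
  also have "\<dots> = (\<integral>\<^sup>+S. F S \<partial>PiM I \<mu>)"
    by (rule nn_integral_PiM_split[OF \<mu> i F, symmetric])
  finally show ?thesis .
qed

lemma (in prob_space) expectation_of_bool: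
  assumes P: "Measurable.pred M P"
  shows "integrable M (\<lambda>x. of_bool (P x) :: real)" and "expectation (\<lambda>x. of_bool (P x) :: real) = prob {x \<in> space M. P x}"
proof -
  show "integrable M (\<lambda>x. of_bool (P x) :: real)"
    using P by (intro integrable_const_bound[of _ 1]) auto
  have "expectation (\<lambda>x. of_bool (P x) :: real) = expectation (indicator {x \<in> space M. P x})"
    by (intro Bochner_Integration.integral_cong) (auto simp: indicator_def)
  then show "expectation (\<lambda>x. of_bool (P x) :: real) = prob {x \<in> space M. P x}" using P by simp
qed

lemma (in prob_space) expectation_sum_of_bool:
  assumes "\<And>k. k \<in> A \<Longrightarrow> Measurable.pred M (P k)"
  shows "integrable M (\<lambda>x. \<Sum>k\<in>A. of_bool (P k x) :: real)"
    and "expectation (\<lambda>x. \<Sum>k\<in>A. of_bool (P k x) :: real) = (\<Sum>k\<in>A. prob {x \<in> space M. P k x})"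
proof -
  have int: "integrable M (\<lambda>x. of_bool (P k x) :: real)" if "k \<in> A" for k
    using assms[OF that] by (rule expectation_of_bool(1))
  then show "integrable M (\<lambda>x. \<Sum>k\<in>A. of_bool (P k x) :: real)"
    by (rule Bochner_Integration.integrable_sum)
  have "expectation (\<lambda>x. \<Sum>k\<in>A. of_bool (P k x) :: real) = (\<Sum>k\<in>A. expectation (\<lambda>x. of_bool (P k x)))"
    using int by (rule Bochner_Integration.integral_sum)
  also have "\<dots> = (\<Sum>k\<in>A. prob {x \<in> space M. P k x})"
    by (intro sum.cong refl expectation_of_bool(2) assms)
  finally show "expectation (\<lambda>x. \<Sum>k\<in>A. of_bool (P k x) :: real) = (\<Sum>k\<in>A. prob {x \<in> space M. P k x})" .
qed

lemma (in prob_space) expectation_1_plus: "integrable M X \<Longrightarrow> expectation (\<lambda>x. 1 + X x) = 1 + expectation X" for X :: "'a \<Rightarrow> real"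
  by (simp add: prob_space)

text \<open>A quantity that is determined up to time \<open>T\<close> does not see the laws of later states. Coordinates
  outside \<open>I\<close> are \<open>undefined\<close>, which is why agreement on \<open>J\<close> is required of extensional functions
  only.\<close>
lemma nn_integral_PiM_cong_on:
  assumes \<mu>: "\<And>a. a \<in> I \<Longrightarrow> prob_space (\<mu> a)" "\<And>a. a \<in> I \<Longrightarrow> prob_space (\<mu>' a)"
    and sets: "\<And>a. a \<in> I \<Longrightarrow> sets (\<mu> a) = sets (\<mu>' a)"
    and J: "J \<subseteq> I" and eq: "\<And>a. a \<in> J \<Longrightarrow> \<mu> a = \<mu>' a"
    and F: "F \<in> borel_measurable (PiM I \<mu>)" 
    and dep: "\<And>S S'. S \<in> extensional I \<Longrightarrow> S' \<in> extensional I \<Longrightarrow> (\<And>a. a \<in> J \<Longrightarrow> S a = S' a) \<Longrightarrow> F S = F S'"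
  shows "(\<integral>\<^sup>+S. F S \<partial>PiM I \<mu>) = (\<integral>\<^sup>+S. F S \<partial>PiM I \<mu>')"
proof -
  interpret prob_space "PiM I \<mu>" using \<mu> by (intro prob_space_PiM) auto
  obtain z where z: "z \<in> space (PiM I \<mu>)" using not_empty by blast
  have F': "F \<in> borel_measurable (PiM I \<mu>')"
    using F by (simp add: measurable_cong_sets[OF sets_PiM_cong[OF refl sets] refl])
  have sp: "space (PiM I \<mu>) = space (PiM I \<mu>')"
    by (intro sets_eq_imp_space_eq sets_PiM_cong refl sets)
  \<comment> \<open>the coordinates outside \<open>J\<close> are filled in from a fixed point \<open>z\<close>, so that \<open>F\<close> factors through the restriction to \<open>J\<close>\<close>
  define E where "E y = (\<lambda>a\<in>I. if a \<in> J then y a else z a)" for y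
  have project: "(\<integral>\<^sup>+S. F S \<partial>PiM I \<kappa>) = (\<integral>\<^sup>+y. F (E y) \<partial>PiM J \<kappa>)"
    if \<kappa>: "\<And>a. a \<in> I \<Longrightarrow> prob_space (\<kappa> a)" and Fl: "F \<in> borel_measurable (PiM I \<kappa>)"
      and z: "z \<in> space (PiM I \<kappa>)" for \<kappa>
  proof -
    have "E \<in> PiM J \<kappa> \<rightarrow>\<^sub>M PiM I \<kappa>"
      unfolding E_def
    proof (rule measurable_restrict)
      fix a assume a: "a \<in> I"
      then have "z a \<in> space (\<kappa> a)" using z by (auto simp: space_PiM)
      then show "(\<lambda>y. if a \<in> J then y a else z a) \<in> PiM J \<kappa> \<rightarrow>\<^sub>M \<kappa> a" by (cases "a \<in> J") auto
    qed
    then have m: "(\<lambda>y. F (E y)) \<in> borel_measurable (PiM J \<kappa>)" using Fl by (rule measurable_compose)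
    have "(\<integral>\<^sup>+S. F S \<partial>PiM I \<kappa>) = (\<integral>\<^sup>+S. F (E (\<lambda>a\<in>J. S a)) \<partial>PiM I \<kappa>)"
      using J by (intro nn_integral_cong dep) (auto simp: E_def space_PiM PiE_def)
    also have "\<dots> = (\<integral>\<^sup>+y. F (E y) \<partial>distr (PiM I \<kappa>) (PiM J \<kappa>) (\<lambda>S. \<lambda>a\<in>J. S a))"
      using J by (intro nn_integral_distr[symmetric] measurable_restrict_subset) (auto simp: m)
    also have "\<dots> = (\<integral>\<^sup>+y. F (E y) \<partial>PiM J \<kappa>)"
      using distr_PiM_reindex[where K = I and I = J and M = \<kappa> and f = "\<lambda>a. a"] \<kappa> J by (simp add: subset_eq Pi_def)
    finally show ?thesis .
  qed
  have "PiM J \<mu> = PiM J \<mu>'" using eq by (intro PiM_cong) auto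
  then show ?thesis using project[OF \<mu>(1) F z] project[OF \<mu>(2) F'] z sp by simp
qed

section \<open>Sampling at predictable times\<close>
text \<open>The sequence \<open>v\<close> is observed at the times \<open>t \<ge> 1\<close> with \<open>p t\<close>.\<close>
definition hits :: "(nat \<Rightarrow> bool) \<Rightarrow> nat \<Rightarrow> nat" where
  "hits p t = card {r \<in> {1..t}. p r}"

text \<open>The \<open>k\<close>th observed value, written as a sum with at most one nonzero term: this makes it total and
  visibly measurable, with value \<open>0\<close> as long as there are fewer than \<open>k\<close> observations.\<close>
definition sample :: "(nat \<Rightarrow> bool) \<Rightarrow> (nat \<Rightarrow> real) \<Rightarrow> nat \<Rightarrow> nat \<Rightarrow> real" where
  "sample p v t k = (\<Sum>r\<in>{1..t}. of_bool (p r \<and> hits p r = k) * v r)"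

text \<open>The continuation \<open>y\<close> turns the random number of observed values into one point of a fixed sequence
  space, where their law can be stated.\<close>
definition completed :: "(nat \<Rightarrow> bool) \<Rightarrow> (nat \<Rightarrow> real) \<Rightarrow> nat \<Rightarrow> (nat \<Rightarrow> real) \<Rightarrow> nat \<Rightarrow> real" where
  "completed p v t y = (\<lambda>k\<in>{1..}. if k \<le> hits p t then sample p v t k else y k)"

lemma hits_0 [simp]: "hits p 0 = 0"
  by (simp add: hits_def)

lemma hits_eq_sum: "hits p t = (\<Sum>r\<in>{1..t}. of_bool (p r))"
  by (simp add: hits_def of_bool_def sum.If_cases Int_def)

lemma hits_Suc: "hits p (Suc t) = hits p t + of_bool (p (Suc t))"
  by (simp add: hits_eq_sum)

lemma hits_mono: "t \<le> t' \<Longrightarrow> hits p t \<le> hits p t'"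
  unfolding hits_def by (intro card_mono) auto

lemma hits_cong: "(\<And>r. 1 \<le> r \<Longrightarrow> r \<le> t \<Longrightarrow> p r \<longleftrightarrow> p' r) \<Longrightarrow> hits p t = hits p' t"
  unfolding hits_def by (intro arg_cong[of _ _ card]) auto

lemma sample_Suc:
  "sample p v (Suc t) k = sample p v t k + of_bool (p (Suc t) \<and> k = Suc (hits p t)) * v (Suc t)"
  by (auto simp: sample_def hits_Suc)

lemma sample_eq_0: "hits p t < k \<Longrightarrow> sample p v t k = 0"
  unfolding sample_def using hits_mono[of _ t p] by (intro sum.neutral) (auto simp: leD)

lemma sample_cong:
  "(\<And>r. 1 \<le> r \<Longrightarrow> r \<le> t \<Longrightarrow> p r \<longleftrightarrow> p' r) \<Longrightarrow> (\<And>r. 1 \<le> r \<Longrightarrow> r \<le> t \<Longrightarrow> p r \<Longrightarrow> v r = v' r) \<Longrightarrow>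
     sample p v t k = sample p' v' t k"
  unfolding sample_def by (intro sum.cong) (auto simp: hits_cong[of _ p p'])

lemma sample_stable: "t \<le> t' \<Longrightarrow> k \<le> hits p t \<Longrightarrow> sample p v t' k = sample p v t k"
  by (induction t' rule: dec_induct) (use hits_mono[of t _ p] in \<open>fastforce simp: sample_Suc\<close>)+

lemma completed_cong:
  assumes "\<And>r. 1 \<le> r \<Longrightarrow> r \<le> t \<Longrightarrow> p r \<longleftrightarrow> p' r" "\<And>r. 1 \<le> r \<Longrightarrow> r \<le> t \<Longrightarrow> p r \<Longrightarrow> v r = v' r"
  shows "completed p v t y = completed p' v' t y"
proof -
  have "hits p t = hits p' t" using assms(1) by (rule hits_cong)
  moreover have "sample p v t = sample p' v' t" using assms by (intro ext sample_cong)
  ultimately show ?thesis unfolding completed_def by (intro ext) (simp only: restrict_def)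
qed

text \<open>A new observation replaces exactly the first entry that is still taken from \<open>y\<close>.\<close>
lemma completed_Suc:
  "completed p v (Suc t) y =
     completed p v t (if p (Suc t) then y(Suc (hits p t) := v (Suc t)) else y)"
  by (auto simp: completed_def fun_eq_iff sample_Suc hits_Suc sample_eq_0 restrict_def le_Suc_eq)

lemma measurable_hits [measurable (raw)]:
  assumes "\<And>r. 1 \<le> r \<Longrightarrow> r \<le> t \<Longrightarrow> Measurable.pred M (\<lambda>x. p x r)"
  shows "(\<lambda>x. hits (p x) t) \<in> M \<rightarrow>\<^sub>M count_space UNIV"
  using assms
proof (induction t)
  case (Suc t)
  have [measurable]: "Measurable.pred M (\<lambda>x. p x (Suc t))" "(\<lambda>x. hits (p x) t) \<in> M \<rightarrow>\<^sub>M count_space UNIV"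
    using Suc by auto
  show ?case unfolding hits_Suc of_bool_def by measurable
qed simp

lemma measurable_sample [measurable (raw)]:
  assumes "\<And>r. 1 \<le> r \<Longrightarrow> r \<le> t \<Longrightarrow> Measurable.pred M (\<lambda>x. p x r)"
    and "\<And>r. 1 \<le> r \<Longrightarrow> r \<le> t \<Longrightarrow> (\<lambda>x. v x r) \<in> borel_measurable M"
  shows "(\<lambda>x. sample (p x) (v x) t k) \<in> borel_measurable M"
  using assms
proof (induction t)
  case 0
  then show ?case by (simp add: sample_def)
next
  case (Suc t)
  have [measurable]: "Measurable.pred M (\<lambda>x. p x (Suc t))" "(\<lambda>x. v x (Suc t)) \<in> borel_measurable M"
      "(\<lambda>x. hits (p x) t) \<in> M \<rightarrow>\<^sub>M count_space UNIV" "(\<lambda>x. sample (p x) (v x) t k) \<in> borel_measurable M"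
    using Suc by (auto intro!: measurable_hits)
  show ?case unfolding sample_Suc by measurable
qed

lemma measurable_completed:
  assumes p: "\<And>r. 1 \<le> r \<Longrightarrow> r \<le> t \<Longrightarrow> Measurable.pred M (\<lambda>x. p x r)"
    and v: "\<And>r. 1 \<le> r \<Longrightarrow> r \<le> t \<Longrightarrow> (\<lambda>x. v x r) \<in> borel_measurable M"
    and y: "y \<in> M \<rightarrow>\<^sub>M PiM {1..} (\<lambda>_. \<rho>)" and \<rho>: "sets \<rho> = sets borel"
  shows "(\<lambda>x. completed (p x) (v x) t (y x)) \<in> M \<rightarrow>\<^sub>M PiM {1..} (\<lambda>_. \<rho>)"
  unfolding completed_def
proof (rule measurable_restrict)
  fix k :: nat assume k: "k \<in> {1..}"
  have [measurable]: "(\<lambda>x. y x k) \<in> borel_measurable M"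
    using measurable_compose[OF y measurable_component_singleton[OF k]]
    by (simp add: measurable_cong_sets[OF refl \<rho>])
  note [measurable] = measurable_hits[OF p] measurable_sample[OF p v]
  have "(\<lambda>x. if k \<le> hits (p x) t then sample (p x) (v x) t k else y x k) \<in> borel_measurable M"
    by measurable
  then show "(\<lambda>x. if k \<le> hits (p x) t then sample (p x) (v x) t k else y x k) \<in> M \<rightarrow>\<^sub>M \<rho>"
    by (simp add: measurable_cong_sets[OF refl \<rho>])
qed

lemma borel_measurable_integral_completed:
  assumes \<rho>: "sets \<rho> = sets borel" "prob_space \<rho>"
    and p: "\<And>t. 1 \<le> t \<Longrightarrow> Measurable.pred M (\<lambda>S. p S t)"
    and v: "\<And>t. 1 \<le> t \<Longrightarrow> (\<lambda>S. v S t) \<in> borel_measurable M"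
    and \<phi>: "\<phi> \<in> borel_measurable (PiM {1..} (\<lambda>_. \<rho>))"
  shows "(\<lambda>S. \<integral>\<^sup>+Y. \<phi> (completed (p S) (v S) T Y) \<partial>PiM {1..} (\<lambda>_. \<rho>)) \<in> borel_measurable M"
proof -
  let ?Y = "PiM {1..} (\<lambda>_. \<rho>)"
  interpret Y: prob_space ?Y using \<rho>(2) by (intro prob_space_PiM)
  have "(\<lambda>z. completed (p (fst z)) (v (fst z)) T (snd z)) \<in> M \<Otimes>\<^sub>M ?Y \<rightarrow>\<^sub>M ?Y"
    by (rule measurable_completed[OF _ _ _ \<rho>(1)])
      (auto intro: measurable_compose[OF measurable_fst p] measurable_compose[OF measurable_fst v])
  from measurable_compose[OF this \<phi>] show ?thesis
    by (intro Y.borel_measurable_nn_integral) (simp add: split_beta')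
qed

text \<open>Whether to observe the coordinate \<open>e t\<close> may depend on the coordinates at earlier times, not on those from time
  \<open>t\<close> on. If the observed values are completed by a fresh i.i.d. sequence then the result is i.i.d. at
  every time \<open>T\<close>: passing from \<open>T\<close> to \<open>Suc T\<close> either changes nothing or replaces a fresh entry by an
  independent value with the same law. The completion makes all statements about the observed values,
  however many there are, statements about one sequence with a known law.\<close>
theorem optional_skipping:
  fixes e :: "nat \<Rightarrow> 'i" and p :: "('i \<Rightarrow> real) \<Rightarrow> nat \<Rightarrow> bool"
  assumes \<mu>: "\<And>a. a \<in> I \<Longrightarrow> prob_space (\<mu> a)"
    and \<rho>: "sets \<rho> = sets borel"
    and e: "\<And>t. 1 \<le> t \<Longrightarrow> e t \<in> I \<and> \<mu> (e t) = \<rho>" "inj_on e {1..}"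
    and p: "\<And>t. 1 \<le> t \<Longrightarrow> Measurable.pred (PiM I \<mu>) (\<lambda>S. p S t)"
    and predictable: "\<And>S x s t. 1 \<le> t \<Longrightarrow> t \<le> s \<Longrightarrow> p (S(e s := x)) t \<longleftrightarrow> p S t"
    and \<phi>: "\<phi> \<in> borel_measurable (PiM {1..} (\<lambda>_. \<rho>))"
  shows "(\<integral>\<^sup>+S. (\<integral>\<^sup>+Y. \<phi> (completed (p S) (\<lambda>t. S (e t)) T Y) \<partial>PiM {1..} (\<lambda>_. \<rho>)) \<partial>PiM I \<mu>)
    = (\<integral>\<^sup>+Y. \<phi> Y \<partial>PiM {1..} (\<lambda>_. \<rho>))"
proof (induction T)
  case 0
  interpret PI: prob_space "PiM I \<mu>" using \<mu> by (intro prob_space_PiM) auto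
  have "completed q v 0 Y = Y" if "Y \<in> space (PiM {1..} (\<lambda>_. \<rho>))" for q v Y
    using that by (auto simp: completed_def space_PiM PiE_def extensional_def fun_eq_iff)
  then have "(\<integral>\<^sup>+Y. \<phi> (completed q v 0 Y) \<partial>PiM {1..} (\<lambda>_. \<rho>)) = (\<integral>\<^sup>+Y. \<phi> Y \<partial>PiM {1..} (\<lambda>_. \<rho>))" for q v
    by (intro nn_integral_cong) simp
  then show ?case by (simp add: PI.emeasure_space_1)
next
  case (Suc T)
  let ?Y = "PiM {1..} (\<lambda>_. \<rho>)"
  define i where "i = e (Suc T)"
  have i: "i \<in> I" "\<mu> i = \<rho>" using e(1)[of "Suc T"] by (auto simp: i_def)
  have rho: "prob_space \<rho>" using \<mu>[OF i(1)] i by simp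
  interpret \<rho>: prob_space \<rho> by (rule rho)
  interpret Y: prob_space ?Y using rho by (intro prob_space_PiM) auto
  have i_new: "e t \<noteq> i" if "1 \<le> t" "t \<le> T" for t
    using inj_onD[OF e(2), of t "Suc T"] that by (auto simp: i_def)
  define F where "F t S = (\<integral>\<^sup>+Y. \<phi> (completed (p S) (\<lambda>t. S (e t)) t Y) \<partial>?Y)" for t S
  have v: "(\<lambda>S. S (e t)) \<in> borel_measurable (PiM I \<mu>)" if "1 \<le> t" for t
    using measurable_component_singleton[of "e t" I \<mu>] e(1)[OF that]
    by (simp add: measurable_cong_sets[OF refl \<rho>])
  have Fm: "F t \<in> borel_measurable (PiM I \<mu>)" for t
    unfolding F_def by (rule borel_measurable_integral_completed[OF \<rho> rho p v \<phi>])
  have step: "(\<integral>\<^sup>+x. F (Suc T) (X(i := x)) \<partial>\<rho>) = (\<integral>\<^sup>+x. F T (X(i := x)) \<partial>\<rho>)" for X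
  proof -
    let ?v = "\<lambda>t. X (e t)" and ?k = "Suc (hits (p X) T)"
    have pX: "p (X(i := x)) t \<longleftrightarrow> p X t" if "1 \<le> t" "t \<le> Suc T" for x t
      using predictable[OF that] by (simp add: i_def)
    have T: "completed (p (X(i := x))) (\<lambda>t. (X(i := x)) (e t)) T Y = completed (p X) ?v T Y" for x Y
      using pX i_new by (intro completed_cong) auto
    have ST: "completed (p (X(i := x))) (\<lambda>t. (X(i := x)) (e t)) (Suc T) Y
        = (if p X (Suc T) then completed (p X) ?v T (Y(?k := x)) else completed (p X) ?v T Y)" for x Y
    proof -
      have "hits (p (X(i := x))) T = hits (p X) T" using pX by (intro hits_cong) auto
      then show ?thesis
        unfolding completed_Suc T using pX[of "Suc T" x] by (simp add: i_def)
    qed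
    have \<psi>: "(\<lambda>Y. \<phi> (completed (p X) ?v T Y)) \<in> borel_measurable ?Y"
      by (rule measurable_compose[OF measurable_completed \<phi>]) (auto simp: \<rho>)
    show ?thesis
    proof (cases "p X (Suc T)")
      case True
      have "(\<integral>\<^sup>+x. F (Suc T) (X(i := x)) \<partial>\<rho>) = (\<integral>\<^sup>+Y. \<phi> (completed (p X) ?v T Y) \<partial>?Y)"
        unfolding F_def ST if_P[OF True]
        by (rule nn_integral_PiM_resample[where I="{1..}" and \<mu>="\<lambda>_. \<rho>", OF rho _ \<psi>]) simp
      then show ?thesis unfolding F_def T by (simp add: \<rho>.emeasure_space_1 del: fun_upd_apply)
    next
      case False
      then show ?thesis unfolding F_def T ST by simp
    qed
  qed
  have split: "(\<integral>\<^sup>+S. F t S \<partial>PiM I \<mu>) = (\<integral>\<^sup>+X. (\<integral>\<^sup>+x. F t (X(i := x)) \<partial>\<rho>) \<partial>PiM (I - {i}) \<mu>)" for t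
    using nn_integral_PiM_split[OF \<mu> i(1) Fm] by (simp only: i(2))
  have "(\<integral>\<^sup>+S. F (Suc T) S \<partial>PiM I \<mu>) = (\<integral>\<^sup>+S. F T S \<partial>PiM I \<mu>)"
    by (simp only: split step)
  with Suc show ?case by (simp add: F_def)
qed

section \<open>The best arms and the rewarded arms\<close>
text \<open>The set of the \<open>M\<close> best arms, described without a ranking: no permutation has to be constructed when
  a parameter is changed.\<close>
definition top_set :: "(nat \<Rightarrow> real) \<Rightarrow> nat \<Rightarrow> nat set \<Rightarrow> bool" where
  "top_set m N B \<longleftrightarrow> B \<subseteq> {1..N} \<and> inj_on m B \<and> (\<forall>a\<in>B. 0 \<le> m a) \<and> (\<forall>a\<in>B. \<forall>b\<in>{1..N} - B. m b < m a)"

lemma ranking_top_set: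
  assumes \<sigma>: "ranking \<nu> f N \<Theta> \<sigma>" and B: "top_set (\<lambda>a. arm_mean \<nu> f (\<Theta> a)) N B" and M: "card B = M"
  shows "\<sigma> ` {1..M} = B"
proof -
  let ?m = "\<lambda>a. arm_mean \<nu> f (\<Theta> a)"
  have perm: "\<sigma> permutes {1..N}" and sorted: "\<And>i j. i \<in> {1..N} \<Longrightarrow> j \<in> {1..N} \<Longrightarrow> i \<le> j \<Longrightarrow> ?m (\<sigma> j) \<le> ?m (\<sigma> i)"
    using \<sigma> by (auto simp: ranking_def)
  have BN: "B \<subseteq> {1..N}" and Btop: "\<And>a b. a \<in> B \<Longrightarrow> b \<in> {1..N} - B \<Longrightarrow> ?m b < ?m a"
    using B by (auto simp: top_set_def)
  have finB: "finite B" using BN finite_subset by blast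
  have MN: "M \<le> N" using card_mono[OF _ BN] M by simp
  have "\<sigma> i \<in> B" if i: "i \<in> {1..M}" for i
  proof (rule ccontr)
    assume nB: "\<sigma> i \<notin> B"
    have iN: "i \<in> {1..N}" using i MN by auto
    \<comment> \<open>all of \<open>B\<close> is better than an arm outside \<open>B\<close>, so an outside arm cannot have a rank below \<open>M + 1\<close>\<close>
    have "B \<subseteq> \<sigma> ` {1..<i}"
    proof
      fix b assume b: "b \<in> B"
      then obtain l where l: "l \<in> {1..N}" "b = \<sigma> l"
        using BN permutes_image[OF perm] by blast
      have "?m (\<sigma> i) < ?m (\<sigma> l)"
        using Btop[of b "\<sigma> i"] b nB l permutes_in_image[OF perm, of i] iN by auto
      then have "l < i" using sorted[OF iN l(1)] by force
      then show "b \<in> \<sigma> ` {1..<i}" using l by auto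
    qed
    then have "card B \<le> card (\<sigma> ` {1..<i})" by (intro card_mono) auto
    also have "\<dots> \<le> i - 1" using card_image_le[of "{1..<i}" \<sigma>] by simp
    finally show False using i M by auto
  qed
  then have "\<sigma> ` {1..M} \<subseteq> B" by blast
  moreover have "card (\<sigma> ` {1..M}) = M"
    using card_image[OF permutes_inj_on[OF perm], of "{1..M}"] by simp
  ultimately show ?thesis using M finB by (metis card_subset_eq)
qed

lemma best_arm_ranking: "ranking \<nu> f N \<Theta> (best_arm \<nu> f N \<Theta>)"
  unfolding best_arm_def using ranking_exists by (rule someI_ex)

lemma best_arm_inj: "inj_on (best_arm \<nu> f N \<Theta>) A"
  using best_arm_ranking[of \<nu> f N \<Theta>] permutes_inj_on by (auto simp: ranking_def)

lemma param_sets_iff_top_set: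
  assumes "M \<le> N"
  shows "\<Theta> \<in> param_sets \<nu> H f N M \<longleftrightarrow>
    \<Theta> \<in> {1..N} \<rightarrow> H \<and> (\<exists>B. card B = M \<and> top_set (\<lambda>a. arm_mean \<nu> f (\<Theta> a)) N B)"
proof -
  let ?m = "\<lambda>a. arm_mean \<nu> f (\<Theta> a)" and ?b = "best_arm \<nu> f N \<Theta>"
  have perm: "?b permutes {1..N}" and sorted: "\<And>i j. i \<in> {1..N} \<Longrightarrow> j \<in> {1..N} \<Longrightarrow> i \<le> j \<Longrightarrow> ?m (?b j) \<le> ?m (?b i)"
    using best_arm_ranking[of \<nu> f N \<Theta>] by (auto simp: ranking_def)
  have sub: "{1..M} \<subseteq> {1..N}" using assms by auto
  show ?thesis
  proof (intro iffI conjI; (elim conjE exE)?)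
    assume "\<Theta> \<in> param_sets \<nu> H f N M"
    then have \<Theta>: "\<Theta> \<in> {1..N} \<rightarrow> H" and nonneg: "\<And>i. i \<in> {1..M} \<Longrightarrow> 0 \<le> ?m (?b i)"
      and less: "\<And>i j. i \<in> {1..M} \<Longrightarrow> j \<in> {1..N} \<Longrightarrow> i < j \<Longrightarrow> ?m (?b j) < ?m (?b i)"
      unfolding param_sets_def by blast+
    show "\<Theta> \<in> {1..N} \<rightarrow> H" by (rule \<Theta>)
    show "\<exists>B. card B = M \<and> top_set ?m N B"
    proof (intro exI conjI)
      show "card (?b ` {1..M}) = M" by (simp add: card_image best_arm_inj)
      have "inj_on ?m (?b ` {1..M})"
      proof (rule inj_onI, clarsimp)
        fix i j assume "Suc 0 \<le> i" "i \<le> M" "Suc 0 \<le> j" "j \<le> M" "?m (?b i) = ?m (?b j)"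
        then have "i = j" using less[of i j] less[of j i] assms by (cases i j rule: linorder_cases) auto
        then show "?b i = ?b j" by simp
      qed
      moreover have "?m b < ?m (?b i)" if i: "i \<in> {1..M}" and b: "b \<in> {1..N} - ?b ` {1..M}" for i b
      proof -
        obtain l where l: "l \<in> {1..N}" "b = ?b l" using b permutes_image[OF perm] by blast
        then have "i < l" using i b by (force simp: not_less)
        then show ?thesis using less[OF i l(1)] l(2) by simp
      qed
      moreover have "?b ` {1..M} \<subseteq> {1..N}" using permutes_image[OF perm] sub by blast
      ultimately show "top_set ?m N (?b ` {1..M})"
        using nonneg unfolding top_set_def by blast
    qed
  next
    fix B assume \<Theta>: "\<Theta> \<in> {1..N} \<rightarrow> H" and M: "card B = M" and B: "top_set ?m N B"
    have im: "?b ` {1..M} = B" by (rule ranking_top_set[OF best_arm_ranking B M])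
    have "?m (?b j) < ?m (?b i)" if ij: "i \<in> {1..M}" "j \<in> {1..N}" "i < j" for i j
    proof (cases "j \<le> M")
      case True
      then have "?b i \<in> B" "?b j \<in> B" using ij im by auto
      moreover have "?b i \<noteq> ?b j" using inj_onD[OF best_arm_inj[of \<nu> f N \<Theta> UNIV], of i j] ij by auto
      ultimately have "?m (?b j) \<noteq> ?m (?b i)" using B inj_onD[of ?m B "?b j" "?b i"] by (auto simp: top_set_def)
      then show ?thesis using sorted[of i j] ij sub by force
    next
      case False
      have "?b j \<notin> B"
      proof
        assume "?b j \<in> B"
        then obtain l where "l \<in> {1..M}" "?b l = ?b j" using im by (metis imageE)
        then show False using inj_onD[OF best_arm_inj[of \<nu> f N \<Theta> UNIV], of l j] False by auto
      qed
      then show ?thesis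
        using B im ij permutes_in_image[OF perm, of j] unfolding top_set_def by blast
    qed
    moreover have "0 \<le> ?m (?b i)" if "i \<in> {1..M}" for i
      using B im that unfolding top_set_def by blast
    ultimately show "\<Theta> \<in> param_sets \<nu> H f N M"
      using \<Theta> unfolding param_sets_def by blast
  qed
qed

lemma best_arms_top_set:
  assumes "\<Theta> \<in> param_sets \<nu> H f N M" "M \<le> N"
  shows "top_set (\<lambda>a. arm_mean \<nu> f (\<Theta> a)) N (best_arm \<nu> f N \<Theta> ` {1..M})"
    and "card (best_arm \<nu> f N \<Theta> ` {1..M}) = M"
proof -
  obtain B where "card B = M" "top_set (\<lambda>a. arm_mean \<nu> f (\<Theta> a)) N B"
    using assms(1) param_sets_iff_top_set[OF assms(2)] by blast
  moreover from this have "best_arm \<nu> f N \<Theta> ` {1..M} = B"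
    by (intro ranking_top_set[OF best_arm_ranking])
  ultimately show "top_set (\<lambda>a. arm_mean \<nu> f (\<Theta> a)) N (best_arm \<nu> f N \<Theta> ` {1..M})"
    and "card (best_arm \<nu> f N \<Theta> ` {1..M}) = M" by simp_all
qed

text \<open>Exchange argument: an injection sends the arms of \<open>A\<close> outside \<open>B\<close> to strictly better arms of \<open>B\<close> missing
  from \<open>A\<close>. In the case of equality all missing arms therefore have mean zero; this happens when the
  smallest of the \<open>M\<close> largest means vanishes, and it is why the case needs attention in what follows.\<close>
lemma top_set_sum:
  assumes B: "top_set m N B" and A: "A \<subseteq> {1..N}" "card A \<le> card B"
  shows "sum m A \<le> sum m B"
    and "sum m A = sum m B \<Longrightarrow> A \<subseteq> B \<and> (\<forall>a\<in>B - A. m a = 0)"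
proof -
  have BN: "B \<subseteq> {1..N}" and nonneg: "\<And>a. a \<in> B \<Longrightarrow> 0 \<le> m a"
    and less: "\<And>a b. a \<in> B \<Longrightarrow> b \<in> {1..N} - B \<Longrightarrow> m b < m a"
    using B by (auto simp: top_set_def)
  have fin: "finite A" "finite B" using A BN finite_subset by blast+
  have split: "sum m A = sum m (A \<inter> B) + sum m (A - B)" "sum m B = sum m (A \<inter> B) + sum m (B - A)"
    using sum.Int_Diff[OF fin(1), of m B] sum.Int_Diff[OF fin(2), of m A] by (simp_all add: Int_commute)
  have "sum m (A - B) \<le> sum m (B - A) \<and> (A - B \<noteq> {} \<longrightarrow> sum m (A - B) < sum m (B - A))"
  proof (cases "A - B = {}")
    case True
    have "0 \<le> sum m (B - A)" using nonneg by (intro sum_nonneg) auto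
    then show ?thesis unfolding True by simp
  next
    case False
    have "card (A - B) \<le> card (B - A)"
      using A(2) fin card_Int_Diff[of A B] card_Int_Diff[of B A] by (simp add: Int_commute)
    then obtain \<phi> where \<phi>: "inj_on \<phi> (A - B)" "\<phi> ` (A - B) \<subseteq> B - A"
      using card_le_inj[of "A - B" "B - A"] fin by auto
    have "sum m (A - B) < (\<Sum>a\<in>A - B. m (\<phi> a))"
      using False fin \<phi> A(1) by (intro sum_strict_mono less) auto
    also have "\<dots> = sum m (\<phi> ` (A - B))" using \<phi> by (simp add: sum.reindex)
    also have "\<dots> \<le> sum m (B - A)"
      using \<phi> fin nonneg by (intro sum_mono2) auto
    finally show ?thesis by simp
  qed
  note * = this
  show "sum m A \<le> sum m B" using * split by linarith
  assume eq: "sum m A = sum m B"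
  then have "A - B = {}" using * split by linarith
  moreover from this have "sum m (B - A) = 0" using eq split by (metis add_cancel_right_right sum.empty)
  ultimately show "A \<subseteq> B \<and> (\<forall>a\<in>B - A. m a = 0)"
    using sum_nonneg_eq_0_iff[OF finite_Diff[OF fin(2)], of A m] nonneg by blast
qed

text \<open>Only finitely many sets of arms exist, so positive gaps are bounded away from zero.\<close>
lemma top_set_sum_gap:
  fixes m :: "nat \<Rightarrow> real"
  obtains \<Delta> where "\<Delta> > 0" "\<And>A. A \<subseteq> {1..N} \<Longrightarrow> sum m A < sum m B \<Longrightarrow> \<Delta> \<le> sum m B - sum m A"
proof -
  let ?G = "insert 1 {sum m B - sum m A |A. A \<subseteq> {1..N} \<and> sum m A < sum m B}"
  have "finite {sum m B - sum m A |A. A \<in> Pow {1..N} \<and> sum m A < sum m B}" by simp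
  then have fin: "finite ?G" by simp
  show thesis
  proof (rule that[of "Min ?G"])
    show "0 < Min ?G" using fin by (subst Min_gr_iff) auto
    show "Min ?G \<le> sum m B - sum m A" if "A \<subseteq> {1..N}" "sum m A < sum m B" for A
      using fin that by (intro Min_le) auto
  qed
qed

definition accrued :: "collision_model \<Rightarrow> nat \<Rightarrow> nat \<Rightarrow> (nat \<Rightarrow> nat) \<Rightarrow> nat set" where
  "accrued c N M a = {j \<in> {1..N}. rewarded c M a j}"

lemma accrued_subset: "accrued c N M a \<subseteq> {1..N}" "accrued c N M a \<subseteq> a ` {1..M}"
proof -
  show "accrued c N M a \<subseteq> {1..N}" by (auto simp: accrued_def)
  have "j \<in> a ` {1..M}" if "rewarded c M a j" for j
    using that by (cases c) (simp_all add: image_iff Bex_def Ex1_def, blast+)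
  then show "accrued c N M a \<subseteq> a ` {1..M}" by (auto simp: accrued_def)
qed

lemma card_accrued: "card (accrued c N M a) \<le> M"
  using card_mono[OF _ accrued_subset(2)[of c N M a]] card_image_le[of "{1..M}" a] by simp

text \<open>A played arm goes unrewarded only through a collision, which wastes at least two players.\<close>
lemma card_accrued_collision:
  assumes "j \<in> a ` {1..M}" "j \<in> {1..N}" "j \<notin> accrued c N M a"
  shows "card (accrued c N M a) + 2 \<le> M"
proof -
  obtain i1 where i1: "i1 \<in> {1..M}" "a i1 = j" using assms by blast
  from assms have c: "c = Lost" using i1 by (cases c) (auto simp: accrued_def)
  obtain i2 where i2: "i2 \<in> {1..M}" "a i2 = j" "i2 \<noteq> i1"
    using assms(2,3) i1 unfolding c accrued_def rewarded.simps by blast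
  have "accrued c N M a \<subseteq> a ` ({1..M} - {i1, i2})"
  proof
    fix x assume x: "x \<in> accrued c N M a"
    then obtain i where "i \<in> {1..M}" "a i = x" using accrued_subset(2) by blast
    moreover have "x \<noteq> j" using x assms(3) by blast
    ultimately show "x \<in> a ` ({1..M} - {i1, i2})" using i1 i2 by auto
  qed
  then have "card (accrued c N M a) \<le> card ({1..M} - {i1, i2})"
    using surj_card_le[of "{1..M} - {i1, i2}"] by blast
  moreover have "card ({1..M} - {i1, i2}) = M - 2" using i1 i2 by (subst card_Diff_subset) auto
  moreover have "2 \<le> M" using card_mono[of "{1..M}" "{i1, i2}"] i1 i2 by auto
  ultimately show ?thesis by linarith
qed

lemma accrued_inj:
  assumes "inj_on a {1..M}" "a ` {1..M} \<subseteq> {1..N}"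
  shows "accrued c N M a = a ` {1..M}"
proof (cases c)
  case Shared
  then show ?thesis using assms by (auto simp: accrued_def)
next
  case Lost
  show ?thesis
  proof (rule antisym[OF accrued_subset(2)], rule subsetI)
    fix j assume j: "j \<in> a ` {1..M}"
    then obtain i where i: "i \<in> {1..M}" "a i = j" by blast
    then have "\<exists>!i. i \<in> {1..M} \<and> a i = j" using inj_onD[OF assms(1)] by blast
    moreover have "j \<in> {1..N}" using assms(2) j by blast
    ultimately show "j \<in> accrued c N M a" unfolding accrued_def Lost rewarded.simps by blast
  qed
qed

section \<open>The regret as an expected gap\<close>
lemma action_cong_past:
  "(\<And>a r. 1 \<le> r \<Longrightarrow> r < t \<Longrightarrow> S (a, r) = S' (a, r)) \<Longrightarrow> action M \<pi> S t i = action M \<pi> S' t i"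
proof (induction t arbitrary: i rule: less_induct)
  case (less t)
  have IH: "action M \<pi> S r i = action M \<pi> S' r i" if "1 \<le> r" "r < t" for r i
    using less that by (intro less.IH) auto
  show ?case
    unfolding action.simps[of M \<pi> _ t i]
    by (intro arg_cong[of _ _ "\<pi> i t"] restrict_ext) (simp add: IH less.prems)
qed

text \<open>A state that nobody observes influences no decision at any time.\<close>
lemma action_cong_unplayed:
  assumes "\<And>i. i \<in> {1..M} \<Longrightarrow> action M \<pi> S s i \<noteq> j" "i \<in> {1..M}"
  shows "action M \<pi> (S((j, s) := x)) t i = action M \<pi> S t i"
  using assms(2)
proof (induction t arbitrary: i rule: less_induct)
  case (less t)
  have IH: "action M \<pi> (S((j, s) := x)) r i = action M \<pi> S r i" if "r < t" "i \<in> {1..M}" for r i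
    using that by (rule less.IH)
  have same: "(S((j, s) := x)) (action M \<pi> S r i, r) = S (action M \<pi> S r i, r)" for r
    using assms(1)[OF less.prems] by auto
  show ?case
    unfolding action.simps[of M \<pi> _ t i]
    by (intro arg_cong[of _ _ "\<pi> i t"] restrict_ext)
      (use less.prems in \<open>simp add: IH same del: fun_upd_apply cong: conj_cong\<close>)
qed

lemma measurable_action:
  assumes \<pi>: "decentralized_policy N M \<pi>"
    and \<mu>: "\<And>a. a \<in> {1..N} \<times> {1..} \<Longrightarrow> sets (\<mu> a) = sets borel"
    and "i \<in> {1..M}" "1 \<le> t"
  shows "(\<lambda>S. action M \<pi> S t i) \<in> PiM ({1..N} \<times> {1..}) \<mu> \<rightarrow>\<^sub>M count_space {1..N}"
  using assms(3,4)
proof (induction t arbitrary: i rule: less_induct)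
  case (less t)
  let ?M = "PiM ({1..N} \<times> {1..}) \<mu>"
  have pi: "\<pi> i t \<in> history_space t \<rightarrow>\<^sub>M count_space {1..N}"
    using \<pi> less.prems by (auto simp: decentralized_policy_def)
  have "(\<lambda>S. \<lambda>r\<in>{1..<t}. (action M \<pi> S r i, S (action M \<pi> S r i, r),
      \<exists>j\<in>{1..M}. j \<noteq> i \<and> action M \<pi> S r j = action M \<pi> S r i)) \<in> ?M \<rightarrow>\<^sub>M history_space t"
    unfolding history_space_def
  proof (rule measurable_restrict)
    fix r assume r: "r \<in> {1..<t}"
    have act: "(\<lambda>S. action M \<pi> S r j) \<in> ?M \<rightarrow>\<^sub>M count_space {1..N}" if "j \<in> {1..M}" for j
      using less.IH[of r j] r that by auto
    have [measurable]: "(\<lambda>S. action M \<pi> S r j) \<in> ?M \<rightarrow>\<^sub>M count_space UNIV" if "j \<in> {1..M}" for j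
      using act[OF that] by (rule measurable_compose) simp
    note [measurable] = this[OF less.prems(1)]
    have [measurable]: "Measurable.pred ?M (\<lambda>S. action M \<pi> S r j = action M \<pi> S r i)" if "j \<in> {1..M}" for j
      using that
      by (intro measurable_compose_countable[where f = "\<lambda>a S. action M \<pi> S r j = a" and g = "\<lambda>S. action M \<pi> S r i"]) measurable
    have A: "(\<lambda>S. action M \<pi> S r i) \<in> ?M \<rightarrow>\<^sub>M count_space UNIV" by measurable
    have B: "(\<lambda>S. S (action M \<pi> S r i, r)) \<in> borel_measurable ?M"
    proof (rule measurable_compose_countable'[OF _ act[OF less.prems(1)]])
      fix a assume a: "a \<in> {1..N}"
      then have "(a, r) \<in> {1..N} \<times> {1..}" using r by auto
      from measurable_component_singleton[OF this, of \<mu>]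
      show "(\<lambda>S. S (a, r)) \<in> borel_measurable ?M"
        using \<mu>[of "(a, r)"] a r by (simp cong: measurable_cong_sets)
    qed simp
    have C: "Measurable.pred ?M (\<lambda>S. \<exists>j\<in>{1..M}. j \<noteq> i \<and> action M \<pi> S r j = action M \<pi> S r i)"
      by measurable
    show "(\<lambda>S. (action M \<pi> S r i, S (action M \<pi> S r i, r),
        \<exists>j\<in>{1..M}. j \<noteq> i \<and> action M \<pi> S r j = action M \<pi> S r i))
      \<in> ?M \<rightarrow>\<^sub>M count_space UNIV \<Otimes>\<^sub>M (borel \<Otimes>\<^sub>M count_space UNIV)"
      by (rule measurable_Pair[OF A measurable_Pair[OF B C]])
  qed
  from measurable_compose[OF this pi] show ?case
    unfolding action.simps[of M \<pi> _ t i] .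
qed

locale bandit =
  fixes \<nu> :: "real measure" and H :: "'p set" and f :: "'p \<Rightarrow> real \<Rightarrow> real" and N M :: nat
    and c :: collision_model
  assumes densities: "density_family \<nu> H f"
    and C1: "\<And>\<theta>. \<theta> \<in> H \<Longrightarrow> integrable (arm_law \<nu> f \<theta>) (\<lambda>s. s)"
    and M_le_N: "M \<le> N"
begin

abbreviation mean :: "'p \<Rightarrow> real" where "mean \<equiv> arm_mean \<nu> f"
abbreviation states :: "(nat \<Rightarrow> 'p) \<Rightarrow> (nat \<times> nat \<Rightarrow> real) measure" where
  "states \<equiv> state_space \<nu> f N"
abbreviation valid :: "(nat \<Rightarrow> 'p) set" where "valid \<equiv> param_sets \<nu> H f N M"
abbreviation best :: "(nat \<Rightarrow> 'p) \<Rightarrow> nat set" where "best \<Theta> \<equiv> best_arm \<nu> f N \<Theta> ` {1..M}"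

lemma sets_arm_law: "sets (arm_law \<nu> f \<theta>) = sets borel"
  using densities by (simp add: arm_law_def density_family_def)

lemma prob_space_arm_law: "\<theta> \<in> H \<Longrightarrow> prob_space (arm_law \<nu> f \<theta>)"
  using densities
  by (auto intro!: prob_spaceI simp: arm_law_def density_family_def emeasure_density cong: nn_integral_cong)

lemma states_eq: "states \<Theta> = PiM ({1..N} \<times> {1..}) (\<lambda>a. arm_law \<nu> f (\<Theta> (fst a)))"
  by (simp add: state_space_def split_beta')

lemma prob_space_states: "\<Theta> \<in> {1..N} \<rightarrow> H \<Longrightarrow> prob_space (states \<Theta>)"
  unfolding states_eq by (intro prob_space_PiM prob_space_arm_law) auto

lemma measurable_state: "j \<in> {1..N} \<Longrightarrow> 1 \<le> t \<Longrightarrow> (\<lambda>S. S (j, t)) \<in> borel_measurable (states \<Theta>)"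
  using measurable_component_singleton[of "(j, t)" "{1..N} \<times> {1..}" "\<lambda>a. arm_law \<nu> f (\<Theta> (fst a))"]
  by (simp add: states_eq measurable_cong_sets[OF refl sets_arm_law])

lemma measurable_action_states:
  assumes "decentralized_policy N M \<pi>" "i \<in> {1..M}" "1 \<le> t"
  shows "(\<lambda>S. action M \<pi> S t i) \<in> states \<Theta> \<rightarrow>\<^sub>M count_space UNIV"
  using measurable_action[OF assms(1) _ assms(2,3)]
  unfolding states_eq by (rule measurable_compose) (auto simp: sets_arm_law)

lemma pred_rewarded:
  assumes "decentralized_policy N M \<pi>" "1 \<le> t"
  shows "Measurable.pred (states \<Theta>) (\<lambda>S. rewarded c M (action M \<pi> S t) j)"
proof -
  note [measurable] = measurable_action_states[OF assms(1) _ assms(2)]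
  have "rewarded Lost M a j \<longleftrightarrow> (\<exists>i\<in>{1..M}. a i = j \<and> (\<forall>k\<in>{1..M}. a k = j \<longrightarrow> k = i))" for a
    unfolding rewarded.simps by blast
  then show ?thesis by (cases c) (simp_all only: rewarded.simps, measurable)
qed

text \<open>The loss in one period when player \<open>i\<close> plays arm \<open>a i\<close> and each rewarded arm yields its mean.\<close>
definition gap :: "(nat \<Rightarrow> 'p) \<Rightarrow> (nat \<Rightarrow> nat) \<Rightarrow> real" where
  "gap \<Theta> a = (\<Sum>j\<in>best \<Theta>. mean (\<Theta> j)) - (\<Sum>j\<in>accrued c N M a. mean (\<Theta> j))"

lemma gap_nonneg: "\<Theta> \<in> valid \<Longrightarrow> 0 \<le> gap \<Theta> a"
  using top_set_sum(1)[OF best_arms_top_set(1), of \<Theta> \<nu> H f N M "accrued c N M a"]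
    best_arms_top_set(2)[of \<Theta> \<nu> H f N M] accrued_subset(1) card_accrued M_le_N
  by (auto simp: gap_def)

lemma accrued_sum: "(\<Sum>j\<in>accrued c N M a. m j) = (\<Sum>j\<in>{1..N}. of_bool (rewarded c M a j) * m j)" for m :: "nat \<Rightarrow> real"
  by (simp add: accrued_def of_bool_def sum.If_cases Int_def if_distrib[of "\<lambda>x. x * _"] cong: if_cong)

text \<open>The set of rewarded arms is predictable, so in expectation a rewarded arm contributes its mean.\<close>
lemma regret_eq_expected_gap:
  assumes \<pi>: "decentralized_policy N M \<pi>" and \<Theta>: "\<Theta> \<in> {1..N} \<rightarrow> H"
  shows "\<And>t. 1 \<le> t \<Longrightarrow> integrable (states \<Theta>) (\<lambda>S. gap \<Theta> (action M \<pi> S t))"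
    and "regret \<nu> f N M c \<pi> \<Theta> T = (\<integral>S. (\<Sum>t\<in>{1..T}. gap \<Theta> (action M \<pi> S t)) \<partial>states \<Theta>)"
proof -
  interpret S: prob_space "states \<Theta>" by (rule prob_space_states[OF \<Theta>])
  let ?r = "\<lambda>S t. rewarded c M (action M \<pi> S t)" and ?top = "\<Sum>j\<in>best \<Theta>. mean (\<Theta> j)"
  have rew: "integrable (states \<Theta>) (\<lambda>S. of_bool (?r S t j) * mean (\<Theta> j))" if "1 \<le> t" for t j
  proof -
    have [measurable]: "Measurable.pred (states \<Theta>) (\<lambda>S. ?r S t j)"
      using pred_rewarded[OF \<pi> that] .
    show ?thesis
      by (intro integrable_mult_left S.integrable_const_bound[of _ 1]) auto
  qed
  show int: "integrable (states \<Theta>) (\<lambda>S. gap \<Theta> (action M \<pi> S t))" if "1 \<le> t" for t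
    unfolding gap_def accrued_sum using rew[OF that]
    by (intro Bochner_Integration.integrable_diff Bochner_Integration.integrable_sum) auto
  have one: "integrable (states \<Theta>) (\<lambda>S. of_bool (?r S t j) * S (j, t)) \<and>
      (\<integral>S. of_bool (?r S t j) * S (j, t) \<partial>states \<Theta>) = (\<integral>S. of_bool (?r S t j) * mean (\<Theta> j) \<partial>states \<Theta>)"
    if t: "1 \<le> t" and j: "j \<in> {1..N}" for t j
  proof -
    have P: "Measurable.pred (states \<Theta>) (\<lambda>S. ?r S t j)" using pred_rewarded[OF \<pi> t] .
    have past: "?r (S((j, t) := x)) t j \<longleftrightarrow> ?r S t j" for S x
    proof -
      have "action M \<pi> (S((j, t) := x)) t = action M \<pi> S t"
        by (intro ext action_cong_past) auto
      then show ?thesis by simp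
    qed
    have law: "prob_space (arm_law \<nu> f (\<Theta> (fst a)))" if "a \<in> {1..N} \<times> {1..}" for a :: "nat \<times> nat"
      using that \<Theta> by (intro prob_space_arm_law) auto
    have jt: "(j, t) \<in> {1..N} \<times> {1..}" using t j by simp
    have "integrable (arm_law \<nu> f (\<Theta> (fst (j, t)))) (\<lambda>s. s)" using j \<Theta> by (auto intro!: C1)
    note * = expectation_PiM_of_bool_mult[where I = "{1..N} \<times> {1..}" and \<mu> = "\<lambda>a. arm_law \<nu> f (\<Theta> (fst a))"
        and i = "(j, t)" and v = "\<lambda>s. s", OF law jt P[unfolded states_eq] past this,
        folded states_eq, unfolded fst_conv, folded arm_mean_def]
    have "(\<integral>S. of_bool (?r S t j) * mean (\<Theta> j) \<partial>states \<Theta>)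
        = measure (states \<Theta>) {S \<in> space (states \<Theta>). ?r S t j} * mean (\<Theta> j)"
      by (simp add: S.expectation_of_bool(2)[OF P])
    with * show ?thesis by (simp only: simp_thms)
  qed
  have tot: "integrable (states \<Theta>) (\<lambda>S. total_reward c N M \<pi> S t) \<and>
      (\<integral>S. total_reward c N M \<pi> S t \<partial>states \<Theta>) = ?top - (\<integral>S. gap \<Theta> (action M \<pi> S t) \<partial>states \<Theta>)"
    if t: "1 \<le> t" for t
  proof -
    have "(\<integral>S. gap \<Theta> (action M \<pi> S t) \<partial>states \<Theta>)
        = ?top - (\<Sum>j\<in>{1..N}. \<integral>S. of_bool (?r S t j) * mean (\<Theta> j) \<partial>states \<Theta>)"
      unfolding gap_def accrued_sum
      by (rule trans[OF Bochner_Integration.integral_diff])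
        (auto intro!: Bochner_Integration.integrable_sum rew[OF t] arg_cong2[of _ _ _ _ "(-)"]
          Bochner_Integration.integral_sum simp only: S.prob_space integral_const lebesgue_integral_const scaleR_one S.integrable_const)
    moreover have "(\<integral>S. total_reward c N M \<pi> S t \<partial>states \<Theta>)
        = (\<Sum>j\<in>{1..N}. \<integral>S. of_bool (?r S t j) * mean (\<Theta> j) \<partial>states \<Theta>)"
      unfolding total_reward_def using one[OF t] by (subst Bochner_Integration.integral_sum) auto
    moreover have "integrable (states \<Theta>) (\<lambda>S. total_reward c N M \<pi> S t)"
      unfolding total_reward_def by (intro Bochner_Integration.integrable_sum conjunct1[OF one[OF t]])
    ultimately show ?thesis by simp
  qed
  have "(\<integral>S. (\<Sum>t\<in>{1..T}. total_reward c N M \<pi> S t) \<partial>states \<Theta>)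
      = (\<Sum>t\<in>{1..T}. ?top - (\<integral>S. gap \<Theta> (action M \<pi> S t) \<partial>states \<Theta>))"
    using tot by (subst Bochner_Integration.integral_sum) (auto intro!: sum.cong)
  also have "\<dots> = real T * ?top - (\<integral>S. (\<Sum>t\<in>{1..T}. gap \<Theta> (action M \<pi> S t)) \<partial>states \<Theta>)"
    using int by (subst Bochner_Integration.integral_sum) (auto simp: sum_subtractf)
  finally show "regret \<nu> f N M c \<pi> \<Theta> T = (\<integral>S. (\<Sum>t\<in>{1..T}. gap \<Theta> (action M \<pi> S t)) \<partial>states \<Theta>)"
    unfolding regret_def by (simp add: sum.reindex[OF best_arm_inj])
qed

lemma regret_nonneg:
  assumes "decentralized_policy N M \<pi>" "\<Theta> \<in> valid"
  shows "0 \<le> regret \<nu> f N M c \<pi> \<Theta> T"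
proof -
  have "\<Theta> \<in> {1..N} \<rightarrow> H" using assms(2) unfolding param_sets_def by blast
  show ?thesis
    unfolding regret_eq_expected_gap(2)[OF assms(1) \<open>\<Theta> \<in> {1..N} \<rightarrow> H\<close>]
    by (intro Bochner_Integration.integral_nonneg sum_nonneg gap_nonneg assms)
qed

section \<open>The lower bound\<close>
lemma gap_eq_0D:
  assumes \<Theta>: "\<Theta> \<in> valid" and a: "gap \<Theta> a = 0"
  shows "accrued c N M a \<subseteq> best \<Theta> \<and> (\<forall>j\<in>best \<Theta> - accrued c N M a. mean (\<Theta> j) = 0)"
proof (rule top_set_sum(2)[OF best_arms_top_set(1)[OF \<Theta> M_le_N] accrued_subset(1)])
  show "card (accrued c N M a) \<le> card (best \<Theta>)"
    using card_accrued best_arms_top_set(2)[OF \<Theta> M_le_N] by metis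
qed (use a in \<open>simp add: gap_def\<close>)

text \<open>A zero gap would leave the arm unrewarded, hence hit by a collision, hence at least two of the best
  arms would be missing. They would both have mean zero, but the means of the best arms are distinct.\<close>
lemma gap_pos_if_bad_arm_played:
  assumes \<Theta>: "\<Theta> \<in> valid" and j: "j \<in> {1..N} - best \<Theta>" "j \<in> a ` {1..M}"
  shows "0 < gap \<Theta> a"
proof (rule ccontr)
  let ?m = "\<lambda>a. mean (\<Theta> a)" and ?A = "accrued c N M a"
  note top = best_arms_top_set[OF \<Theta> M_le_N]
  assume "\<not> 0 < gap \<Theta> a"
  then have A: "?A \<subseteq> best \<Theta>" "\<forall>a\<in>best \<Theta> - ?A. ?m a = 0"
    using gap_nonneg[OF \<Theta>, of a] gap_eq_0D[OF \<Theta>, of a] by auto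
  then have "card ?A + 2 \<le> M" using j by (intro card_accrued_collision) auto
  then have "2 \<le> card (best \<Theta> - ?A)"
    using card_Diff_subset[OF _ A(1)] top(2) finite_subset[OF A(1)] by simp
  then obtain x y where xy: "x \<in> best \<Theta> - ?A" "y \<in> best \<Theta> - ?A" "x \<noteq> y"
    by (metis One_nat_def card_le_Suc0_iff_eq Suc_1 card.infinite not_less_eq_eq zero_le)
  then have "?m x = ?m y" using A(2) by simp
  then show False using xy top(1) by (auto simp: top_set_def inj_on_def)
qed

text \<open>Positivity of the mean is essential: missing a best arm with mean zero is free.\<close>
lemma gap_pos_if_good_arm_unplayed:
  assumes \<Theta>: "\<Theta> \<in> valid" and j: "j \<in> best \<Theta>" "0 < mean (\<Theta> j)" "j \<notin> a ` {1..M}"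
  shows "0 < gap \<Theta> a"
proof (rule ccontr)
  let ?m = "\<lambda>a. mean (\<Theta> a)" and ?A = "accrued c N M a"
  assume "\<not> 0 < gap \<Theta> a"
  then have "\<forall>a\<in>best \<Theta> - ?A. ?m a = 0"
    using gap_nonneg[OF \<Theta>, of a] gap_eq_0D[OF \<Theta>, of a] by auto
  moreover have "j \<notin> ?A" using j(3) accrued_subset(2) by blast
  ultimately show False using j by auto
qed

lemma gap_bounded_below:
  obtains \<Delta> where "0 < \<Delta>" "\<And>a. 0 < gap \<Theta> a \<Longrightarrow> \<Delta> \<le> gap \<Theta> a"
  using top_set_sum_gap[of N "\<lambda>a. mean (\<Theta> a)" "best \<Theta>"] accrued_subset(1)
  unfolding gap_def by (metis diff_gt_0_iff_gt)

definition played :: "policy \<Rightarrow> nat \<Rightarrow> (nat \<times> nat \<Rightarrow> real) \<Rightarrow> nat \<Rightarrow> bool" where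
  "played \<pi> j S t \<longleftrightarrow> j \<in> action M \<pi> S t ` {1..M}"

lemma played_cong_past: "(\<And>a r. 1 \<le> r \<Longrightarrow> r < t \<Longrightarrow> S (a, r) = S' (a, r)) \<Longrightarrow> played \<pi> j S t = played \<pi> j S' t"
  unfolding played_def using action_cong_past[of t S S' M \<pi>] by (metis ext)

lemma played_upd_unplayed:
  assumes "\<not> played \<pi> j S s" shows "played \<pi> k (S((j, s) := x)) t \<longleftrightarrow> played \<pi> k S t"
proof -
  have "action M \<pi> (S((j, s) := x)) t i = action M \<pi> S t i" if "i \<in> {1..M}" for i
    using assms that by (intro action_cong_unplayed) (auto simp: played_def)
  then show ?thesis unfolding played_def by (metis (mono_tags, lifting) image_cong)
qed

lemma pred_played:
  assumes "decentralized_policy N M \<pi>" "1 \<le> t"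
  shows "Measurable.pred (states \<Theta>) (\<lambda>S. played \<pi> j S t)"
proof -
  note [measurable] = measurable_action_states[OF assms(1) _ assms(2)]
  have "played \<pi> j S t \<longleftrightarrow> (\<exists>i\<in>{1..M}. action M \<pi> S t i = j)" for S by (auto simp: played_def)
  then show ?thesis by simp
qed

text \<open>The weight \<open>w\<close> is bounded by the likelihood ratio of the parameter \<open>\<theta>'\<close> to \<open>\<Theta> j\<close>, in the integrated
  form \<open>le\<close>. Only observed states of \<open>j\<close> carry a weight. The law of arm \<open>j\<close> is changed one time at a
  time: if \<open>j\<close> is played at that time then the weight pays for the change, and if it is not then
  the integrand does not depend on the state that is changed.\<close>
lemma change_of_measure:
  assumes \<pi>: "decentralized_policy N M \<pi>" and \<Theta>: "\<Theta> \<in> {1..N} \<rightarrow> H" and j: "j \<in> {1..N}" and \<theta>': "\<theta>' \<in> H"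
    and w [measurable]: "w \<in> borel_measurable borel"
    and le: "\<And>\<psi>. \<psi> \<in> borel_measurable borel \<Longrightarrow> (\<integral>\<^sup>+x. \<psi> x * w x \<partial>arm_law \<nu> f (\<Theta> j)) \<le> (\<integral>\<^sup>+x. \<psi> x \<partial>arm_law \<nu> f \<theta>')"
    and F: "F \<in> borel_measurable (states \<Theta>)"
    and dep: "\<And>S S'. (\<And>a r. 1 \<le> r \<Longrightarrow> r \<le> T \<Longrightarrow> S (a, r) = S' (a, r)) \<Longrightarrow> F S = F S'"
    and unplayed: "\<And>S s x. \<not> played \<pi> j S s \<Longrightarrow> F (S((j, s) := x)) = F S"
  shows "(\<integral>\<^sup>+S. F S * (\<Prod>s\<in>{1..T}. if played \<pi> j S s then w (S (j, s)) else 1) \<partial>states \<Theta>)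
      \<le> (\<integral>\<^sup>+S. F S \<partial>states (\<Theta> (j := \<theta>')))"
proof -
  let ?I = "{1..N} \<times> {1..} :: (nat \<times> nat) set"
  \<comment> \<open>hybrid family: arm \<open>j\<close> follows \<open>\<theta>'\<close> up to time \<open>r\<close> and \<open>\<Theta> j\<close> afterwards\<close>
  define \<mu> where "\<mu> r a = arm_law \<nu> f (if fst a = j \<and> snd a \<le> r then \<theta>' else \<Theta> (fst a))" for r :: nat and a :: "nat \<times> nat"
  define u where "u S s = (if played \<pi> j S s then w (S (j, s)) else 1)" for S s
  define G where "G r S = F S * (\<Prod>s\<in>{Suc r..T}. u S s)" for r S
  have prob: "prob_space (\<mu> r a)" if "a \<in> ?I" for r a
    using that \<Theta> \<theta>' unfolding \<mu>_def by (intro prob_space_arm_law) auto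
  have sets: "sets (\<mu> r a) = sets borel" for r a by (simp add: \<mu>_def sets_arm_law)
  have sets_eq: "sets (PiM ?I (\<mu> r)) = sets (states \<Theta>)" for r
    unfolding states_eq by (intro sets_PiM_cong refl) (simp add: sets sets_arm_law)
  note meas_eq = measurable_cong_sets[OF sets_eq refl]
  have u_meas: "(\<lambda>S. u S s) \<in> borel_measurable (states \<Theta>)" if "1 \<le> s" for s
  proof -
    note [measurable] = pred_played[OF \<pi> that] measurable_state[OF j that]
    show ?thesis unfolding u_def by measurable
  qed
  have G_meas: "G r \<in> borel_measurable (PiM ?I (\<mu> r'))" for r r'
    unfolding meas_eq G_def using F u_meas by (intro borel_measurable_times_ennreal borel_measurable_prod_ennreal) auto
  have step: "(\<integral>\<^sup>+S. G r S \<partial>PiM ?I (\<mu> r)) \<le> (\<integral>\<^sup>+S. G (Suc r) S \<partial>PiM ?I (\<mu> (Suc r)))" if r: "r < T" for r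
  proof -
    let ?i = "(j, Suc r)"
    have i: "?i \<in> ?I" using j by simp
    have rest: "PiM (?I - {?i}) (\<mu> r) = PiM (?I - {?i}) (\<mu> (Suc r))"
      by (intro PiM_cong refl) (auto simp: \<mu>_def le_Suc_eq)
    have law: "\<mu> r ?i = arm_law \<nu> f (\<Theta> j)" "\<mu> (Suc r) ?i = arm_law \<nu> f \<theta>'" by (simp_all add: \<mu>_def)
    have Gr: "G r S = G (Suc r) S * u S (Suc r)" for S
    proof -
      have "{Suc r..T} = insert (Suc r) {Suc (Suc r)..T}" using r by auto
      then show ?thesis by (simp add: G_def mult_ac)
    qed
    have "(\<integral>\<^sup>+x. G r (X(?i := x)) \<partial>arm_law \<nu> f (\<Theta> j)) \<le> (\<integral>\<^sup>+x. G (Suc r) (X(?i := x)) \<partial>arm_law \<nu> f \<theta>')"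
      if X: "X \<in> space (PiM (?I - {?i}) (\<mu> (Suc r)))" for X
    proof -
      have now: "played \<pi> j (X(?i := x)) (Suc r) = played \<pi> j X (Suc r)" for x
        by (intro played_cong_past) auto
      show ?thesis
      proof (cases "played \<pi> j X (Suc r)")
        case True
        have "(\<lambda>x. X(?i := x)) \<in> \<mu> (Suc r) ?i \<rightarrow>\<^sub>M PiM ?I (\<mu> (Suc r))"
          using i X by (intro measurable_fun_upd[of ?I "?I - {?i}" ?i]) auto
        then have "(\<lambda>x. G (Suc r) (X(?i := x))) \<in> borel_measurable borel"
          using measurable_compose[OF _ G_meas, of "\<lambda>x. X(?i := x)" "\<mu> (Suc r) ?i" "Suc r" "Suc r"]
          by (simp add: measurable_cong_sets[OF sets refl])
        from le[OF this] show ?thesis unfolding Gr u_def using True now by simp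
      next
        case False
        then have np: "\<not> played \<pi> j X (Suc r)" .
        have "G (Suc r) (X(?i := x)) = G (Suc r) X" for x
          unfolding G_def u_def using unplayed[OF np]
          by (intro arg_cong2[of _ _ _ _ "(*)"] prod.cong) (auto simp: played_upd_unplayed[OF np])
        moreover have "u (X(?i := x)) (Suc r) = 1" for x unfolding u_def now using False by simp
        ultimately show ?thesis
          unfolding Gr using \<Theta> j \<theta>' by (simp add: prob_space.emeasure_space_1[OF prob_space_arm_law] Pi_iff)
      qed
    qed
    moreover have "(\<integral>\<^sup>+S. G q S \<partial>PiM ?I (\<mu> q)) =
        (\<integral>\<^sup>+X. (\<integral>\<^sup>+x. G q (X(?i := x)) \<partial>\<mu> q ?i) \<partial>PiM (?I - {?i}) (\<mu> q))" for q
      by (rule nn_integral_PiM_split[OF _ i G_meas]) (rule prob)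
    ultimately show ?thesis by (simp only: law rest) (rule nn_integral_mono)
  qed
  have "(\<integral>\<^sup>+S. G 0 S \<partial>PiM ?I (\<mu> 0)) \<le> (\<integral>\<^sup>+S. G r S \<partial>PiM ?I (\<mu> r))" if "r \<le> T" for r
    using that
  proof (induction r)
    case (Suc r)
    then have "(\<integral>\<^sup>+S. G 0 S \<partial>PiM ?I (\<mu> 0)) \<le> (\<integral>\<^sup>+S. G r S \<partial>PiM ?I (\<mu> r))" by simp
    also have "\<dots> \<le> (\<integral>\<^sup>+S. G (Suc r) S \<partial>PiM ?I (\<mu> (Suc r)))" using Suc.prems by (intro step) simp
    finally show ?case .
  qed simp
  from this[of T] have "(\<integral>\<^sup>+S. G 0 S \<partial>PiM ?I (\<mu> 0)) \<le> (\<integral>\<^sup>+S. F S \<partial>PiM ?I (\<mu> T))"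
    by (simp add: G_def)
  also have "(\<integral>\<^sup>+S. F S \<partial>PiM ?I (\<mu> T)) = (\<integral>\<^sup>+S. F S \<partial>states (\<Theta> (j := \<theta>')))"
    unfolding states_eq
  proof (rule nn_integral_PiM_cong_on[where J = "{1..N} \<times> {1..T}"])
    show "F \<in> borel_measurable (PiM ?I (\<mu> T))" unfolding meas_eq by (rule F)
    fix S S' :: "nat \<times> nat \<Rightarrow> real"
    assume ext: "S \<in> extensional ?I" "S' \<in> extensional ?I"
      and eq: "\<And>a. a \<in> {1..N} \<times> {1..T} \<Longrightarrow> S a = S' a"
    show "F S = F S'"
    proof (rule dep)
      fix a r :: nat assume "1 \<le> r" "r \<le> T"
      then show "S (a, r) = S' (a, r)"
        using eq[of "(a, r)"] ext by (cases "a \<in> {1..N}") (auto simp: extensional_def)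
    qed
  qed (use \<Theta> \<theta>' in \<open>auto intro!: prob prob_space_arm_law simp: \<mu>_def sets_arm_law\<close>)
  also have "PiM ?I (\<mu> 0) = states \<Theta>"
    unfolding states_eq by (intro PiM_cong) (auto simp: \<mu>_def)
  finally show ?thesis by (simp add: G_def u_def del: fun_upd_apply)
qed

definition play_count :: "policy \<Rightarrow> nat \<Rightarrow> nat \<Rightarrow> (nat \<times> nat \<Rightarrow> real) \<Rightarrow> real" where
  "play_count \<pi> j T S = (\<Sum>t\<in>{1..T}. of_bool (played \<pi> j S t))"

lemma play_count_bounds: "0 \<le> play_count \<pi> j T S" "play_count \<pi> j T S \<le> real T"
proof -
  show "0 \<le> play_count \<pi> j T S" by (simp add: play_count_def sum_nonneg)
  have "play_count \<pi> j T S \<le> (\<Sum>t\<in>{1..T}. 1)" unfolding play_count_def by (intro sum_mono) simp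
  then show "play_count \<pi> j T S \<le> real T" by simp
qed

lemma measurable_play_count:
  assumes "decentralized_policy N M \<pi>" shows "play_count \<pi> j T \<in> borel_measurable (states \<Theta>)"
proof -
  have "(\<lambda>S. of_bool (played \<pi> j S t) :: real) \<in> borel_measurable (states \<Theta>)" if "t \<in> {1..T}" for t
  proof -
    have [measurable]: "Measurable.pred (states \<Theta>) (\<lambda>S. played \<pi> j S t)"
      using that by (intro pred_played assms) auto
    show ?thesis by measurable
  qed
  then show ?thesis unfolding play_count_def[abs_def] by (intro borel_measurable_sum)
qed

lemma integrable_play_count:
  assumes "decentralized_policy N M \<pi>" "\<Theta> \<in> {1..N} \<rightarrow> H"
  shows "integrable (states \<Theta>) (play_count \<pi> j T)"
proof -
  interpret prob_space "states \<Theta>" by (rule prob_space_states[OF assms(2)])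
  show ?thesis
    using play_count_bounds measurable_play_count[OF assms(1)]
    by (intro integrable_const_bound[of _ "real T"]) auto
qed

text \<open>Turns a lower bound for the gap in terms of some event into a lower bound for the regret in terms of
  the expected number of its occurrences.\<close>
lemma regret_ge_expectation:
  assumes \<pi>: "decentralized_policy N M \<pi>" and \<Theta>: "\<Theta> \<in> {1..N} \<rightarrow> H"
    and q: "integrable (states \<Theta>) (\<lambda>S. \<Sum>t\<in>{1..T}. q S t)"
    and le: "\<And>S t. 1 \<le> t \<Longrightarrow> \<Delta> * q S t \<le> gap \<Theta> (action M \<pi> S t)"
  shows "\<Delta> * (\<integral>S. (\<Sum>t\<in>{1..T}. q S t) \<partial>states \<Theta>) \<le> regret \<nu> f N M c \<pi> \<Theta> T"
proof -
  have "(\<integral>S. \<Delta> * (\<Sum>t\<in>{1..T}. q S t) \<partial>states \<Theta>) \<le> (\<integral>S. (\<Sum>t\<in>{1..T}. gap \<Theta> (action M \<pi> S t)) \<partial>states \<Theta>)"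
  proof (rule integral_mono[OF integrable_mult_right[OF q] Bochner_Integration.integrable_sum])
    show "\<Delta> * (\<Sum>t\<in>{1..T}. q S t) \<le> (\<Sum>t\<in>{1..T}. gap \<Theta> (action M \<pi> S t))" for S
      unfolding sum_distrib_left by (intro sum_mono le) simp
  qed (use regret_eq_expected_gap(1)[OF \<pi> \<Theta>] in auto)
  then show ?thesis using regret_eq_expected_gap(2)[OF \<pi> \<Theta>] q by simp
qed

text \<open>Taking the absolute value of the log-likelihood ratio can only decrease the weight. It makes the
  weight at most \<open>1\<close>, so that all integrands stay bounded.\<close>
lemma likelihood_weight:
  assumes \<theta>: "\<theta> \<in> H" "\<theta>' \<in> H" and pos: "AE y in arm_law \<nu> f \<theta>. 0 < f \<theta>' y"
    and \<psi>: "\<psi> \<in> borel_measurable borel"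
  shows "(\<integral>\<^sup>+x. \<psi> x * ennreal (exp (- \<bar>ln (f \<theta> x / f \<theta>' x)\<bar>)) \<partial>arm_law \<nu> f \<theta>) \<le> (\<integral>\<^sup>+x. \<psi> x \<partial>arm_law \<nu> f \<theta>')"
proof -
  have [measurable]: "f \<theta> \<in> borel_measurable \<nu>" "f \<theta>' \<in> borel_measurable \<nu>"
    and nonneg: "\<And>x. 0 \<le> f \<theta> x" "\<And>x. 0 \<le> f \<theta>' x" and sets: "sets \<nu> = sets borel"
    using densities \<theta> by (auto simp: density_family_def)
  have [measurable]: "\<psi> \<in> borel_measurable \<nu>" using \<psi> by (simp add: measurable_cong_sets[OF sets refl])
  have "AE x in \<nu>. 0 < ennreal (f \<theta> x) \<longrightarrow> 0 < f \<theta>' x"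
    using pos unfolding arm_law_def by (subst (asm) AE_density) auto
  then have le: "AE x in \<nu>. ennreal (f \<theta> x) * (\<psi> x * ennreal (exp (- \<bar>ln (f \<theta> x / f \<theta>' x)\<bar>))) \<le> ennreal (f \<theta>' x) * \<psi> x"
  proof eventually_elim
    case (elim x)
    have "f \<theta> x * exp (- \<bar>ln (f \<theta> x / f \<theta>' x)\<bar>) \<le> f \<theta>' x"
    proof (cases "f \<theta> x = 0")
      case False
      then have p: "0 < f \<theta> x" "0 < f \<theta>' x" using elim nonneg(1)[of x] by auto
      have "exp (- \<bar>ln (f \<theta> x / f \<theta>' x)\<bar>) \<le> exp (- ln (f \<theta> x / f \<theta>' x))" by simp
      also have "\<dots> = f \<theta>' x / f \<theta> x" using p by (simp add: exp_minus)
      finally show ?thesis using p by (simp add: field_simps)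
    qed (use nonneg in simp)
    then have "ennreal (f \<theta> x) * ennreal (exp (- \<bar>ln (f \<theta> x / f \<theta>' x)\<bar>)) \<le> ennreal (f \<theta>' x)"
      using nonneg by (simp flip: ennreal_mult)
    from mult_left_mono[OF this, of "\<psi> x"] show ?case by (simp add: mult_ac)
  qed
  show ?thesis
    unfolding arm_law_def using le by (simp add: nn_integral_density nn_integral_mono_AE)
qed

text \<open>If \<open>E n \<le> T/8\<close> then under \<open>\<Theta>\<close>, with probability at least \<open>1/2\<close>, both the number \<open>n\<close> of plays of \<open>j\<close> is below \<open>T/2\<close> and the
  total absolute log-likelihood ratio \<open>W\<close>, whose expectation is at most \<open>C E n\<close>, is below
  \<open>x = 4 C E n + 1\<close>. By the change of measure the event \<open>n < T/2\<close> then has probability at least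
  \<open>exp (- x) / 2\<close> under the changed parameters, where Markov's inequality makes it unlikely if \<open>j\<close> is
  usually played.\<close>
lemma plays_needed_to_separate:
  assumes \<pi>: "decentralized_policy N M \<pi>" and \<Theta>: "\<Theta> \<in> {1..N} \<rightarrow> H" and j: "j \<in> {1..N}" and \<theta>': "\<theta>' \<in> H"
    and pos: "AE y in arm_law \<nu> f (\<Theta> j). 0 < f \<theta>' y"
    and int: "integrable (arm_law \<nu> f (\<Theta> j)) (\<lambda>y. ln (f (\<Theta> j) y / f \<theta>' y))"
    and C: "(\<integral>y. \<bar>ln (f (\<Theta> j) y / f \<theta>' y)\<bar> \<partial>arm_law \<nu> f (\<Theta> j)) \<le> C"
    and T: "0 < T" and few: "8 * (\<integral>S. play_count \<pi> j T S \<partial>states \<Theta>) \<le> real T"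
  shows "exp (- (4 * C * (\<integral>S. play_count \<pi> j T S \<partial>states \<Theta>) + 1)) / 2
      \<le> 2 * (\<integral>S. (real T - play_count \<pi> j T S) \<partial>states (\<Theta> (j := \<theta>'))) / real T"
proof -
  let ?\<Theta>' = "\<Theta> (j := \<theta>')" and ?n = "play_count \<pi> j T"
  have \<Theta>': "?\<Theta>' \<in> {1..N} \<rightarrow> H" using \<Theta> \<theta>' by auto
  interpret S: prob_space "states \<Theta>" by (rule prob_space_states[OF \<Theta>])
  interpret S': prob_space "states ?\<Theta>'" by (rule prob_space_states[OF \<Theta>'])
  define l where "l y = \<bar>ln (f (\<Theta> j) y / f \<theta>' y)\<bar>" for y
  define W where "W S = (\<Sum>t\<in>{1..T}. of_bool (played \<pi> j S t) * l (S (j, t)))" for S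
  define a where "a = (\<integral>S. ?n S \<partial>states \<Theta>)"
  \<comment> \<open>the summand \<open>1\<close> keeps \<open>x\<close> positive when \<open>a = 0\<close>\<close>
  define x where "x = 4 * C * a + 1"
  have l0: "0 \<le> l y" for y by (simp add: l_def)
  have l_int: "integrable (arm_law \<nu> f (\<Theta> j)) l" unfolding l_def[abs_def] using int by (rule integrable_abs)
  then have l_meas [measurable]: "l \<in> borel_measurable borel"
    using borel_measurable_integrable[OF l_int] by (simp add: measurable_cong_sets[OF sets_arm_law refl])
  have C0: "0 \<le> C" by (rule order_trans[OF _ C]) simp
  have a0: "0 \<le> a" unfolding a_def using play_count_bounds(1) by (intro Bochner_Integration.integral_nonneg)
  have x1: "1 \<le> x" unfolding x_def using C0 a0 by simp
  have W0: "0 \<le> W S" for S unfolding W_def using l0 by (intro sum_nonneg) auto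
  have summand: "integrable (states \<Theta>) (\<lambda>S. of_bool (played \<pi> j S t) * l (S (j, t))) \<and>
      (\<integral>S. of_bool (played \<pi> j S t) * l (S (j, t)) \<partial>states \<Theta>) \<le> C * (\<integral>S. of_bool (played \<pi> j S t) \<partial>states \<Theta>)"
    if t: "1 \<le> t" for t
  proof -
    have P: "Measurable.pred (states \<Theta>) (\<lambda>S. played \<pi> j S t)" using pred_played[OF \<pi> t] .
    have past: "played \<pi> j (S((j, t) := y)) t \<longleftrightarrow> played \<pi> j S t" for S y
      by (intro played_cong_past) auto
    have law: "prob_space (arm_law \<nu> f (\<Theta> (fst a)))" if "a \<in> {1..N} \<times> {1..}" for a :: "nat \<times> nat"
      using that \<Theta> by (intro prob_space_arm_law) auto
    have jt: "(j, t) \<in> {1..N} \<times> {1..}" using t j by simp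
    have "integrable (arm_law \<nu> f (\<Theta> (fst (j, t)))) l" using l_int by simp
    note * = expectation_PiM_of_bool_mult[where I = "{1..N} \<times> {1..}" and \<mu> = "\<lambda>a. arm_law \<nu> f (\<Theta> (fst a))"
        and i = "(j, t)" and v = l, OF law jt P[unfolded states_eq] past this,
        folded states_eq, unfolded fst_conv]
    have "(\<integral>S. (of_bool (played \<pi> j S t) :: real) \<partial>states \<Theta>) = measure (states \<Theta>) {S \<in> space (states \<Theta>). played \<pi> j S t}"
      by (rule S.expectation_of_bool(2)[OF P])
    then have "(\<integral>S. of_bool (played \<pi> j S t) * l (S (j, t)) \<partial>states \<Theta>)
        = (\<integral>S. of_bool (played \<pi> j S t) \<partial>states \<Theta>) * (\<integral>y. l y \<partial>arm_law \<nu> f (\<Theta> j))" using * by simp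
    moreover have "0 \<le> (\<integral>S. (of_bool (played \<pi> j S t) :: real) \<partial>states \<Theta>)"
      by (intro Bochner_Integration.integral_nonneg) simp
    moreover have "(\<integral>y. l y \<partial>arm_law \<nu> f (\<Theta> j)) \<le> C" using C by (simp add: l_def)
    ultimately show ?thesis
      using *(1) mult_left_mono[of "\<integral>y. l y \<partial>arm_law \<nu> f (\<Theta> j)" C "\<integral>S. of_bool (played \<pi> j S t) \<partial>states \<Theta>"]
      by (simp only: mult.commute[of C] simp_thms)
  qed
  have W_int: "integrable (states \<Theta>) W" unfolding W_def[abs_def] using summand by (intro Bochner_Integration.integrable_sum) auto
  have EW: "(\<integral>S. W S \<partial>states \<Theta>) \<le> C * a"
  proof -
    have "(\<integral>S. W S \<partial>states \<Theta>) \<le> (\<Sum>t\<in>{1..T}. C * (\<integral>S. of_bool (played \<pi> j S t) \<partial>states \<Theta>))"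
      unfolding W_def using summand by (subst Bochner_Integration.integral_sum) (auto intro!: sum_mono)
    also have "\<dots> = C * (\<integral>S. ?n S \<partial>states \<Theta>)"
      unfolding play_count_def
    proof (subst Bochner_Integration.integral_sum)
      fix t assume "t \<in> {1..T}"
      then have [measurable]: "Measurable.pred (states \<Theta>) (\<lambda>S. played \<pi> j S t)"
        by (intro pred_played[OF \<pi>]) auto
      show "integrable (states \<Theta>) (\<lambda>S. of_bool (played \<pi> j S t) :: real)"
        by (intro S.integrable_const_bound[of _ 1]) auto
    qed (simp add: sum_distrib_left)
    finally show ?thesis by (simp add: a_def)
  qed
  have n_meas [measurable]: "?n \<in> borel_measurable (states \<Theta>)" "?n \<in> borel_measurable (states ?\<Theta>')"
    by (rule measurable_play_count[OF \<pi>])+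
  have W_meas [measurable]: "W \<in> borel_measurable (states \<Theta>)" using W_int by auto
  define F where "F S = (of_bool (2 * ?n S < real T) :: real)" for S
  have F_meas [measurable]: "F \<in> borel_measurable (states \<Theta>)" "F \<in> borel_measurable (states ?\<Theta>')"
    unfolding F_def[abs_def] by measurable
  have lower: "exp (- x) / 2 \<le> (\<integral>S. F S * exp (- W S) \<partial>states \<Theta>)"
  proof -
    \<comment> \<open>both applications of Markov's inequality at once, as a pointwise bound: the left side is positive only if \<open>n < T/2\<close> and \<open>W < x\<close>\<close>
    have low: "exp (- x) * (1 - 2 * ?n S / real T - W S / x) \<le> F S * exp (- W S)" for S
    proof (cases "2 * ?n S < real T \<and> W S < x")
      case True
      have "1 - 2 * ?n S / real T - W S / x \<le> 1" using play_count_bounds(1) W0[of S] x1 by (simp add: field_simps add_nonneg_nonneg)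
      then have "exp (- x) * (1 - 2 * ?n S / real T - W S / x) \<le> exp (- x)" by simp
      also have "\<dots> \<le> F S * exp (- W S)" using True by (simp add: F_def)
      finally show ?thesis .
    next
      case False
      then have "1 \<le> 2 * ?n S / real T \<or> 1 \<le> W S / x" using T x1 by (auto simp: field_simps)
      moreover have "0 \<le> 2 * ?n S / real T" "0 \<le> W S / x" using play_count_bounds(1) W0[of S] x1 by auto
      ultimately have "1 - 2 * ?n S / real T - W S / x \<le> 0" by linarith
      then have "exp (- x) * (1 - 2 * ?n S / real T - W S / x) \<le> 0" by (simp add: mult_nonneg_nonpos)
      also have "0 \<le> F S * exp (- W S)" by (simp add: F_def)
      finally show ?thesis .
    qed
    have n_int: "integrable (states \<Theta>) ?n" by (rule integrable_play_count[OF \<pi> \<Theta>])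
    have "2 * a / real T \<le> 1 / 4" using few T by (simp add: a_def field_simps)
    moreover have "(\<integral>S. W S \<partial>states \<Theta>) / x \<le> 1 / 4" using EW x1 by (simp add: x_def field_simps)
    ultimately have "exp (- x) / 2 \<le> exp (- x) * (1 - 2 * a / real T - (\<integral>S. W S \<partial>states \<Theta>) / x)" by simp
    also have "\<dots> = (\<integral>S. exp (- x) * (1 - 2 * ?n S / real T - W S / x) \<partial>states \<Theta>)"
      using n_int W_int by (simp add: a_def S.prob_space)
    also have "\<dots> \<le> (\<integral>S. F S * exp (- W S) \<partial>states \<Theta>)"
    proof (rule integral_mono[OF _ _ low])
      show "integrable (states \<Theta>) (\<lambda>S. exp (- x) * (1 - 2 * ?n S / real T - W S / x))"
        using n_int W_int by simp
      show "integrable (states \<Theta>) (\<lambda>S. F S * exp (- W S))"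
        using W0 by (intro S.integrable_const_bound[of _ 1]) (auto simp: F_def)
    qed
    finally show ?thesis .
  qed
  have upper: "(\<integral>S. F S \<partial>states ?\<Theta>') \<le> 2 * (\<integral>S. (real T - ?n S) \<partial>states ?\<Theta>') / real T"
  proof -
    have "F S \<le> 2 * (real T - ?n S) / real T" for S
      using T play_count_bounds(2)[of \<pi> j T S] by (auto simp: F_def field_simps)
    moreover have "integrable (states ?\<Theta>') (\<lambda>S. 2 * (real T - ?n S) / real T)"
      using integrable_play_count[OF \<pi> \<Theta>'] by simp
    moreover have "integrable (states ?\<Theta>') F"
      by (intro S'.integrable_const_bound[of _ 1]) (auto simp: F_def)
    ultimately have "(\<integral>S. F S \<partial>states ?\<Theta>') \<le> (\<integral>S. 2 * (real T - ?n S) / real T \<partial>states ?\<Theta>')"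
      by (intro integral_mono)
    then show ?thesis by (simp only: integral_divide_zero integral_mult_right_zero)
  qed
  have "ennreal (\<integral>S. F S * exp (- W S) \<partial>states \<Theta>) = (\<integral>\<^sup>+S. ennreal (F S * exp (- W S)) \<partial>states \<Theta>)"
    using W0 by (intro nn_integral_eq_integral[symmetric] S.integrable_const_bound[of _ 1]) (auto simp: F_def)
  also have "\<dots> = (\<integral>\<^sup>+S. ennreal (F S) * (\<Prod>s\<in>{1..T}. if played \<pi> j S s then ennreal (exp (- l (S (j, s)))) else 1) \<partial>states \<Theta>)"
  proof (intro nn_integral_cong)
    fix S
    have "exp (- W S) = (\<Prod>s\<in>{1..T}. if played \<pi> j S s then exp (- l (S (j, s))) else 1)"
      unfolding W_def sum_negf[symmetric] by (subst exp_sum) (auto intro!: prod.cong)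
    then have "ennreal (exp (- W S)) = (\<Prod>s\<in>{1..T}. ennreal (if played \<pi> j S s then exp (- l (S (j, s))) else 1))"
      by (simp add: prod_ennreal)
    also have "\<dots> = (\<Prod>s\<in>{1..T}. if played \<pi> j S s then ennreal (exp (- l (S (j, s)))) else 1)"
      by (intro prod.cong) auto
    finally show "ennreal (F S * exp (- W S)) = ennreal (F S) * (\<Prod>s\<in>{1..T}. if played \<pi> j S s then ennreal (exp (- l (S (j, s)))) else 1)"
      by (simp add: ennreal_mult F_def)
  qed
  also have "\<dots> \<le> (\<integral>\<^sup>+S. ennreal (F S) \<partial>states ?\<Theta>')"
  proof (rule change_of_measure[OF \<pi> \<Theta> j \<theta>'])
    show "(\<integral>\<^sup>+y. \<psi> y * ennreal (exp (- l y)) \<partial>arm_law \<nu> f (\<Theta> j)) \<le> (\<integral>\<^sup>+y. \<psi> y \<partial>arm_law \<nu> f \<theta>')"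
      if "\<psi> \<in> borel_measurable borel" for \<psi>
      unfolding l_def using \<Theta> j \<theta>' that by (intro likelihood_weight pos) auto
    show "ennreal (F S) = ennreal (F S')" if "\<And>a r. 1 \<le> r \<Longrightarrow> r \<le> T \<Longrightarrow> S (a, r) = S' (a, r)" for S S'
    proof -
      have "played \<pi> j S t = played \<pi> j S' t" if "t \<in> {1..T}" for t
        using that \<open>\<And>a r. 1 \<le> r \<Longrightarrow> r \<le> T \<Longrightarrow> S (a, r) = S' (a, r)\<close> by (intro played_cong_past) auto
      then show ?thesis by (simp add: F_def play_count_def)
    qed
    show "ennreal (F (S((j, s) := y))) = ennreal (F S)" if "\<not> played \<pi> j S s" for S s y
      using played_upd_unplayed[OF that] by (simp add: F_def play_count_def)
  qed auto
  also have "\<dots> = ennreal (\<integral>S. F S \<partial>states ?\<Theta>')"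
    by (intro nn_integral_eq_integral S'.integrable_const_bound[of _ 1]) (auto simp: F_def)
  finally have "ennreal (\<integral>S. F S * exp (- W S) \<partial>states \<Theta>) \<le> ennreal (\<integral>S. F S \<partial>states ?\<Theta>')" .
  moreover have "0 \<le> (\<integral>S. F S \<partial>states ?\<Theta>')"
    by (intro Bochner_Integration.integral_nonneg) (simp add: F_def)
  ultimately have "(\<integral>S. F S * exp (- W S) \<partial>states \<Theta>) \<le> (\<integral>S. F S \<partial>states ?\<Theta>')"
    by (simp only: ennreal_le_iff)
  then show ?thesis using lower upper by (simp add: x_def a_def)
qed

end

locale learnable_bandit = bandit \<nu> H f N M c
  for \<nu> and H :: "'p set" and f N M c +
  assumes M_pos: "1 \<le> M" and M_less_N: "M < N"
    and C2: "\<And>\<theta> \<theta>'. \<theta> \<in> H \<Longrightarrow> \<theta>' \<in> H \<Longrightarrow> arm_mean \<nu> f \<theta> < arm_mean \<nu> f \<theta>' \<Longrightarrow>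
               0 < kl_dist \<nu> f \<theta> \<theta>' \<and> kl_dist \<nu> f \<theta> \<theta>' < \<infinity>"
    and C4: "\<And>\<theta> \<delta>. \<theta> \<in> H \<Longrightarrow> 0 < \<delta> \<Longrightarrow>
               \<exists>\<theta>'\<in>H. arm_mean \<nu> f \<theta> < arm_mean \<nu> f \<theta>' \<and> arm_mean \<nu> f \<theta>' < arm_mean \<nu> f \<theta> + \<delta>"
begin

text \<open>The new mean exceeds the largest one, so \<open>j\<close> enters the set of best arms and the worst of the
  former best arms leaves it. Choosing a mean above the largest, which is nonnegative, also makes it positive.\<close>
lemma confusing_alternative:
  assumes \<Theta>: "\<Theta> \<in> valid"
  obtains j \<theta>' where "j \<in> {1..N} - best \<Theta>" "\<theta>' \<in> H" "mean (\<Theta> j) < mean \<theta>'" "0 < mean \<theta>'"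
    "\<Theta> (j := \<theta>') \<in> valid" "j \<in> best (\<Theta> (j := \<theta>'))"
proof -
  let ?m = "\<lambda>a. mean (\<Theta> a)" and ?B = "best \<Theta>"
  note top = best_arms_top_set[OF \<Theta> M_le_N]
  have \<Theta>H: "\<Theta> \<in> {1..N} \<rightarrow> H" using \<Theta> unfolding param_sets_def by blast
  have BN: "?B \<subseteq> {1..N}" and inj: "inj_on ?m ?B" and nonneg: "\<And>a. a \<in> ?B \<Longrightarrow> 0 \<le> ?m a"
    and less: "\<And>a b. a \<in> ?B \<Longrightarrow> b \<in> {1..N} - ?B \<Longrightarrow> ?m b < ?m a"
    using top(1) unfolding top_set_def by blast+
  have fin: "finite ?B" by simp
  have ne: "?B \<noteq> {}" using M_pos by auto
  have "Min (?m ` ?B) \<in> ?m ` ?B" "Max (?m ` ?B) \<in> ?m ` ?B" using fin ne by (intro Min_in Max_in; simp)+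
  then obtain b0 b1 where b01: "b0 \<in> ?B" "?m b0 = Min (?m ` ?B)" "b1 \<in> ?B" "?m b1 = Max (?m ` ?B)" by fastforce
  have b0: "b0 \<in> ?B" "\<And>a. a \<in> ?B \<Longrightarrow> ?m b0 \<le> ?m a"
    unfolding b01(2) using b01(1) fin by (auto intro!: Min_le)
  have b1: "b1 \<in> ?B" "\<And>a. a \<in> ?B \<Longrightarrow> ?m a \<le> ?m b1"
    unfolding b01(4) using b01(3) fin by (auto intro!: Max_ge)
  have "card ?B < card {1..N}" using top(2) M_less_N by simp
  then obtain j where j: "j \<in> {1..N}" "j \<notin> ?B" using BN by (metis card_mono fin linorder_not_less subsetI)
  \<comment> \<open>the bound \<open>1\<close> on the increase is arbitrary\<close>
  obtain \<theta>' where \<theta>': "\<theta>' \<in> H" "?m b1 < mean \<theta>'"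
    using C4[of "\<Theta> b1" 1] \<Theta>H b1(1) BN by auto
  let ?\<Theta>' = "\<Theta> (j := \<theta>')" and ?B' = "insert j (?B - {b0})"
  have j_less: "?m a < mean \<theta>'" if "a \<in> {1..N}" for a
  proof -
    have "?m a \<le> ?m b1" using b1(2)[of a] less[OF b1(1), of a] that by (cases "a \<in> ?B") (blast intro: less_imp_le)+
    then show ?thesis using \<theta>'(2) by simp
  qed
  have card: "card ?B' = M" using j b0(1) fin top(2) M_pos by simp
  have "top_set (\<lambda>a. mean (?\<Theta>' a)) N ?B'"
    unfolding top_set_def
  proof (intro conjI ballI)
    show "?B' \<subseteq> {1..N}" using BN j by auto
    have ne: "mean \<theta>' \<noteq> ?m a" if "a \<in> ?B" for a using j_less[of a] that BN by auto
    show "inj_on (\<lambda>a. mean (?\<Theta>' a)) ?B'"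
      using inj ne ne[symmetric] j by (auto simp: inj_on_def)
    show "0 \<le> mean (?\<Theta>' a)" if "a \<in> ?B'" for a
      using that nonneg nonneg[OF b1(1)] \<theta>'(2) by auto
    show "mean (?\<Theta>' b) < mean (?\<Theta>' a)" if a: "a \<in> ?B'" and b: "b \<in> {1..N} - ?B'" for a b
    proof (cases "a = j")
      case True
      then show ?thesis using j_less[of b] b by auto
    next
      case False
      then have a': "a \<in> ?B" "a \<noteq> b0" using a by auto
      have "?m b < ?m a"
      proof (cases "b = b0")
        case True
        then show ?thesis using b0(2)[OF a'(1)] inj_onD[OF inj, of a b0] a' b0(1) by force
      next
        case False
        then show ?thesis using less[OF a'(1), of b] b by auto
      qed
      then show ?thesis using False b by auto
    qed
  qed
  moreover have "?\<Theta>' \<in> {1..N} \<rightarrow> H" using \<Theta>H \<theta>' by auto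
  ultimately have valid': "?\<Theta>' \<in> valid" and "best ?\<Theta>' = ?B'"
    using param_sets_iff_top_set[OF M_le_N] card ranking_top_set[OF best_arm_ranking _ card] by blast+
  then have "j \<in> best ?\<Theta>'" by blast
  moreover have "0 < mean \<theta>'" using nonneg[OF b1(1)] \<theta>'(2) by linarith
  ultimately show thesis using that[of j \<theta>'] j \<theta>'(1) j_less[OF j(1)] valid' by blast
qed

text \<open>The constant depends on the gaps under the two parameter sets and on the law of the log-likelihood
  ratio, but not on the policy. Being uniformly good enters under the changed parameters, with exponent \<open>1/2\<close>.\<close>
theorem regret_at_least_logarithmic:
  assumes \<Theta>: "\<Theta> \<in> valid"
  shows "\<exists>L>0. \<forall>\<pi>. uniformly_good \<nu> H f N M c \<pi> \<longrightarrow>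
    (\<forall>\<^sub>F T in sequentially. L * ln (real T) \<le> regret \<nu> f N M c \<pi> \<Theta> T)"
proof -
  obtain j \<theta>' where j: "j \<in> {1..N} - best \<Theta>" and \<theta>': "\<theta>' \<in> H" "mean (\<Theta> j) < mean \<theta>'" "0 < mean \<theta>'"
    and valid': "\<Theta> (j := \<theta>') \<in> valid" and best': "j \<in> best (\<Theta> (j := \<theta>'))"
    using confusing_alternative[OF \<Theta>] .
  let ?\<Theta>' = "\<Theta> (j := \<theta>')"
  have \<Theta>H: "\<Theta> \<in> {1..N} \<rightarrow> H" "?\<Theta>' \<in> {1..N} \<rightarrow> H" using \<Theta> valid' unfolding param_sets_def by blast+
  have jN: "j \<in> {1..N}" using j by blast
  have "kl_dist \<nu> f (\<Theta> j) \<theta>' < \<infinity>" using C2[OF Pi_mem[OF \<Theta>H(1) jN] \<theta>'(1,2)] by blast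
  then have pos: "AE y in arm_law \<nu> f (\<Theta> j). 0 < f \<theta>' y"
    and int: "integrable (arm_law \<nu> f (\<Theta> j)) (\<lambda>y. ln (f (\<Theta> j) y / f \<theta>' y))"
    by (auto simp: kl_dist_def split: if_splits)
  \<comment> \<open>the summand \<open>1\<close> makes \<open>C\<close> a legitimate denominator\<close>
  define C where "C = (\<integral>y. \<bar>ln (f (\<Theta> j) y / f \<theta>' y)\<bar> \<partial>arm_law \<nu> f (\<Theta> j)) + 1"
  have C: "0 < C" unfolding C_def by (intro add_nonneg_pos Bochner_Integration.integral_nonneg) auto
  obtain \<Delta> where \<Delta>: "0 < \<Delta>" "\<And>a. 0 < gap \<Theta> a \<Longrightarrow> \<Delta> \<le> gap \<Theta> a" by (rule gap_bounded_below[of \<Theta>]) blast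
  obtain \<Delta>' where \<Delta>': "0 < \<Delta>'" "\<And>a. 0 < gap ?\<Theta>' a \<Longrightarrow> \<Delta>' \<le> gap ?\<Theta>' a" by (rule gap_bounded_below[of ?\<Theta>']) blast
  show ?thesis
  proof (intro exI[of _ "\<Delta> / (16 * C)"] conjI allI impI)
    show "0 < \<Delta> / (16 * C)" using \<Delta> C by simp
    fix \<pi> assume good: "uniformly_good \<nu> H f N M c \<pi>"
    then have \<pi>: "decentralized_policy N M \<pi>" by (simp add: uniformly_good_def)
    define a where "a T = (\<integral>S. play_count \<pi> j T S \<partial>states \<Theta>)" for T
    define b where "b T = (\<integral>S. (real T - play_count \<pi> j T S) \<partial>states ?\<Theta>')" for T
    have a: "\<Delta> * a T \<le> regret \<nu> f N M c \<pi> \<Theta> T" for T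
      unfolding a_def play_count_def
    proof (rule regret_ge_expectation[OF \<pi> \<Theta>H(1)])
      show "\<Delta> * of_bool (played \<pi> j S t) \<le> gap \<Theta> (action M \<pi> S t)" for S t
        using gap_nonneg[OF \<Theta>] \<Delta>(2) gap_pos_if_bad_arm_played[OF \<Theta> j] by (auto simp: played_def)
    qed (use integrable_play_count[OF \<pi> \<Theta>H(1)] in \<open>simp add: play_count_def[abs_def]\<close>)
    have b: "\<Delta>' * b T \<le> regret \<nu> f N M c \<pi> ?\<Theta>' T" for T
    proof -
      have co: "real T - play_count \<pi> j T S = (\<Sum>t\<in>{1..T}. 1 - of_bool (played \<pi> j S t))" for S
        by (simp add: play_count_def sum_subtractf)
      show ?thesis
        unfolding b_def co
      proof (rule regret_ge_expectation[OF \<pi> \<Theta>H(2)])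
        show "\<Delta>' * (1 - of_bool (played \<pi> j S t)) \<le> gap ?\<Theta>' (action M \<pi> S t)" for S t
        proof (cases "played \<pi> j S t")
          case False
          then have "0 < gap ?\<Theta>' (action M \<pi> S t)"
            using \<theta>'(3) by (intro gap_pos_if_good_arm_unplayed[OF valid' best']) (auto simp: played_def)
          then show ?thesis using \<Delta>'(2) False by simp
        qed (use gap_nonneg[OF valid'] in simp)
        interpret prob_space "states ?\<Theta>'" by (rule prob_space_states[OF \<Theta>H(2)])
        have "integrable (states ?\<Theta>') (\<lambda>S. real T - play_count \<pi> j T S)"
          using integrable_play_count[OF \<pi> \<Theta>H(2)] by simp
        then show "integrable (states ?\<Theta>') (\<lambda>S. \<Sum>t\<in>{1..T}. (1 - of_bool (played \<pi> j S t) :: real))"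
          by (simp only: co)
      qed
    qed
    have "regret \<nu> f N M c \<pi> ?\<Theta>' \<in> o(\<lambda>T. real T powr (1 / 2))"
      using good valid' unfolding uniformly_good_def by force
    from landau_o.smallD[OF this, of "\<Delta>' / 4"] \<Delta>'(1)
    have small: "\<forall>\<^sub>F T in sequentially. \<bar>regret \<nu> f N M c \<pi> ?\<Theta>' T\<bar> \<le> \<Delta>' / 4 * real T powr (1 / 2)"
      by simp
    have "\<forall>\<^sub>F T in sequentially. 4 \<le> ln (real T)" by real_asymp
    moreover have "\<forall>\<^sub>F T in sequentially. ln (real T) / (16 * C) \<le> real T / 8"
      using C by real_asymp
    ultimately show "\<forall>\<^sub>F T in sequentially. \<Delta> / (16 * C) * ln (real T) \<le> regret \<nu> f N M c \<pi> \<Theta> T"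
      using small eventually_gt_at_top[of 0]
    proof eventually_elim
      case (elim T)
      have "ln (real T) / (16 * C) \<le> a T"
      \<comment> \<open>otherwise the number of plays is linear in \<open>T\<close> and there is nothing to show\<close>
      proof (cases "8 * a T \<le> real T")
        case True
        have "exp (- (4 * C * a T + 1)) / 2 \<le> 2 * b T / real T"
          unfolding a_def b_def
        proof (rule plays_needed_to_separate[OF \<pi> \<Theta>H(1) jN \<theta>'(1) pos int])
          show "(\<integral>y. \<bar>ln (f (\<Theta> j) y / f \<theta>' y)\<bar> \<partial>arm_law \<nu> f (\<Theta> j)) \<le> C" by (simp add: C_def)
          show "0 < T" using elim by simp
          show "8 * (\<integral>S. play_count \<pi> j T S \<partial>states \<Theta>) \<le> real T" using True by (simp add: a_def)
        qed
        also have "\<dots> \<le> 2 * (real T powr (1 / 2) / 4) / real T"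
        proof -
          have "\<Delta>' * b T \<le> \<Delta>' * (real T powr (1 / 2) / 4)" using b[of T] elim(3) by linarith
          then have "b T \<le> real T powr (1 / 2) / 4" using \<Delta>'(1) by simp
          then show ?thesis by (intro divide_right_mono mult_left_mono) auto
        qed
        also have "\<dots> = exp (- (ln (real T) / 2)) / 2"
        proof -
          have "real T powr (1 / 2) / real T = real T powr (1 / 2 - 1)"
            using elim powr_diff[of "real T" "1 / 2" 1] by simp
          then show ?thesis using elim by (simp add: powr_def)
        qed
        finally have "ln (real T) / 2 \<le> 4 * C * a T + 1" by simp
        then have "ln (real T) / 4 \<le> 4 * C * a T" using elim(1) by linarith
        then show ?thesis using C by (simp add: field_simps)
      next
        case False
        then show ?thesis using elim(2) by linarith
      qed
      then have "\<Delta> * (ln (real T) / (16 * C)) \<le> \<Delta> * a T" using \<Delta>(1) by (intro mult_left_mono) auto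
      then show ?case using a[of T] by simp
    qed
  qed
qed

end

section \<open>The rotating policy\<close>
lemma measurable_insort_key:
  fixes k :: "'x \<Rightarrow> 'a::countable \<Rightarrow> 'b::linorder"
  assumes k: "\<And>a b. Measurable.pred M (\<lambda>x. k x a \<le> k x b)"
    and L: "L \<in> M \<rightarrow>\<^sub>M count_space UNIV"
  shows "(\<lambda>x. insort_key (k x) a (L x)) \<in> M \<rightarrow>\<^sub>M count_space UNIV"
proof (rule measurable_compose_countable[OF _ L])
  fix ys show "(\<lambda>x. insort_key (k x) a ys) \<in> M \<rightarrow>\<^sub>M count_space UNIV"
  proof (induction ys)
    case (Cons y ys)
    have "(\<lambda>x. y # insort_key (k x) a ys) \<in> M \<rightarrow>\<^sub>M count_space UNIV"
      using Cons by (rule measurable_compose) simp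
    then show ?case
      using k[of a y] by (auto intro!: measurable_If simp: pred_def)
  qed simp
qed

text \<open>Sorting depends on the keys through finitely many comparisons, and the result ranges over a
  countable type.\<close>
lemma measurable_sort_key:
  fixes k :: "'x \<Rightarrow> 'a::countable \<Rightarrow> 'b::linorder"
  assumes k: "\<And>a b. Measurable.pred M (\<lambda>x. k x a \<le> k x b)"
    and L: "L \<in> M \<rightarrow>\<^sub>M count_space UNIV"
  shows "(\<lambda>x. sort_key (k x) (L x)) \<in> M \<rightarrow>\<^sub>M count_space UNIV"
proof (rule measurable_compose_countable[OF _ L])
  fix ys show "(\<lambda>x. sort_key (k x) ys) \<in> M \<rightarrow>\<^sub>M count_space UNIV"
    by (induction ys) (auto intro!: measurable_insort_key k)
qed

lemma take_sort_key_top: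
  assumes "a \<in> set (take m (sort_key k xs))" "b \<in> set xs" "b \<notin> set (take m (sort_key k xs))"
  shows "k a \<le> k b"
proof -
  let ?ys = "sort_key k xs"
  have "b \<in> set (drop m ?ys)"
    using assms(2,3) set_append[of "take m ?ys" "drop m ?ys"] by auto
  moreover have "sorted (map k (take m ?ys) @ map k (drop m ?ys))"
    by (simp flip: map_append)
  ultimately show ?thesis using assms(1) unfolding sorted_append by auto
qed

text \<open>The index of arm \<open>j\<close> at the start of round \<open>n\<close>, rounds being numbered from \<open>0\<close>. At most \<open>n\<close> samples
  are available then, so that the bound for time \<open>Suc n\<close> has \<open>k < Suc n\<close>, as the conditions on \<open>g\<close>
  demand. An arm without samples gets the index \<open>\<infinity>\<close>, which forces it to be tried.\<close>
definition ucb_index :: "nat \<Rightarrow> (nat \<Rightarrow> nat \<Rightarrow> (nat \<Rightarrow> real) \<Rightarrow> real) \<Rightarrow> history \<Rightarrow> nat \<Rightarrow> nat \<Rightarrow> ereal" where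
  "ucb_index M g x n j =
     (let p = \<lambda>r. fst (x r) = j; k = hits p (n * M)
      in if k = 0 then \<infinity> else ereal (g (Suc n) k (restrict (sample p (\<lambda>r. fst (snd (x r))) (n * M)) {1..k})))"

definition point_estimate :: "nat \<Rightarrow> (nat \<Rightarrow> (nat \<Rightarrow> real) \<Rightarrow> real) \<Rightarrow> history \<Rightarrow> nat \<Rightarrow> nat \<Rightarrow> real" where
  "point_estimate M h x n j =
     (let p = \<lambda>r. fst (x r) = j; k = hits p (n * M)
      in if k = 0 then 0 else h k (restrict (sample p (\<lambda>r. fst (snd (x r))) (n * M)) {1..k}))"

text \<open>Both sorts are by decreasing key: first the \<open>M\<close> arms with the largest indices are selected, then
  they are put in the order of their estimated means.\<close>
definition schedule ::
  "nat \<Rightarrow> nat \<Rightarrow> (nat \<Rightarrow> (nat \<Rightarrow> real) \<Rightarrow> real) \<Rightarrow> (nat \<Rightarrow> nat \<Rightarrow> (nat \<Rightarrow> real) \<Rightarrow> real) \<Rightarrow> history \<Rightarrow> nat \<Rightarrow> nat list" where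
  "schedule N M h g x n =
     sort_key (\<lambda>j. - point_estimate M h x n j) (take M (sort_key (\<lambda>j. - ucb_index M g x n j) [1..<Suc N]))"

text \<open>The offset \<open>i\<close> keeps players with equal schedules apart at all times.\<close>
definition rotating_ucb ::
  "nat \<Rightarrow> nat \<Rightarrow> (nat \<Rightarrow> (nat \<Rightarrow> real) \<Rightarrow> real) \<Rightarrow> (nat \<Rightarrow> nat \<Rightarrow> (nat \<Rightarrow> real) \<Rightarrow> real) \<Rightarrow> policy" where
  "rotating_ucb N M h g i t x = schedule N M h g x ((t - 1) div M) ! ((t - 1 + i) mod M)"

lemma schedule_cong:
  assumes "\<And>r. 1 \<le> r \<Longrightarrow> r \<le> n * M \<Longrightarrow> x r = y r"
  shows "schedule N M h g x n = schedule N M h g y n"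
proof -
  have "hits (\<lambda>r. fst (x r) = j) (n * M) = hits (\<lambda>r. fst (y r) = j) (n * M)" for j
    using assms by (intro hits_cong) auto
  moreover have "sample (\<lambda>r. fst (x r) = j) (\<lambda>r. fst (snd (x r))) (n * M) =
      sample (\<lambda>r. fst (y r) = j) (\<lambda>r. fst (snd (y r))) (n * M)" for j
    using assms by (intro ext sample_cong) auto
  ultimately have "ucb_index M g x n j = ucb_index M g y n j" "point_estimate M h x n j = point_estimate M h y n j" for j
    by (simp_all only: ucb_index_def point_estimate_def Let_def)
  then show ?thesis by (simp only: schedule_def)
qed

lemma schedule_facts:
  assumes "M \<le> N"
  shows "length (schedule N M h g x n) = M" "distinct (schedule N M h g x n)"
    "set (schedule N M h g x n) \<subseteq> {1..N}" "card (set (schedule N M h g x n)) = M"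
proof -
  show len: "length (schedule N M h g x n) = M" using assms by (simp add: schedule_def)
  show dist: "distinct (schedule N M h g x n)" by (simp add: schedule_def)
  show "set (schedule N M h g x n) \<subseteq> {1..N}"
    using set_take_subset[of M "sort_key (\<lambda>j. - ucb_index M g x n j) [1..<Suc N]"] by (auto simp: schedule_def)
  show "card (set (schedule N M h g x n)) = M" using distinct_card[OF dist] len by simp
qed

lemma schedule_top:
  assumes "a \<in> set (schedule N M h g x n)" "b \<in> {1..N}" "b \<notin> set (schedule N M h g x n)"
  shows "ucb_index M g x n b \<le> ucb_index M g x n a"
  using take_sort_key_top[of a M "\<lambda>j. - ucb_index M g x n j" "[1..<Suc N]" b] assms
  by (auto simp: schedule_def simp del: upt_Suc)

lemma schedule_sorted: "sorted (map (\<lambda>j. - point_estimate M h x n j) (schedule N M h g x n))"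
  by (simp add: schedule_def)

text \<open>A statistic of a random number of samples, with the value \<open>z\<close> when there are none.\<close>
lemma measurable_of_samples:
  assumes K: "\<And>k. 1 \<le> k \<Longrightarrow> K k \<in> PiM {1..k} (\<lambda>_. borel) \<rightarrow>\<^sub>M L" and z: "z \<in> space L"
    and p: "\<And>r. 1 \<le> r \<Longrightarrow> r \<le> T \<Longrightarrow> Measurable.pred M (\<lambda>x. p x r)"
    and v: "\<And>r. 1 \<le> r \<Longrightarrow> r \<le> T \<Longrightarrow> (\<lambda>x. v x r) \<in> borel_measurable M"
  shows "(\<lambda>x. let k = hits (p x) T in if k = 0 then z else K k (restrict (sample (p x) (v x) T) {1..k})) \<in> M \<rightarrow>\<^sub>M L"
  unfolding Let_def
proof (rule measurable_compose_countable[OF _ measurable_hits[OF p]])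
  fix k :: nat
  have "(\<lambda>x. restrict (sample (p x) (v x) T) {1..k}) \<in> M \<rightarrow>\<^sub>M PiM {1..k} (\<lambda>_. borel)"
    by (intro measurable_restrict measurable_sample p v)
  then have *: "(\<lambda>x. K k (restrict (sample (p x) (v x) T) {1..k})) \<in> M \<rightarrow>\<^sub>M L" if "1 \<le> k"
    using K[OF that] by (rule measurable_compose)
  show "(\<lambda>x. if k = 0 then z else K k (restrict (sample (p x) (v x) T) {1..k})) \<in> M \<rightarrow>\<^sub>M L"
  proof (cases "k = 0")
    case True
    then show ?thesis using z by (simp only: simp_thms if_True measurable_const)
  next
    case False
    then show ?thesis using * by (simp only: simp_thms if_False)
  qed
qed

locale ucb_bandit = learnable_bandit \<nu> H f N M c
  for \<nu> and H :: "'p set" and f N M c +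
  fixes h :: "nat \<Rightarrow> (nat \<Rightarrow> real) \<Rightarrow> real" and g :: "nat \<Rightarrow> nat \<Rightarrow> (nat \<Rightarrow> real) \<Rightarrow> real"
  assumes C5: "estimators \<nu> H f h g"
begin

lemmas C5_parts = C5[unfolded estimators_def]

lemma h_meas: "1 \<le> k \<Longrightarrow> h k \<in> borel_measurable (PiM {1..k} (\<lambda>_. borel))"
  using C5_parts[THEN conjunct1] by blast

lemma g_meas: "1 \<le> t \<Longrightarrow> 1 \<le> k \<Longrightarrow> g t k \<in> borel_measurable (PiM {1..k} (\<lambda>_. borel))"
  using C5_parts[THEN conjunct2, THEN conjunct1] by blast

lemma g_optimistic:
  "\<theta> \<in> H \<Longrightarrow> r < mean \<theta> \<Longrightarrow>
    (\<lambda>t. 1 - measure (obs_space \<nu> f \<theta>)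
        {S \<in> space (obs_space \<nu> f \<theta>). \<forall>k\<in>{1..<t}. r \<le> g t k (restrict S {1..k})}) \<in> o(\<lambda>t. 1 / real t)"
  using C5_parts[THEN conjunct2, THEN conjunct2, THEN conjunct1] by blast

lemma g_rarely_large:
  "\<theta> \<in> H \<Longrightarrow> \<theta>' \<in> H \<Longrightarrow> mean \<theta> < mean \<theta>' \<Longrightarrow>
    \<exists>l. ((\<lambda>\<epsilon>. limsup (\<lambda>t. ereal
            ((\<Sum>k\<in>{1..<t}. measure (obs_space \<nu> f \<theta>)
                {S \<in> space (obs_space \<nu> f \<theta>). mean \<theta>' - \<epsilon> \<le> g t k (restrict S {1..k})}) / ln (real t))))
         \<longlongrightarrow> l) (at_right 0) \<and>
        l \<le> 1 / kl_dist \<nu> f \<theta> \<theta>'"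
  using C5_parts[THEN conjunct2, THEN conjunct2, THEN conjunct2, THEN conjunct1] by blast

lemma g_mono: "1 \<le> k \<Longrightarrow> 1 \<le> t \<Longrightarrow> t \<le> t' \<Longrightarrow> g t k (restrict S {1..k}) \<le> g t' k (restrict S {1..k})"
  using C5_parts[THEN conjunct2, THEN conjunct2, THEN conjunct2, THEN conjunct2, THEN conjunct1] by blast

lemma h_concentrates:
  "\<theta> \<in> H \<Longrightarrow> 0 < \<epsilon> \<Longrightarrow> 0 < \<delta> \<Longrightarrow> \<delta> < 1 \<Longrightarrow>
    (\<lambda>t. measure (obs_space \<nu> f \<theta>)
       {S \<in> space (obs_space \<nu> f \<theta>).
          \<epsilon> < (MAX k\<in>{k. \<delta> * real t \<le> real k \<and> k \<le> t}. \<bar>h k (restrict S {1..k}) - mean \<theta>\<bar>)})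
    \<in> o(\<lambda>t. 1 / real t)"
  using C5_parts[THEN conjunct2, THEN conjunct2, THEN conjunct2, THEN conjunct2, THEN conjunct2, THEN conjunct2] by blast

lemma decentralized_rotating_ucb: "decentralized_policy N M (rotating_ucb N M h g)"
  unfolding decentralized_policy_def
proof (intro ballI allI impI)
  fix i t :: nat assume t: "1 \<le> t"
  define n where "n = (t - 1) div M"
  have n: "n * M < t" unfolding n_def using t div_times_less_eq_dividend[of "t - 1" M] by linarith
  have comp: "(\<lambda>x. x r) \<in> history_space t \<rightarrow>\<^sub>M count_space UNIV \<Otimes>\<^sub>M (borel \<Otimes>\<^sub>M count_space UNIV)"
    if "1 \<le> r" "r \<le> n * M" for r
    unfolding history_space_def using that n by (intro measurable_component_singleton) auto
  have p: "Measurable.pred (history_space t) (\<lambda>x. fst (x r) = j)" if "1 \<le> r" "r \<le> n * M" for r j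
    using measurable_compose[OF comp[OF that] measurable_fst] by measurable
  have v: "(\<lambda>x. fst (snd (x r))) \<in> borel_measurable (history_space t)" if "1 \<le> r" "r \<le> n * M" for r
    using measurable_compose[OF measurable_compose[OF comp[OF that] measurable_snd] measurable_fst] .
  have [measurable]: "(\<lambda>x. ucb_index M g x n j) \<in> borel_measurable (history_space t)" for j
    using measurable_of_samples[where K = "\<lambda>k y. ereal (g (Suc n) k y)" and L = borel and z = \<infinity>
        and T = "n * M" and M = "history_space t" and p = "\<lambda>x r. fst (x r) = j" and v = "\<lambda>x r. fst (snd (x r))",
        OF _ _ p v] g_meas[of "Suc n"]
    unfolding ucb_index_def Let_def by simp
  have [measurable]: "(\<lambda>x. point_estimate M h x n j) \<in> borel_measurable (history_space t)" for j
    using measurable_of_samples[where K = h and L = borel and z = 0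
        and T = "n * M" and M = "history_space t" and p = "\<lambda>x r. fst (x r) = j" and v = "\<lambda>x r. fst (snd (x r))",
        OF _ _ p v] h_meas
    unfolding point_estimate_def Let_def by simp
  have ord: "Measurable.pred (history_space t) (\<lambda>x. - ucb_index M g x n a \<le> - ucb_index M g x n b)" for a b
    unfolding ereal_minus_le_minus Measurable.pred_def by (rule borel_measurable_le) measurable
  have ord': "Measurable.pred (history_space t) (\<lambda>x. - point_estimate M h x n a \<le> - point_estimate M h x n b)" for a b
    unfolding Measurable.pred_def by (rule borel_measurable_le) measurable
  have top: "(\<lambda>x. take M (sort_key (\<lambda>j. - ucb_index M g x n j) [1..<Suc N])) \<in> history_space t \<rightarrow>\<^sub>M count_space UNIV"
    by (rule measurable_compose[OF measurable_sort_key[OF ord]]) simp_all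
  have "(\<lambda>x. schedule N M h g x n) \<in> history_space t \<rightarrow>\<^sub>M count_space UNIV"
    unfolding schedule_def by (rule measurable_sort_key[OF ord' top])
  then have "(\<lambda>x. schedule N M h g x n ! ((t - 1 + i) mod M)) \<in> history_space t \<rightarrow>\<^sub>M count_space UNIV"
    by (rule measurable_compose) simp
  then have meas: "rotating_ucb N M h g i t \<in> history_space t \<rightarrow>\<^sub>M count_space UNIV"
    unfolding rotating_ucb_def[abs_def] n_def .
  have range: "rotating_ucb N M h g i t x \<in> {1..N}" for x
  proof -
    have "rotating_ucb N M h g i t x \<in> set (schedule N M h g x n)"
      unfolding rotating_ucb_def n_def using M_pos by (intro nth_mem) (simp add: schedule_facts[OF M_le_N])
    then show ?thesis using schedule_facts(3)[OF M_le_N] by blast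
  qed
  show "rotating_ucb N M h g i t \<in> history_space t \<rightarrow>\<^sub>M count_space {1..N}"
    using range measurable_sets[OF meas] by (subst measurable_count_space_eq2) auto
qed

text \<open>What player \<open>i\<close> records at time \<open>r\<close>; the local history before time \<open>t\<close> is its restriction to
  \<open>{1..<t}\<close>.\<close>
definition trajectory :: "(nat \<times> nat \<Rightarrow> real) \<Rightarrow> nat \<Rightarrow> history" where
  "trajectory S i r = (let a = action M (rotating_ucb N M h g) S r in (a i, S (a i, r), \<exists>j\<in>{1..M}. j \<noteq> i \<and> a j = a i))"

definition plan :: "(nat \<times> nat \<Rightarrow> real) \<Rightarrow> nat \<Rightarrow> nat \<Rightarrow> nat list" where
  "plan S i n = schedule N M h g (trajectory S i) n"

lemma action_rotating_ucb:
  assumes "1 \<le> t"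
  shows "action M (rotating_ucb N M h g) S t i = plan S i ((t - 1) div M) ! ((t - 1 + i) mod M)"
proof -
  have "schedule N M h g (restrict (trajectory S i) {1..<t}) ((t - 1) div M) = plan S i ((t - 1) div M)"
    unfolding plan_def
  proof (rule schedule_cong)
    fix r assume "1 \<le> r" "r \<le> (t - 1) div M * M"
    moreover from this have "r < t" using assms div_times_less_eq_dividend[of "t - 1" M] by linarith
    ultimately show "restrict (trajectory S i) {1..<t} r = trajectory S i r" by simp
  qed
  then show ?thesis
    unfolding action.simps[of M _ S t i] rotating_ucb_def trajectory_def[abs_def] Let_def by simp
qed

abbreviation targets :: "(nat \<times> nat \<Rightarrow> real) \<Rightarrow> nat \<Rightarrow> nat \<Rightarrow> nat \<Rightarrow> bool" where
  "targets S i j r \<equiv> action M (rotating_ucb N M h g) S r i = j"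

lemma rotation_bij: "bij_betw (\<lambda>s. (s + i) mod M) {..<M} {..<M}"
proof -
  have collision: False if "s < s'" "s' < M" "(s + i) mod M = (s' + i) mod M" for s s'
  proof -
    have "M dvd (s' + i) - (s + i)" using that by (subst mod_eq_dvd_iff_nat[symmetric]) auto
    then show False using that by (auto dest: dvd_imp_le)
  qed
  have inj: "inj_on (\<lambda>s. (s + i) mod M) {..<M}"
  proof (rule inj_onI)
    fix s s' assume "s \<in> {..<M}" "s' \<in> {..<M}" "(s + i) mod M = (s' + i) mod M"
    then show "s = s'" using collision[of s s'] collision[of s' s] by (cases s s' rule: linorder_cases) auto
  qed
  moreover have "(\<lambda>s. (s + i) mod M) ` {..<M} = {..<M}"
    using M_pos by (intro endo_inj_surj inj) auto
  ultimately show ?thesis by (simp add: bij_betw_def)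
qed

lemma card_rotated_slots:
  assumes "distinct xs" "length xs = M"
  shows "card {s \<in> {..<M}. xs ! ((s + i) mod M) = j} = of_bool (j \<in> set xs)"
proof -
  note inj = bij_betw_imp_inj_on[OF rotation_bij[of i]] and surj = bij_betw_imp_surj_on[OF rotation_bij[of i]]
  have "{u \<in> {..<M}. xs ! u = j} = (\<lambda>s. (s + i) mod M) ` {s \<in> {..<M}. xs ! ((s + i) mod M) = j}"
  proof (intro set_eqI iffI)
    fix u assume u: "u \<in> {u \<in> {..<M}. xs ! u = j}"
    then have "u \<in> (\<lambda>s. (s + i) mod M) ` {..<M}" using surj by simp
    then obtain s where "s < M" "u = (s + i) mod M" by blast
    then show "u \<in> (\<lambda>s. (s + i) mod M) ` {s \<in> {..<M}. xs ! ((s + i) mod M) = j}" using u by blast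
  qed (use M_pos in auto)
  moreover have "inj_on (\<lambda>s. (s + i) mod M) {s \<in> {..<M}. xs ! ((s + i) mod M) = j}"
    using inj by (rule inj_on_subset) blast
  ultimately have "card {s \<in> {..<M}. xs ! ((s + i) mod M) = j} = card {u \<in> {..<M}. xs ! u = j}"
    by (simp only: card_image)
  also have "\<dots> = of_bool (j \<in> set xs)"
  proof (cases "j \<in> set xs")
    case True
    then obtain u where "u < M" "xs ! u = j" using assms by (auto simp: in_set_conv_nth)
    then have "{u \<in> {..<M}. xs ! u = j} = {u}" using assms by (auto simp: nth_eq_iff_index_eq)
    then show ?thesis using True by simp
  next
    case False
    then have "{u \<in> {..<M}. xs ! u = j} = {}" using assms by (auto simp: in_set_conv_nth)
    then show ?thesis using False by simp
  qed
  finally show ?thesis .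
qed

lemma hits_round: "hits p (n * M + M) = hits p (n * M) + card {s \<in> {..<M}. p (n * M + s + 1)}"
proof -
  have "{r \<in> {1..n * M + M}. p r} = {r \<in> {1..n * M}. p r} \<union> (\<lambda>s. n * M + s + 1) ` {s \<in> {..<M}. p (n * M + s + 1)}"
  proof (intro set_eqI iffI)
    fix r assume r: "r \<in> {r \<in> {1..n * M + M}. p r}"
    show "r \<in> {r \<in> {1..n * M}. p r} \<union> (\<lambda>s. n * M + s + 1) ` {s \<in> {..<M}. p (n * M + s + 1)}"
    proof (cases "r \<le> n * M")
      case False
      then have "r = n * M + (r - n * M - 1) + 1" "r - n * M - 1 < M" using r by auto
      then show ?thesis using r by (intro UnI2 image_eqI[of _ _ "r - n * M - 1"]) auto
    qed (use r in auto)
  qed auto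
  moreover have "card ({r \<in> {1..n * M}. p r} \<union> (\<lambda>s. n * M + s + 1) ` {s \<in> {..<M}. p (n * M + s + 1)})
      = card {r \<in> {1..n * M}. p r} + card ((\<lambda>s. n * M + s + 1) ` {s \<in> {..<M}. p (n * M + s + 1)})"
    by (intro card_Un_disjoint) auto
  moreover have "card ((\<lambda>s. n * M + s + 1) ` {s \<in> {..<M}. p (n * M + s + 1)}) = card {s \<in> {..<M}. p (n * M + s + 1)}"
    by (intro card_image) (auto simp: inj_on_def)
  ultimately show ?thesis by (simp add: hits_def)
qed

text \<open>In one round a player runs through its schedule exactly once.\<close>
lemma hits_plan_Suc:
  "hits (targets S i j) (Suc n * M) = hits (targets S i j) (n * M) + of_bool (j \<in> set (plan S i n))"
proof -
  have act: "action M (rotating_ucb N M h g) S (n * M + s + 1) i = plan S i n ! ((s + i) mod M)" if "s < M" for s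
  proof -
    have "(n * M + s) div M = n" using that M_pos by simp
    moreover have "(n * M + s + i) mod M = (s + i) mod M" by (metis add.assoc mod_mult_self3)
    ultimately show ?thesis by (simp add: action_rotating_ucb)
  qed
  have "hits (targets S i j) (Suc n * M) = hits (targets S i j) (n * M) + card {s \<in> {..<M}. targets S i j (n * M + s + 1)}"
    using hits_round[of "targets S i j" n] by (simp add: add.commute)
  also have "{s \<in> {..<M}. targets S i j (n * M + s + 1)} = {s \<in> {..<M}. plan S i n ! ((s + i) mod M) = j}"
    using act by auto
  also have "card \<dots> = of_bool (j \<in> set (plan S i n))"
    unfolding plan_def by (intro card_rotated_slots schedule_facts[OF M_le_N])
  finally show ?thesis .
qed

lemma hits_plan_le: "hits (targets S i j) (n * M) \<le> n"
proof (induction n)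
  case (Suc n)
  then show ?case unfolding hits_plan_Suc by (cases "j \<in> set (plan S i n)") auto
qed simp

text \<open>Each round that has \<open>j\<close> on the schedule increases the number of samples of \<open>j\<close>, so a given number of
  samples is met in at most one such round.\<close>
lemma sum_over_planned_rounds:
  "(\<Sum>n<T. of_bool (j \<in> set (plan S i n) \<and> Q (hits (targets S i j) (n * M)))) \<le> (\<Sum>k<T. of_bool (Q k) :: real)"
proof -
  let ?c = "\<lambda>n. hits (targets S i j) (n * M)"
  let ?A = "{n \<in> {..<T}. j \<in> set (plan S i n) \<and> Q (?c n)}"
  have strict: "?c n < ?c n'" if "j \<in> set (plan S i n)" "n < n'" for n n'
  proof -
    have "?c n < ?c (Suc n)" unfolding hits_plan_Suc using that by simp
    also have "\<dots> \<le> ?c n'" using that by (intro hits_mono mult_right_mono) auto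
    finally show ?thesis .
  qed
  have "inj_on ?c ?A"
  proof (rule inj_onI)
    fix n n' assume "n \<in> ?A" "n' \<in> ?A" "?c n = ?c n'"
    then show "n = n'" using strict[of n n'] strict[of n' n] by (cases n n' rule: linorder_cases) auto
  qed
  moreover have "?c ` ?A \<subseteq> {k \<in> {..<T}. Q k}"
  proof (clarsimp)
    fix n assume "n < T"
    then show "?c n < T" using hits_plan_le[of S i j n] by simp
  qed
  ultimately have "card ?A \<le> card {k \<in> {..<T}. Q k}" by (intro card_inj_on_le) auto
  then show ?thesis by (simp add: of_bool_def sum.If_cases Int_def)
qed

section \<open>Rounds with a wrong schedule\<close>
definition target :: "(nat \<Rightarrow> 'p) \<Rightarrow> nat list" where
  "target \<Theta> = map (best_arm \<nu> f N \<Theta>) [1..<Suc M]"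

lemma set_target: "set (target \<Theta>) = best \<Theta>"
  by (auto simp: target_def simp del: upt_Suc)

lemma target_facts: "length (target \<Theta>) = M" "distinct (target \<Theta>)"
  by (simp_all add: target_def distinct_map best_arm_inj del: upt_Suc)

lemma sorted_target:
  assumes "\<Theta> \<in> valid" shows "sorted (map (\<lambda>a. - mean (\<Theta> a)) (target \<Theta>))"
proof -
  have "mean (\<Theta> (best_arm \<nu> f N \<Theta> j)) \<le> mean (\<Theta> (best_arm \<nu> f N \<Theta> i))"
    if "1 \<le> i" "i \<le> j" "j < Suc M" for i j
    using best_arm_ranking[of \<nu> f N \<Theta>] that M_le_N by (auto simp: ranking_def)
  then have "sorted_wrt (\<lambda>i j. mean (\<Theta> (best_arm \<nu> f N \<Theta> j)) \<le> mean (\<Theta> (best_arm \<nu> f N \<Theta> i))) [1..<Suc M]"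
    by (auto simp: sorted_wrt_iff_nth_less simp del: upt_Suc)
  then show ?thesis by (simp add: target_def sorted_wrt_map comp_def del: upt_Suc)
qed

lemma sorted_permutation_unique:
  fixes k :: "'a \<Rightarrow> 'b::linorder"
  assumes "distinct xs" "distinct ys" "set xs = set ys" "inj_on k (set ys)" "sorted (map k xs)" "sorted (map k ys)"
  shows "xs = ys"
proof -
  have "map k xs = map k ys"
    using assms by (intro sorted_distinct_set_unique) (auto simp: distinct_map)
  then show ?thesis using assms(3,4) by (intro map_inj_on[of k xs ys]) auto
qed

definition pulls :: "(nat \<times> nat \<Rightarrow> real) \<Rightarrow> nat \<Rightarrow> nat \<Rightarrow> nat \<Rightarrow> nat" where
  "pulls S i j n = hits (targets S i j) (n * M)"

text \<open>The ways in which arm \<open>j\<close> can be responsible for a wrong schedule in round \<open>n\<close>. The threshold \<open>r\<close>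
  is to lie just below the \<open>M\<close>th largest mean, and \<open>\<epsilon>\<close> is the accuracy that the order of the best arms
  requires. All cases but the first put \<open>j\<close> on the schedule, so that it is sampled in the round.\<close>
definition charged :: "(nat \<Rightarrow> 'p) \<Rightarrow> real \<Rightarrow> real \<Rightarrow> (nat \<times> nat \<Rightarrow> real) \<Rightarrow> nat \<Rightarrow> nat \<Rightarrow> nat \<Rightarrow> bool" where
  "charged \<Theta> r \<epsilon> S i n j \<longleftrightarrow>
     (if j \<in> best \<Theta>
      then ucb_index M g (trajectory S i) n j < ereal r \<or>
        j \<in> set (plan S i n) \<and>
          (pulls S i j n = 0 \<or> \<epsilon> < \<bar>point_estimate M h (trajectory S i) n j - mean (\<Theta> j)\<bar>)
      else j \<in> set (plan S i n) \<and> ereal r \<le> ucb_index M g (trajectory S i) n j)"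

text \<open>If a scheduled arm is not among the best then it has displaced a best arm, and its index is at least as
  large. If the schedule consists of the best arms then estimates within \<open>\<epsilon>\<close> of means that are more
  than \<open>2 \<epsilon>\<close> apart produce the right order.\<close>
lemma wrong_plan_charged:
  assumes \<Theta>: "\<Theta> \<in> valid" 
    and sep: "\<And>a b. a \<in> best \<Theta> \<Longrightarrow> b \<in> best \<Theta> \<Longrightarrow> mean (\<Theta> b) < mean (\<Theta> a) \<Longrightarrow> 2 * \<epsilon> < mean (\<Theta> a) - mean (\<Theta> b)"
    and wrong: "plan S i n \<noteq> target \<Theta>"
  shows "\<exists>j\<in>{1..N}. charged \<Theta> r \<epsilon> S i n j"
proof (rule ccontr)
  let ?idx = "ucb_index M g (trajectory S i) n" and ?est = "point_estimate M h (trajectory S i) n"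
  let ?m = "\<lambda>a. mean (\<Theta> a)"
  note top = best_arms_top_set[OF \<Theta> M_le_N]
  note sched = schedule_facts[OF M_le_N, of h g "trajectory S i" n, folded plan_def]
  assume none: "\<not> (\<exists>j\<in>{1..N}. charged \<Theta> r \<epsilon> S i n j)"
  have BN: "best \<Theta> \<subseteq> {1..N}" using top(1) by (simp add: top_set_def)
  have good: "ereal r \<le> ?idx j" if "j \<in> best \<Theta>" for j
    using none that BN by (force simp: charged_def)
  have est: "\<bar>?est j - ?m j\<bar> \<le> \<epsilon>" if "j \<in> best \<Theta>" "j \<in> set (plan S i n)" for j
    using none that BN by (force simp: charged_def)
  have "set (plan S i n) \<subseteq> best \<Theta>"
  proof
    fix a assume a: "a \<in> set (plan S i n)"
    show "a \<in> best \<Theta>"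
    proof (rule ccontr)
      assume nb: "a \<notin> best \<Theta>"
      have "\<not> best \<Theta> \<subseteq> set (plan S i n)"
      proof
        assume "best \<Theta> \<subseteq> set (plan S i n)"
        then have "best \<Theta> = set (plan S i n)" using sched(4) top(2) by (intro card_subset_eq) auto
        then show False using a nb by simp
      qed
      then obtain b where b: "b \<in> best \<Theta>" "b \<notin> set (plan S i n)" by blast
      then have "?idx b \<le> ?idx a" using a BN unfolding plan_def by (intro schedule_top) auto
      then have "ereal r \<le> ?idx a" using good[OF b(1)] by (rule order_trans[rotated])
      then show False using none a nb sched(3) by (force simp: charged_def)
    qed
  qed
  then have set: "set (plan S i n) = best \<Theta>" using sched(4) top(2) by (intro card_subset_eq) auto
  have inj: "inj_on (\<lambda>a. - ?m a) (best \<Theta>)" using top(1) by (auto simp: top_set_def inj_on_def)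
  have "sorted_wrt (\<lambda>a b. - ?est a \<le> - ?est b) (plan S i n)"
    using schedule_sorted[of M h "trajectory S i" n N g, folded plan_def] by (simp add: sorted_wrt_map)
  then have "sorted_wrt (\<lambda>a b. - ?m a \<le> - ?m b) (plan S i n)"
  proof (rule sorted_wrt_mono_rel[rotated])
    fix a b assume ab: "a \<in> set (plan S i n)" "b \<in> set (plan S i n)" "- ?est a \<le> - ?est b"
    then show "- ?m a \<le> - ?m b"
      using sep[of b a] est[of a] est[of b] set by (force simp: abs_le_iff not_le)
  qed
  then have "sorted (map (\<lambda>a. - ?m a) (plan S i n))" by (simp add: sorted_wrt_map)
  then have "plan S i n = target \<Theta>"
    using sched(2) target_facts(2) set inj sorted_target[OF \<Theta>]
    by (intro sorted_permutation_unique[of _ _ "\<lambda>a. - ?m a"]) (simp_all add: set_target)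
  then show False using wrong by blast
qed

text \<open>An upper bound for the number of rounds before \<open>T\<close> charged to arm \<open>j\<close> when \<open>z\<close> is the sequence of its
  samples. In either case the summand \<open>1\<close> accounts for the round in which the arm is scheduled without
  any sample.\<close>
definition penalty :: "(nat \<Rightarrow> 'p) \<Rightarrow> real \<Rightarrow> real \<Rightarrow> nat \<Rightarrow> nat \<Rightarrow> (nat \<Rightarrow> real) \<Rightarrow> real" where
  "penalty \<Theta> r \<epsilon> T j z =
     (if j \<in> best \<Theta>
      then (\<Sum>n<T. of_bool (\<exists>k\<in>{1..<Suc n}. g (Suc n) k (restrict z {1..k}) < r)) +
        (1 + (\<Sum>k\<in>{1..<T}. of_bool (\<epsilon> < \<bar>h k (restrict z {1..k}) - mean (\<Theta> j)\<bar>)))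
      else 1 + (\<Sum>k\<in>{1..<T}. of_bool (r \<le> g T k (restrict z {1..k}))))"

lemma sum_of_bool_le_from_1:
  "(\<Sum>k<T. of_bool (k = 0 \<or> Q k)) \<le> 1 + (\<Sum>k\<in>{1..<T}. of_bool (Q k) :: real)" for T :: nat
proof -
  have "(\<Sum>k<T. of_bool (k = 0 \<or> Q k)) \<le> (\<Sum>k\<in>insert 0 {1..<T}. of_bool (k = 0 \<or> Q k) :: real)"
    by (intro sum_mono2) auto
  also have "\<dots> = 1 + (\<Sum>k\<in>{1..<T}. of_bool (Q k))" by simp
  finally show ?thesis .
qed

text \<open>Holds for every continuation \<open>Y\<close>, since only entries that have been observed are compared.
  Monotonicity of \<open>g\<close> in time allows all rounds to be compared with the bound at time \<open>T\<close>, which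
  depends on the round through the number of samples only.\<close>
lemma charges_le_penalty:
  "(\<Sum>n<T. of_bool (charged \<Theta> r \<epsilon> S i n j)) \<le>
     penalty \<Theta> r \<epsilon> T j (completed (targets S i j) (\<lambda>t. S (j, t)) (T * M) Y)"
proof -
  let ?p = "targets S i j"
  define z where "z = completed ?p (\<lambda>t. S (j, t)) (T * M) Y"
  have obs: "restrict (sample ?p (\<lambda>r. fst (snd (trajectory S i r))) (n * M)) {1..pulls S i j n}
      = restrict z {1..pulls S i j n}" if n: "n < T" for n
  proof (intro restrict_ext)
    fix u assume u: "u \<in> {1..pulls S i j n}"
    have nT: "n * M \<le> T * M" using n by simp
    then have "u \<le> hits ?p (T * M)" using u hits_mono[OF nT, of ?p] by (simp add: pulls_def)
    then have "z u = sample ?p (\<lambda>t. S (j, t)) (T * M) u" using u by (simp add: z_def completed_def)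
    also have "\<dots> = sample ?p (\<lambda>t. S (j, t)) (n * M) u"
      using u by (intro sample_stable[OF nT]) (simp add: pulls_def)
    also have "\<dots> = sample ?p (\<lambda>r. fst (snd (trajectory S i r))) (n * M) u"
      by (intro sample_cong) (auto simp: trajectory_def Let_def)
    finally show "sample ?p (\<lambda>r. fst (snd (trajectory S i r))) (n * M) u = z u" by simp
  qed
  have p: "(\<lambda>r. fst (trajectory S i r) = j) = ?p" by (simp add: trajectory_def Let_def)
  have idx: "ucb_index M g (trajectory S i) n j
      = (if pulls S i j n = 0 then \<infinity> else ereal (g (Suc n) (pulls S i j n) (restrict z {1..pulls S i j n})))" if "n < T" for n
    using obs[OF that] unfolding ucb_index_def Let_def p by (simp only: pulls_def)
  have est: "point_estimate M h (trajectory S i) n j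
      = (if pulls S i j n = 0 then 0 else h (pulls S i j n) (restrict z {1..pulls S i j n}))" if "n < T" for n
    using obs[OF that] unfolding point_estimate_def Let_def p by (simp only: pulls_def)
  have planned: "(\<Sum>n<T. of_bool (j \<in> set (plan S i n) \<and> (pulls S i j n = 0 \<or> Q (pulls S i j n))))
      \<le> 1 + (\<Sum>k\<in>{1..<T}. of_bool (Q k) :: real)" for Q
    using order_trans[OF sum_over_planned_rounds[where Q = "\<lambda>k. k = 0 \<or> Q k"] sum_of_bool_le_from_1]
    unfolding pulls_def .
  show ?thesis
  proof (cases "j \<in> best \<Theta>")
    case True
    let ?A = "\<lambda>n. \<exists>k\<in>{1..<Suc n}. g (Suc n) k (restrict z {1..k}) < r"
    let ?Q = "\<lambda>k. \<epsilon> < \<bar>h k (restrict z {1..k}) - mean (\<Theta> j)\<bar>"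
    let ?B = "\<lambda>n. j \<in> set (plan S i n) \<and> (pulls S i j n = 0 \<or> ?Q (pulls S i j n))"
    have "(\<Sum>n<T. of_bool (charged \<Theta> r \<epsilon> S i n j)) \<le> (\<Sum>n<T. of_bool (?A n) + of_bool (?B n) :: real)"
    proof (rule sum_mono)
      fix n assume "n \<in> {..<T}"
      then have n: "n < T" by simp
      have "?A n \<or> ?B n" if c: "charged \<Theta> r \<epsilon> S i n j"
      proof (cases "ucb_index M g (trajectory S i) n j < ereal r")
        case True
        then have "pulls S i j n \<noteq> 0" "g (Suc n) (pulls S i j n) (restrict z {1..pulls S i j n}) < r"
          unfolding idx[OF n] by (auto split: if_splits)
        moreover have "pulls S i j n \<le> n" unfolding pulls_def by (rule hits_plan_le)
        ultimately have "?A n" by (intro bexI[of _ "pulls S i j n"]) auto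
        then show ?thesis by blast
      next
        case False
        then show ?thesis using c \<open>j \<in> best \<Theta>\<close> unfolding charged_def est[OF n] by (auto split: if_splits)
      qed
      then show "of_bool (charged \<Theta> r \<epsilon> S i n j) \<le> (of_bool (?A n) + of_bool (?B n) :: real)" by auto
    qed
    also have "\<dots> \<le> (\<Sum>n<T. of_bool (?A n)) + (1 + (\<Sum>k\<in>{1..<T}. of_bool (?Q k)))"
      unfolding sum.distrib by (intro add_left_mono planned)
    finally show ?thesis using True unfolding penalty_def z_def by (simp only: if_True)
  next
    case False
    let ?Q = "\<lambda>k. r \<le> g T k (restrict z {1..k})"
    have "(\<Sum>n<T. of_bool (charged \<Theta> r \<epsilon> S i n j))
        \<le> (\<Sum>n<T. of_bool (j \<in> set (plan S i n) \<and> (pulls S i j n = 0 \<or> ?Q (pulls S i j n))) :: real)"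
    proof (rule sum_mono)
      fix n assume "n \<in> {..<T}"
      then have n: "n < T" by simp
      have "j \<in> set (plan S i n) \<and> (pulls S i j n = 0 \<or> ?Q (pulls S i j n))" if c: "charged \<Theta> r \<epsilon> S i n j"
      proof -
        have "j \<in> set (plan S i n)" "ereal r \<le> ucb_index M g (trajectory S i) n j"
          using c False by (simp_all add: charged_def)
        then show ?thesis
          unfolding idx[OF n] using g_mono[of "pulls S i j n" "Suc n" T z] n
          by (auto split: if_splits)
      qed
      then show "of_bool (charged \<Theta> r \<epsilon> S i n j)
          \<le> (of_bool (j \<in> set (plan S i n) \<and> (pulls S i j n = 0 \<or> ?Q (pulls S i j n))) :: real)" by auto
    qed
    also have "\<dots> \<le> 1 + (\<Sum>k\<in>{1..<T}. of_bool (?Q k))" by (rule planned)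
    finally show ?thesis using False unfolding penalty_def z_def by (simp only: if_False)
  qed
qed

lemma gap_le_wrong_plans:
  obtains D where "0 < D" "\<And>S t. 1 \<le> t \<Longrightarrow>
    gap \<Theta> (action M (rotating_ucb N M h g) S t) \<le> D * (\<Sum>i\<in>{1..M}. of_bool (plan S i ((t - 1) div M) \<noteq> target \<Theta>))"
proof -
  let ?m = "\<lambda>a. mean (\<Theta> a)"
  define D where "D = 2 * (\<Sum>j\<in>{1..N}. \<bar>?m j\<bar>) + 1"
  have BN: "best \<Theta> \<subseteq> {1..N}"
    using permutes_image[of "best_arm \<nu> f N \<Theta>" "{1..N}"] best_arm_ranking[of \<nu> f N \<Theta>] M_le_N
    unfolding ranking_def by (metis atLeastAtMost_iff image_mono subsetI le_trans)
  have bound: "\<bar>sum ?m A\<bar> \<le> (\<Sum>j\<in>{1..N}. \<bar>?m j\<bar>)" if "A \<subseteq> {1..N}" for A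
    using that by (intro order_trans[OF sum_abs sum_mono2]) auto
  have "gap \<Theta> a \<le> D" for a
    using bound[OF BN] bound[OF accrued_subset(1)[of c N M a]] by (simp add: gap_def D_def abs_le_iff)
  have D0: "0 < D" unfolding D_def by (intro add_nonneg_pos mult_nonneg_nonneg sum_nonneg) auto
  have "gap \<Theta> (action M (rotating_ucb N M h g) S t) \<le> D * (\<Sum>i\<in>{1..M}. of_bool (plan S i ((t - 1) div M) \<noteq> target \<Theta>))"
    if t: "1 \<le> t" for S t
  proof (cases "\<forall>i\<in>{1..M}. plan S i ((t - 1) div M) = target \<Theta>")
    case True
    let ?a = "action M (rotating_ucb N M h g) S t"
    have a: "?a (Suc s) = target \<Theta> ! ((s + t) mod M)" if "s < M" for s
      using True that t by (simp add: action_rotating_ucb add.commute)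
    have Suc: "{1..M} = Suc ` {..<M}" by (auto simp: image_iff) (metis Suc_le_D Suc_le_eq lessThan_iff)
    note inj = bij_betw_imp_inj_on[OF rotation_bij[of t]] and surj = bij_betw_imp_surj_on[OF rotation_bij[of t]]
    have "?a ` {1..M} = (\<lambda>s. target \<Theta> ! ((s + t) mod M)) ` {..<M}"
      unfolding Suc image_image using a by (intro image_cong) auto
    also have "\<dots> = (\<lambda>u. target \<Theta> ! u) ` ((\<lambda>s. (s + t) mod M) ` {..<M})" by (simp add: image_image)
    also have "\<dots> = set (target \<Theta>)"
      unfolding surj using target_facts(1) by (auto simp: set_conv_nth)
    finally have im: "?a ` {1..M} = best \<Theta>" by (simp add: set_target)
    have "inj_on ?a {1..M}"
      by (intro eq_card_imp_inj_on) (simp_all only: im card_image best_arm_inj finite_atLeastAtMost)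
    then have "accrued c N M ?a = best \<Theta>" using accrued_inj im BN by blast
    then have "gap \<Theta> ?a = 0" by (simp add: gap_def)
    then show ?thesis using D0 by (simp add: sum_nonneg)
  next
    case False
    then obtain i where i: "i \<in> {1..M}" "plan S i ((t - 1) div M) \<noteq> target \<Theta>" by blast
    have "1 \<le> (\<Sum>i\<in>{1..M}. of_bool (plan S i ((t - 1) div M) \<noteq> target \<Theta>) :: real)"
      using member_le_sum[of i "{1..M}" "\<lambda>i. of_bool (plan S i ((t - 1) div M) \<noteq> target \<Theta>) :: real"] i by simp
    then have "D * 1 \<le> D * (\<Sum>i\<in>{1..M}. of_bool (plan S i ((t - 1) div M) \<noteq> target \<Theta>))"
      using D0 by (intro mult_left_mono) auto
    then show ?thesis using \<open>gap \<Theta> (action M (rotating_ucb N M h g) S t) \<le> D\<close> by simp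
  qed
  with D0 show thesis by (rule that)
qed

lemma sum_times_le_rounds:
  "(\<Sum>t\<in>{1..T}. of_bool (Q ((t - 1) div M))) \<le> real M * (\<Sum>n<T. of_bool (Q n))"
proof -
  have "(\<Sum>t\<in>{1..T}. of_bool (Q ((t - 1) div M)) :: real) = (\<Sum>u<T. of_bool (Q (u div M)))"
    by (rule sum.reindex_bij_witness[of _ Suc "\<lambda>t. t - 1"]) auto
  also have "\<dots> = (\<Sum>n<T. \<Sum>u\<in>{u\<in>{..<T}. u div M = n}. of_bool (Q (u div M)))"
    by (rule sum.group[symmetric]) (auto intro: le_less_trans[OF div_le_dividend])
  also have "\<dots> \<le> (\<Sum>n<T. real M * of_bool (Q n))"
  proof (rule sum_mono)
    fix n
    have "{u\<in>{..<T}. u div M = n} \<subseteq> {n * M..<n * M + M}"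
    proof
      fix u assume u: "u \<in> {u\<in>{..<T}. u div M = n}"
      have "u = u div M * M + u mod M" by simp
      moreover have "u mod M < M" using M_pos by simp
      ultimately show "u \<in> {n * M..<n * M + M}" using u by (metis (mono_tags, lifting) atLeastLessThan_iff le_add1 mem_Collect_eq nat_add_left_cancel_less)
    qed
    then have "card {u\<in>{..<T}. u div M = n} \<le> M" using card_mono[of "{n * M..<n * M + M}"] by fastforce
    then show "(\<Sum>u\<in>{u\<in>{..<T}. u div M = n}. of_bool (Q (u div M))) \<le> real M * of_bool (Q n)" by simp
  qed
  finally show ?thesis unfolding sum_distrib_left .
qed

end

section \<open>The expected number of wrong rounds\<close>
lemma sum_inverse_le_ln: "1 \<le> T \<Longrightarrow> (\<Sum>t\<in>{1..T}. 1 / real t) \<le> 1 + ln (real T)"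
proof (induction T rule: dec_induct)
  case (step n)
  have n: "0 < real n" using step.hyps by simp
  have "ln (real n / (real n + 1)) \<le> real n / (real n + 1) - 1" using n by (intro ln_le_minus_one) simp
  also have "\<dots> = - (1 / (real n + 1))" using n by (simp add: field_simps)
  finally have "1 / (real n + 1) \<le> ln (real n + 1) - ln (real n)" using n by (simp add: ln_div)
  then show ?case using step.IH by (simp add: add.commute)
qed simp

lemma sum_smallo_inverse_le_ln:
  fixes a :: "nat \<Rightarrow> real"
  assumes "a \<in> o(\<lambda>t. 1 / real t)"
  obtains K where "\<forall>\<^sub>F T in sequentially. (\<Sum>t\<in>{1..T}. a t) \<le> K * ln (real T)"
proof -
  from landau_o.smallD[OF assms, of 1] obtain t0 where t0: "\<And>t. t \<ge> t0 \<Longrightarrow> \<bar>a t\<bar> \<le> 1 / real t"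
    unfolding eventually_sequentially by auto
  define A where "A = (\<Sum>t\<in>{1..t0}. \<bar>a t\<bar>)"
  have A0: "0 \<le> A" unfolding A_def by (intro sum_nonneg) auto
  have le: "(\<Sum>t\<in>{1..T}. a t) \<le> A + (1 + ln (real T))" if T: "1 \<le> T" for T
  proof -
    have "(\<Sum>t\<in>{1..T}. a t) \<le> (\<Sum>t\<in>{1..T}. (if t \<le> t0 then \<bar>a t\<bar> else 0) + 1 / real t)"
    proof (rule sum_mono)
      fix t show "a t \<le> (if t \<le> t0 then \<bar>a t\<bar> else 0) + 1 / real t"
        using t0[of t] by (cases "t \<le> t0") (auto intro: order_trans[OF abs_ge_self])
    qed
    also have "\<dots> = (\<Sum>t\<in>{1..T}. (if t \<le> t0 then \<bar>a t\<bar> else 0)) + (\<Sum>t\<in>{1..T}. 1 / real t)"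
      by (rule sum.distrib)
    also have "(\<Sum>t\<in>{1..T}. (if t \<le> t0 then \<bar>a t\<bar> else 0)) = (\<Sum>t\<in>{t\<in>{1..T}. t \<le> t0}. \<bar>a t\<bar>)"
      by (simp only: sum.inter_filter finite_atLeastAtMost)
    also have "\<dots> \<le> A" unfolding A_def by (intro sum_mono2) auto
    finally show ?thesis using sum_inverse_le_ln[OF T] by simp
  qed
  have "\<forall>\<^sub>F T in sequentially. 1 \<le> ln (real T)" by real_asymp
  then have "\<forall>\<^sub>F T in sequentially. (\<Sum>t\<in>{1..T}. a t) \<le> (A + 2) * ln (real T)"
    using eventually_ge_at_top[of 1]
  proof eventually_elim
    case (elim T)
    have "A + 1 \<le> (A + 1) * ln (real T)" using elim(1) A0 mult_left_mono[of 1 "ln (real T)" "A + 1"] by simp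
    then show ?case using le[OF elim(2)] by (simp add: algebra_simps)
  qed
  then show thesis by (rule that)
qed

context ucb_bandit begin

abbreviation obs :: "'p \<Rightarrow> (nat \<Rightarrow> real) measure" where "obs \<equiv> obs_space \<nu> f"

lemma prob_space_obs: "\<theta> \<in> H \<Longrightarrow> prob_space (obs \<theta>)"
  unfolding obs_space_def by (intro prob_space_PiM prob_space_arm_law)

lemma measurable_statistic:
  assumes "K \<in> borel_measurable (PiM {1..k} (\<lambda>_. borel))"
  shows "(\<lambda>z. K (restrict z {1..k})) \<in> borel_measurable (obs \<theta>)"
proof -
  have m: "(\<lambda>z. restrict z {1..k}) \<in> obs \<theta> \<rightarrow>\<^sub>M PiM {1..k} (\<lambda>_. arm_law \<nu> f \<theta>)"
    unfolding obs_space_def by (intro measurable_restrict_subset) auto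
  have s: "sets (PiM {1..k} (\<lambda>_. arm_law \<nu> f \<theta>)) = sets (PiM {1..k} (\<lambda>_. borel))"
    by (intro sets_PiM_cong refl sets_arm_law)
  have "(\<lambda>z. restrict z {1..k}) \<in> obs \<theta> \<rightarrow>\<^sub>M PiM {1..k} (\<lambda>_. borel)"
    using m unfolding measurable_cong_sets[OF refl s] .
  then show ?thesis using assms by (rule measurable_compose)
qed

lemma pred_g_less: "1 \<le> t \<Longrightarrow> Measurable.pred (obs \<theta>) (\<lambda>z. \<exists>k\<in>{1..<t}. g t k (restrict z {1..k}) < r)"
proof (rule pred_intros_finite)
  fix k assume "1 \<le> t" "k \<in> {1..<t}"
  then have "(\<lambda>z. g t k (restrict z {1..k})) \<in> borel_measurable (obs \<theta>)"
    by (intro measurable_statistic g_meas) auto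
  then show "Measurable.pred (obs \<theta>) (\<lambda>z. g t k (restrict z {1..k}) < r)"
    unfolding Measurable.pred_def by (rule borel_measurable_less[OF _ borel_measurable_const])
qed simp

lemma pred_g_ge:
  assumes "1 \<le> t" "1 \<le> k" shows "Measurable.pred (obs \<theta>) (\<lambda>z. r \<le> g t k (restrict z {1..k}))"
  unfolding Measurable.pred_def
  by (rule borel_measurable_le[OF borel_measurable_const measurable_statistic[OF g_meas[OF assms]]])

lemma pred_h_error:
  assumes "1 \<le> k" shows "Measurable.pred (obs \<theta>) (\<lambda>z. \<epsilon> < \<bar>h k (restrict z {1..k}) - m\<bar>)"
proof -
  have "(\<lambda>z. h k (restrict z {1..k})) \<in> borel_measurable (obs \<theta>)"
    by (rule measurable_statistic[OF h_meas[OF assms]])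
  then have "(\<lambda>z. \<bar>h k (restrict z {1..k}) - m\<bar>) \<in> borel_measurable (obs \<theta>)"
    by (intro borel_measurable_abs borel_measurable_diff borel_measurable_const)
  then show ?thesis
    unfolding Measurable.pred_def by (rule borel_measurable_less[OF borel_measurable_const])
qed

text \<open>The maximum in the condition on \<open>h\<close> includes \<open>k = t\<close>.\<close>
lemma h_error_smallo:
  assumes "\<theta> \<in> H" "0 < \<epsilon>"
  shows "(\<lambda>t. measure (obs \<theta>) {z \<in> space (obs \<theta>). \<epsilon> < \<bar>h t (restrict z {1..t}) - mean \<theta>\<bar>}) \<in> o(\<lambda>t. 1 / real t)"
    (is "?a \<in> _")
proof (rule landau_o.big_small_trans)
  let ?K = "\<lambda>t. {k. 1 / 2 * real t \<le> real k \<and> k \<le> t}"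
  let ?b = "\<lambda>t. measure (obs \<theta>) {z \<in> space (obs \<theta>). \<epsilon> < (MAX k\<in>?K t. \<bar>h k (restrict z {1..k}) - mean \<theta>\<bar>)}"
  interpret prob_space "obs \<theta>" by (rule prob_space_obs[OF assms(1)])
  show "?b \<in> o(\<lambda>t. 1 / real t)" using h_concentrates[OF assms, of "1 / 2"] by simp
  have "?a t \<le> ?b t" if t: "1 \<le> t" for t
  proof (rule finite_measure_mono)
    have K: "finite (?K t)" "t \<in> ?K t" by (auto intro: finite_subset[of _ "{..t}"])
    have gr: "\<epsilon> < (MAX k\<in>?K t. \<bar>h k (restrict z {1..k}) - mean \<theta>\<bar>) \<longleftrightarrow> (\<exists>k\<in>?K t. \<epsilon> < \<bar>h k (restrict z {1..k}) - mean \<theta>\<bar>)" for z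
      by (subst Max_gr_iff[OF finite_imageI[OF K(1)]]) (use K(2) in blast)+
    show "{z \<in> space (obs \<theta>). \<epsilon> < \<bar>h t (restrict z {1..t}) - mean \<theta>\<bar>}
        \<subseteq> {z \<in> space (obs \<theta>). \<epsilon> < (MAX k\<in>?K t. \<bar>h k (restrict z {1..k}) - mean \<theta>\<bar>)}"
    proof
      fix z assume z: "z \<in> {z \<in> space (obs \<theta>). \<epsilon> < \<bar>h t (restrict z {1..t}) - mean \<theta>\<bar>}"
      show "z \<in> {z \<in> space (obs \<theta>). \<epsilon> < (MAX k\<in>?K t. \<bar>h k (restrict z {1..k}) - mean \<theta>\<bar>)}"
        using z Max_ge[OF finite_imageI[OF K(1)] imageI[OF K(2)], of "\<lambda>k. \<bar>h k (restrict z {1..k}) - mean \<theta>\<bar>"]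
        unfolding mem_Collect_eq by linarith
    qed
    have "Measurable.pred (obs \<theta>) (\<lambda>z. \<exists>k\<in>?K t. \<epsilon> < \<bar>h k (restrict z {1..k}) - mean \<theta>\<bar>)"
      using K(1) t by (intro pred_intros_finite pred_h_error) auto
    then show "{z \<in> space (obs \<theta>). \<epsilon> < (MAX k\<in>?K t. \<bar>h k (restrict z {1..k}) - mean \<theta>\<bar>)} \<in> sets (obs \<theta>)"
      unfolding gr Measurable.pred_def .
  qed
  then show "?a \<in> O(?b)"
    by (intro landau_o.bigI[of 1] eventually_mono[OF eventually_ge_at_top[of 1]]) auto
qed

text \<open>The limit over \<open>\<epsilon>\<close> is bounded by the reciprocal of a positive divergence, hence is less than \<open>\<infinity>\<close>, and so is
  the limit superior for all small \<open>\<epsilon>\<close>. The order of the quantifiers lets one \<open>\<epsilon>\<close> serve finitely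
  many arms.\<close>
lemma g_rarely_exceeds_threshold:
  assumes "\<theta> \<in> H" "\<theta>' \<in> H" "mean \<theta> < mean \<theta>'"
  shows "\<forall>\<^sub>F \<epsilon> in at_right 0. \<exists>K. \<forall>\<^sub>F T in sequentially.
    (\<Sum>k\<in>{1..<T}. measure (obs \<theta>) {z \<in> space (obs \<theta>). mean \<theta>' - \<epsilon> \<le> g T k (restrict z {1..k})}) \<le> K * ln (real T)"
proof -
  let ?s = "\<lambda>\<epsilon> T. \<Sum>k\<in>{1..<T}. measure (obs \<theta>) {z \<in> space (obs \<theta>). mean \<theta>' - \<epsilon> \<le> g T k (restrict z {1..k})}"
  obtain l where lim: "((\<lambda>\<epsilon>. limsup (\<lambda>T. ereal (?s \<epsilon> T / ln (real T)))) \<longlongrightarrow> l) (at_right 0)"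
    and l: "l \<le> 1 / kl_dist \<nu> f \<theta> \<theta>'"
    using g_rarely_large[OF assms] by blast
  have "0 < kl_dist \<nu> f \<theta> \<theta>'" "kl_dist \<nu> f \<theta> \<theta>' < \<infinity>" using C2[OF assms] by blast+
  then have "1 / kl_dist \<nu> f \<theta> \<theta>' < \<infinity>" by (cases "kl_dist \<nu> f \<theta> \<theta>'") (auto simp: one_ereal_def)
  with l have "l < \<infinity>" by (rule le_less_trans)
  then obtain B where B: "l < ereal B" using less_PInf_Ex_of_nat[of l] by auto
  from order_tendstoD(2)[OF lim B] show ?thesis
  proof eventually_elim
    case (elim \<epsilon>)
    have "\<forall>\<^sub>F T in sequentially. ereal (?s \<epsilon> T / ln (real T)) < ereal B" using Limsup_lessD[OF elim] .
    moreover have "\<forall>\<^sub>F T in sequentially. 0 < ln (real T)" by real_asymp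
    ultimately have "\<forall>\<^sub>F T in sequentially. ?s \<epsilon> T \<le> B * ln (real T)"
      by eventually_elim (simp add: field_simps)
    then show ?case by blast
  qed
qed

definition expected_penalty :: "(nat \<Rightarrow> 'p) \<Rightarrow> real \<Rightarrow> real \<Rightarrow> nat \<Rightarrow> nat \<Rightarrow> real" where
  "expected_penalty \<Theta> r \<epsilon> T j = (\<integral>z. penalty \<Theta> r \<epsilon> T j z \<partial>obs (\<Theta> j))"

lemma integrable_penalty:
  assumes "\<Theta> j \<in> H" shows "integrable (obs (\<Theta> j)) (penalty \<Theta> r \<epsilon> T j)"
proof -
  interpret prob_space "obs (\<Theta> j)" by (rule prob_space_obs[OF assms])
  have "integrable (obs (\<Theta> j)) (\<lambda>z. \<Sum>k\<in>{1..<T}. of_bool (r \<le> g T k (restrict z {1..k})) :: real)"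
    by (intro expectation_sum_of_bool(1) pred_g_ge) auto
  moreover have "integrable (obs (\<Theta> j)) (\<lambda>z. \<Sum>k\<in>{1..<T}. of_bool (\<epsilon> < \<bar>h k (restrict z {1..k}) - mean (\<Theta> j)\<bar>) :: real)"
    by (intro expectation_sum_of_bool(1) pred_h_error) auto
  moreover have "integrable (obs (\<Theta> j)) (\<lambda>z. \<Sum>n<T. of_bool (\<exists>k\<in>{1..<Suc n}. g (Suc n) k (restrict z {1..k}) < r) :: real)"
    by (intro expectation_sum_of_bool(1) pred_g_less) auto
  ultimately show ?thesis
    unfolding penalty_def[abs_def]
    by (cases "j \<in> best \<Theta>")
      (simp_all only: if_True if_False simp_thms Bochner_Integration.integrable_add integrable_const)
qed

lemma expected_penalty_best:
  assumes \<theta>: "\<Theta> j \<in> H" and j: "j \<in> best \<Theta>" and r: "r < mean (\<Theta> j)" and \<epsilon>: "0 < \<epsilon>"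
  shows "\<exists>K. \<forall>\<^sub>F T in sequentially. expected_penalty \<Theta> r \<epsilon> T j \<le> K * ln (real T)"
proof -
  let ?M = "obs (\<Theta> j)"
  interpret prob_space ?M by (rule prob_space_obs[OF \<theta>])
  let ?a = "\<lambda>t. 1 - prob {z \<in> space ?M. \<forall>k\<in>{1..<t}. r \<le> g t k (restrict z {1..k})}"
  let ?b = "\<lambda>t. prob {z \<in> space ?M. \<epsilon> < \<bar>h t (restrict z {1..t}) - mean (\<Theta> j)\<bar>}"
  obtain K1 where K1: "\<forall>\<^sub>F T in sequentially. (\<Sum>t\<in>{1..T}. ?a t) \<le> K1 * ln (real T)"
    using sum_smallo_inverse_le_ln[OF g_optimistic[OF \<theta> r]] .
  obtain K2 where K2: "\<forall>\<^sub>F T in sequentially. (\<Sum>t\<in>{1..T}. ?b t) \<le> K2 * ln (real T)"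
    using sum_smallo_inverse_le_ln[OF h_error_smallo[OF \<theta> \<epsilon>]] .
  have eq: "expected_penalty \<Theta> r \<epsilon> T j = (\<Sum>t\<in>{1..T}. ?a t) + (1 + (\<Sum>t\<in>{1..<T}. ?b t))" for T
  proof -
    let ?A = "\<lambda>n z. \<exists>k\<in>{1..<Suc n}. g (Suc n) k (restrict z {1..k}) < r"
    let ?B = "\<lambda>k z. \<epsilon> < \<bar>h k (restrict z {1..k}) - mean (\<Theta> j)\<bar>"
    have A: "Measurable.pred ?M (?A n)" for n by (rule pred_g_less) simp
    have B: "Measurable.pred ?M (?B k)" if "k \<in> {1..<T}" for k using that by (intro pred_h_error) simp
    have compl: "prob {z \<in> space ?M. ?A n z} = ?a (Suc n)" for n
    proof -
      have "?a (Suc n) = prob (space ?M - {z \<in> space ?M. \<forall>k\<in>{1..<Suc n}. r \<le> g (Suc n) k (restrict z {1..k})})"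
      proof (rule prob_compl[symmetric])
        have "Measurable.pred ?M (\<lambda>z. \<forall>k\<in>{1..<Suc n}. r \<le> g (Suc n) k (restrict z {1..k}))"
          by (intro pred_intros_finite pred_g_ge) auto
        then show "{z \<in> space ?M. \<forall>k\<in>{1..<Suc n}. r \<le> g (Suc n) k (restrict z {1..k})} \<in> events"
          by (simp only: Measurable.pred_def)
      qed
      also have "space ?M - {z \<in> space ?M. \<forall>k\<in>{1..<Suc n}. r \<le> g (Suc n) k (restrict z {1..k})} = {z \<in> space ?M. ?A n z}"
        by (auto simp: not_le)
      finally show ?thesis by (rule sym)
    qed
    have "expected_penalty \<Theta> r \<epsilon> T j
        = expectation (\<lambda>z. (\<Sum>n<T. of_bool (?A n z))) + expectation (\<lambda>z. 1 + (\<Sum>k\<in>{1..<T}. of_bool (?B k z)))"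
      unfolding expected_penalty_def penalty_def if_P[OF j]
      by (intro Bochner_Integration.integral_add Bochner_Integration.integrable_add integrable_const
          expectation_sum_of_bool(1) A B)
    also have "expectation (\<lambda>z. (\<Sum>n<T. of_bool (?A n z)) :: real) = (\<Sum>n<T. prob {z \<in> space ?M. ?A n z})"
      by (rule expectation_sum_of_bool(2)[OF A])
    also have "\<dots> = (\<Sum>t\<in>{1..T}. ?a t)"
      unfolding compl by (rule sum.reindex_bij_witness[of _ "\<lambda>t. t - 1" Suc]) auto
    also have "expectation (\<lambda>z. 1 + (\<Sum>k\<in>{1..<T}. of_bool (?B k z)) :: real) = 1 + expectation (\<lambda>z. \<Sum>k\<in>{1..<T}. of_bool (?B k z))"
      by (intro expectation_1_plus expectation_sum_of_bool(1) B)
    also have "expectation (\<lambda>z. (\<Sum>k\<in>{1..<T}. of_bool (?B k z)) :: real) = (\<Sum>t\<in>{1..<T}. ?b t)"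
      by (intro expectation_sum_of_bool(2) B)
    finally show ?thesis .
  qed
  have "\<forall>\<^sub>F T in sequentially. 1 \<le> ln (real T)" by real_asymp
  with K1 K2 have "\<forall>\<^sub>F T in sequentially. expected_penalty \<Theta> r \<epsilon> T j \<le> (K1 + 1 + K2) * ln (real T)"
  proof eventually_elim
    case (elim T)
    have "(\<Sum>t\<in>{1..<T}. ?b t) \<le> (\<Sum>t\<in>{1..T}. ?b t)" by (intro sum_mono2) auto
    then show ?case unfolding eq using elim by (simp add: algebra_simps)
  qed
  then show ?thesis by blast
qed

lemma expected_penalty_other:
  assumes \<theta>: "\<Theta> j \<in> H" and j: "j \<notin> best \<Theta>"
    and r: "\<forall>\<^sub>F T in sequentially. (\<Sum>k\<in>{1..<T}. measure (obs (\<Theta> j)) {z \<in> space (obs (\<Theta> j)). r \<le> g T k (restrict z {1..k})}) \<le> K * ln (real T)"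
  shows "\<exists>K. \<forall>\<^sub>F T in sequentially. expected_penalty \<Theta> r \<epsilon> T j \<le> K * ln (real T)"
proof -
  let ?M = "obs (\<Theta> j)"
  interpret prob_space ?M by (rule prob_space_obs[OF \<theta>])
  have eq: "expected_penalty \<Theta> r \<epsilon> T j = 1 + (\<Sum>k\<in>{1..<T}. prob {z \<in> space ?M. r \<le> g T k (restrict z {1..k})})" if T: "1 \<le> T" for T
  proof -
    have B: "Measurable.pred ?M (\<lambda>z. r \<le> g T k (restrict z {1..k}))" if "k \<in> {1..<T}" for k
      using that T by (intro pred_g_ge) auto
    have "expected_penalty \<Theta> r \<epsilon> T j = 1 + expectation (\<lambda>z. \<Sum>k\<in>{1..<T}. of_bool (r \<le> g T k (restrict z {1..k})))"
      unfolding expected_penalty_def penalty_def if_not_P[OF j]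
      by (intro expectation_1_plus expectation_sum_of_bool(1) B)
    also have "expectation (\<lambda>z. (\<Sum>k\<in>{1..<T}. of_bool (r \<le> g T k (restrict z {1..k}))) :: real)
        = (\<Sum>k\<in>{1..<T}. prob {z \<in> space ?M. r \<le> g T k (restrict z {1..k})})"
      by (intro expectation_sum_of_bool(2) B)
    finally show ?thesis .
  qed
  have "\<forall>\<^sub>F T in sequentially. 1 \<le> ln (real T)" by real_asymp
  with r eventually_ge_at_top[of 1]
  have "\<forall>\<^sub>F T in sequentially. expected_penalty \<Theta> r \<epsilon> T j \<le> (1 + K) * ln (real T)"
  proof eventually_elim
    case (elim T)
    show ?case unfolding eq[OF elim(2)] using elim by (simp add: algebra_simps)
  qed
  then show ?thesis by blast
qed

section \<open>Logarithmic regret of the rotating policy\<close>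
definition completed_samples :: "(nat \<times> nat \<Rightarrow> real) \<Rightarrow> nat \<Rightarrow> nat \<Rightarrow> nat \<Rightarrow> (nat \<Rightarrow> real) \<Rightarrow> nat \<Rightarrow> real" where
  "completed_samples S i j T Y = completed (targets S i j) (\<lambda>t. S (j, t)) (T * M) Y"

lemma pred_targets:
  assumes "i \<in> {1..M}" "1 \<le> t" shows "Measurable.pred (states \<Theta>) (\<lambda>S. targets S i j t)"
  using measurable_action_states[OF decentralized_rotating_ucb assms] by measurable

lemma penalty_nonneg: "0 \<le> penalty \<Theta> r \<epsilon> T j z"
  by (auto simp: penalty_def intro!: add_nonneg_nonneg sum_nonneg)

text \<open>By optional skipping the law of a penalty does not depend on how the player chooses its sampling
  times.\<close>
lemma expected_completed_penalty:
  assumes \<Theta>: "\<Theta> \<in> {1..N} \<rightarrow> H" and i: "i \<in> {1..M}" and j: "j \<in> {1..N}"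
  shows "(\<lambda>S. \<integral>\<^sup>+Y. ennreal (penalty \<Theta> r \<epsilon> T j (completed_samples S i j T Y)) \<partial>obs (\<Theta> j)) \<in> borel_measurable (states \<Theta>)"
    and "(\<integral>\<^sup>+S. (\<integral>\<^sup>+Y. ennreal (penalty \<Theta> r \<epsilon> T j (completed_samples S i j T Y)) \<partial>obs (\<Theta> j)) \<partial>states \<Theta>)
      = ennreal (expected_penalty \<Theta> r \<epsilon> T j)"
proof -
  let ?\<phi> = "\<lambda>z. ennreal (penalty \<Theta> r \<epsilon> T j z)"
  have \<theta>: "\<Theta> j \<in> H" using \<Theta> j by blast
  have int: "integrable (obs (\<Theta> j)) (penalty \<Theta> r \<epsilon> T j)" by (rule integrable_penalty[where \<Theta> = \<Theta> and j = j, OF \<theta>])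
  then have \<phi>: "?\<phi> \<in> borel_measurable (PiM {1..} (\<lambda>_. arm_law \<nu> f (\<Theta> j)))"
    unfolding obs_space_def[symmetric] by (intro measurable_compose[OF _ measurable_ennreal]) (rule borel_measurable_integrable)
  show "(\<lambda>S. \<integral>\<^sup>+Y. ?\<phi> (completed_samples S i j T Y) \<partial>obs (\<Theta> j)) \<in> borel_measurable (states \<Theta>)"
    unfolding completed_samples_def obs_space_def
    by (rule borel_measurable_integral_completed[OF sets_arm_law prob_space_arm_law[OF \<theta>] pred_targets[OF i] measurable_state[OF j] \<phi>])
  have "(\<integral>\<^sup>+S. (\<integral>\<^sup>+Y. ?\<phi> (completed_samples S i j T Y) \<partial>obs (\<Theta> j)) \<partial>states \<Theta>) = (\<integral>\<^sup>+Y. ?\<phi> Y \<partial>obs (\<Theta> j))"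
    unfolding completed_samples_def obs_space_def states_eq
  proof (rule optional_skipping[where e = "\<lambda>t. (j, t)"])
    show "prob_space (arm_law \<nu> f (\<Theta> (fst a)))" if "a \<in> {1..N} \<times> {1..}" for a :: "nat \<times> nat"
      using that \<Theta> by (intro prob_space_arm_law) auto
    show "Measurable.pred (PiM ({1..N} \<times> {1..}) (\<lambda>a. arm_law \<nu> f (\<Theta> (fst a)))) (\<lambda>S. targets S i j t)" if "1 \<le> t" for t
      using pred_targets[OF i that, where \<Theta> = \<Theta> and j = j] unfolding states_eq .
    show "targets (S((j, s) := x)) i j t \<longleftrightarrow> targets S i j t" if "1 \<le> t" "t \<le> s" for S s t x
    proof -
      have "action M (rotating_ucb N M h g) (S((j, s) := x)) t i = action M (rotating_ucb N M h g) S t i"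
        using that by (intro action_cong_past) auto
      then show ?thesis by simp
    qed
  qed (use j \<phi> in \<open>auto simp: sets_arm_law inj_on_def\<close>)
  also have "\<dots> = ennreal (expected_penalty \<Theta> r \<epsilon> T j)"
    unfolding expected_penalty_def by (rule nn_integral_eq_integral[OF int]) (simp add: penalty_nonneg)
  finally show "(\<integral>\<^sup>+S. (\<integral>\<^sup>+Y. ?\<phi> (completed_samples S i j T Y) \<partial>obs (\<Theta> j)) \<partial>states \<Theta>) = ennreal (expected_penalty \<Theta> r \<epsilon> T j)" .
qed

lemma regret_le_expected_penalties:
  assumes \<Theta>: "\<Theta> \<in> valid"
    and sep: "\<And>a b. a \<in> best \<Theta> \<Longrightarrow> b \<in> best \<Theta> \<Longrightarrow> mean (\<Theta> b) < mean (\<Theta> a) \<Longrightarrow> 2 * \<epsilon> < mean (\<Theta> a) - mean (\<Theta> b)"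
  obtains D where "0 < D" "\<And>T. regret \<nu> f N M c (rotating_ucb N M h g) \<Theta> T \<le> D * (\<Sum>j\<in>{1..N}. expected_penalty \<Theta> r \<epsilon> T j)"
proof -
  let ?\<pi> = "rotating_ucb N M h g"
  have \<Theta>H: "\<Theta> \<in> {1..N} \<rightarrow> H" using \<Theta> unfolding param_sets_def by blast
  obtain D where D: "0 < D" "\<And>S t. 1 \<le> t \<Longrightarrow>
      gap \<Theta> (action M ?\<pi> S t) \<le> D * (\<Sum>i\<in>{1..M}. of_bool (plan S i ((t - 1) div M) \<noteq> target \<Theta>))"
    by (rule gap_le_wrong_plans[of \<Theta>]) blast
  have ep0: "0 \<le> expected_penalty \<Theta> r \<epsilon> T j" for T j
    unfolding expected_penalty_def using penalty_nonneg by (intro Bochner_Integration.integral_nonneg)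
  let ?c = "\<lambda>S i j T. \<Sum>n<T. of_bool (charged \<Theta> r \<epsilon> S i n j) :: real"
  have path: "(\<Sum>t\<in>{1..T}. gap \<Theta> (action M ?\<pi> S t)) \<le> D * real M * (\<Sum>i\<in>{1..M}. \<Sum>j\<in>{1..N}. ?c S i j T)" for S T
  proof -
    have "(\<Sum>t\<in>{1..T}. gap \<Theta> (action M ?\<pi> S t))
        \<le> (\<Sum>t\<in>{1..T}. D * (\<Sum>i\<in>{1..M}. of_bool (plan S i ((t - 1) div M) \<noteq> target \<Theta>)))"
      by (intro sum_mono D(2)) simp
    also have "\<dots> = D * (\<Sum>i\<in>{1..M}. \<Sum>t\<in>{1..T}. of_bool (plan S i ((t - 1) div M) \<noteq> target \<Theta>))"
      unfolding sum_distrib_left[symmetric] by (subst sum.swap) (rule refl)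
    also have "\<dots> \<le> D * (\<Sum>i\<in>{1..M}. real M * (\<Sum>n<T. of_bool (plan S i n \<noteq> target \<Theta>)))"
      using D(1) by (intro mult_left_mono sum_mono sum_times_le_rounds) auto
    also have "\<dots> = D * real M * (\<Sum>i\<in>{1..M}. \<Sum>n<T. of_bool (plan S i n \<noteq> target \<Theta>))"
      unfolding sum_distrib_left[symmetric] by (simp only: mult.assoc)
    also have "\<dots> \<le> D * real M * (\<Sum>i\<in>{1..M}. \<Sum>j\<in>{1..N}. ?c S i j T)"
    proof (intro mult_left_mono sum_mono)
      fix i
      have "(\<Sum>n<T. of_bool (plan S i n \<noteq> target \<Theta>)) \<le> (\<Sum>n<T. \<Sum>j\<in>{1..N}. of_bool (charged \<Theta> r \<epsilon> S i n j) :: real)"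
      proof (rule sum_mono)
        fix n
        show "of_bool (plan S i n \<noteq> target \<Theta>) \<le> (\<Sum>j\<in>{1..N}. of_bool (charged \<Theta> r \<epsilon> S i n j) :: real)"
        proof (cases "plan S i n = target \<Theta>")
          case False
          then obtain j where j: "j \<in> {1..N}" "charged \<Theta> r \<epsilon> S i n j"
            using wrong_plan_charged[OF \<Theta> sep] by blast
          have "of_bool (charged \<Theta> r \<epsilon> S i n j) \<le> (\<Sum>j\<in>{1..N}. of_bool (charged \<Theta> r \<epsilon> S i n j) :: real)"
            using j(1) by (intro member_le_sum) auto
          then show ?thesis using j(2) False by (simp del: sum_of_bool_eq)
        qed (simp add: sum_nonneg)
      qed
      also have "\<dots> = (\<Sum>j\<in>{1..N}. ?c S i j T)" by (rule sum.swap)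
      finally show "(\<Sum>n<T. of_bool (plan S i n \<noteq> target \<Theta>)) \<le> (\<Sum>j\<in>{1..N}. ?c S i j T)" .
    qed (use D(1) in simp)
    finally show ?thesis .
  qed
  have le: "regret \<nu> f N M c ?\<pi> \<Theta> T \<le> (D * real M * real M) * (\<Sum>j\<in>{1..N}. expected_penalty \<Theta> r \<epsilon> T j)" for T
  proof -
    let ?DM = "ennreal (D * real M)"
    let ?I = "\<lambda>S i j. \<integral>\<^sup>+Y. ennreal (penalty \<Theta> r \<epsilon> T j (completed_samples S i j T Y)) \<partial>obs (\<Theta> j)"
    have charge: "ennreal (?c S i j T) \<le> ?I S i j" if j: "j \<in> {1..N}" for S i j
    proof -
      interpret prob_space "obs (\<Theta> j)" using \<Theta>H j by (intro prob_space_obs) blast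
      have "ennreal (?c S i j T) = (\<integral>\<^sup>+Y. ennreal (?c S i j T) \<partial>obs (\<Theta> j))" by (simp add: emeasure_space_1)
      also have "\<dots> \<le> ?I S i j"
        unfolding completed_samples_def by (intro nn_integral_mono ennreal_leI charges_le_penalty)
      finally show ?thesis .
    qed
    have gaps: "integrable (states \<Theta>) (\<lambda>S. \<Sum>t\<in>{1..T}. gap \<Theta> (action M ?\<pi> S t))"
      by (intro Bochner_Integration.integrable_sum regret_eq_expected_gap(1)[OF decentralized_rotating_ucb \<Theta>H]) simp
    have "ennreal (regret \<nu> f N M c ?\<pi> \<Theta> T) = (\<integral>\<^sup>+S. ennreal (\<Sum>t\<in>{1..T}. gap \<Theta> (action M ?\<pi> S t)) \<partial>states \<Theta>)"
      unfolding regret_eq_expected_gap(2)[OF decentralized_rotating_ucb \<Theta>H]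
      using gaps by (intro nn_integral_eq_integral[symmetric]) (auto intro!: sum_nonneg gap_nonneg \<Theta>)
    also have "\<dots> \<le> (\<integral>\<^sup>+S. ?DM * (\<Sum>i\<in>{1..M}. \<Sum>j\<in>{1..N}. ?I S i j) \<partial>states \<Theta>)"
    proof (rule nn_integral_mono)
      fix S
      have "ennreal (\<Sum>t\<in>{1..T}. gap \<Theta> (action M ?\<pi> S t)) \<le> ennreal (D * real M * (\<Sum>i\<in>{1..M}. \<Sum>j\<in>{1..N}. ?c S i j T))"
        by (rule ennreal_leI[OF path])
      also have "\<dots> = ?DM * (\<Sum>i\<in>{1..M}. \<Sum>j\<in>{1..N}. ennreal (?c S i j T))"
        using D(1) by (subst ennreal_mult) (auto intro!: sum_nonneg simp: sum_ennreal sum_nonneg simp del: sum_of_bool_eq)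
      also have "\<dots> \<le> ?DM * (\<Sum>i\<in>{1..M}. \<Sum>j\<in>{1..N}. ?I S i j)"
        by (intro mult_left_mono sum_mono charge) auto
      finally show "ennreal (\<Sum>t\<in>{1..T}. gap \<Theta> (action M ?\<pi> S t)) \<le> ?DM * (\<Sum>i\<in>{1..M}. \<Sum>j\<in>{1..N}. ?I S i j)" .
    qed
    also have "\<dots> = ?DM * (\<Sum>i\<in>{1..M}. \<Sum>j\<in>{1..N}. \<integral>\<^sup>+S. ?I S i j \<partial>states \<Theta>)"
    proof -
      have m: "(\<lambda>S. \<Sum>j\<in>{1..N}. ?I S i j) \<in> borel_measurable (states \<Theta>)" if "i \<in> {1..M}" for i
        by (intro borel_measurable_sum expected_completed_penalty(1)[OF \<Theta>H that])
      have "(\<integral>\<^sup>+S. ?DM * (\<Sum>i\<in>{1..M}. \<Sum>j\<in>{1..N}. ?I S i j) \<partial>states \<Theta>) = ?DM * (\<integral>\<^sup>+S. (\<Sum>i\<in>{1..M}. \<Sum>j\<in>{1..N}. ?I S i j) \<partial>states \<Theta>)"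
        by (intro nn_integral_cmult borel_measurable_sum m)
      also have "(\<integral>\<^sup>+S. (\<Sum>i\<in>{1..M}. \<Sum>j\<in>{1..N}. ?I S i j) \<partial>states \<Theta>) = (\<Sum>i\<in>{1..M}. \<integral>\<^sup>+S. (\<Sum>j\<in>{1..N}. ?I S i j) \<partial>states \<Theta>)"
        by (intro nn_integral_sum m)
      also have "\<dots> = (\<Sum>i\<in>{1..M}. \<Sum>j\<in>{1..N}. \<integral>\<^sup>+S. ?I S i j \<partial>states \<Theta>)"
        by (intro sum.cong refl nn_integral_sum expected_completed_penalty(1)[OF \<Theta>H])
      finally show ?thesis .
    qed
    also have "\<dots> = ?DM * (\<Sum>i\<in>{1..M}. \<Sum>j\<in>{1..N}. ennreal (expected_penalty \<Theta> r \<epsilon> T j))"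
      by (intro arg_cong[of _ _ "(*) ?DM"] sum.cong refl expected_completed_penalty(2)[OF \<Theta>H])
    also have "\<dots> = ?DM * (\<Sum>i\<in>{1..M}. ennreal (\<Sum>j\<in>{1..N}. expected_penalty \<Theta> r \<epsilon> T j))"
      using ep0 by (simp only: sum_ennreal)
    also have "\<dots> = ?DM * ennreal (\<Sum>i\<in>{1..M}. \<Sum>j\<in>{1..N}. expected_penalty \<Theta> r \<epsilon> T j)"
      using ep0 by (simp only: sum_ennreal sum_nonneg)
    also have "\<dots> = ennreal (D * real M * (\<Sum>i\<in>{1..M}. \<Sum>j\<in>{1..N}. expected_penalty \<Theta> r \<epsilon> T j))"
      using D(1) ep0 by (intro ennreal_mult[symmetric] mult_nonneg_nonneg sum_nonneg) auto
    also have "(\<Sum>i\<in>{1..M}. \<Sum>j\<in>{1..N}. expected_penalty \<Theta> r \<epsilon> T j) = real M * (\<Sum>j\<in>{1..N}. expected_penalty \<Theta> r \<epsilon> T j)"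
      by simp
    finally have "ennreal (regret \<nu> f N M c ?\<pi> \<Theta> T) \<le> ennreal (D * real M * (real M * (\<Sum>j\<in>{1..N}. expected_penalty \<Theta> r \<epsilon> T j)))" .
    moreover have "0 \<le> D * real M * (real M * (\<Sum>j\<in>{1..N}. expected_penalty \<Theta> r \<epsilon> T j))"
      using D(1) ep0 by (intro mult_nonneg_nonneg sum_nonneg) auto
    ultimately show ?thesis by (simp only: ennreal_le_iff mult.assoc)
  qed
  show thesis
  proof (rule that[of "D * real M * real M"])
    show "0 < D * real M * real M" using D(1) M_pos by simp
  qed (rule le)
qed

text \<open>The threshold \<open>r\<close> is placed below the \<open>M\<close>th largest mean, and close enough to it that no arm outside
  the \<open>M\<close> best reaches it often; the accuracy \<open>\<epsilon>\<close> is smaller than half of any difference between means of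
  best arms.\<close>
theorem regret_rotating_ucb_at_most_logarithmic:
  assumes \<Theta>: "\<Theta> \<in> valid"
  shows "\<exists>K. \<forall>\<^sub>F T in sequentially. regret \<nu> f N M c (rotating_ucb N M h g) \<Theta> T \<le> K * ln (real T)"
proof -
  let ?m = "\<lambda>a. mean (\<Theta> a)" and ?B = "best \<Theta>"
  note top = best_arms_top_set[OF \<Theta> M_le_N]
  have \<Theta>H: "\<Theta> \<in> {1..N} \<rightarrow> H" using \<Theta> unfolding param_sets_def by blast
  have BN: "?B \<subseteq> {1..N}" and less: "\<And>a b. a \<in> ?B \<Longrightarrow> b \<in> {1..N} - ?B \<Longrightarrow> ?m b < ?m a"
    using top(1) unfolding top_set_def by blast+
  have fin: "finite ?B" and ne: "?B \<noteq> {}" using M_pos by auto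
  have "Min (?m ` ?B) \<in> ?m ` ?B" using fin ne by (intro Min_in) simp_all
  then obtain b where b: "b \<in> ?B" "Min (?m ` ?B) = ?m b" by blast
  have b_min: "?m b \<le> ?m a" if "a \<in> ?B" for a
    unfolding b(2)[symmetric] using that fin by (intro Min_le) auto
  have bH: "\<Theta> b \<in> H" using \<Theta>H BN b(1) by blast
  let ?s = "\<lambda>\<epsilon> j T. \<Sum>k\<in>{1..<T}. measure (obs (\<Theta> j)) {z \<in> space (obs (\<Theta> j)). ?m b - \<epsilon> \<le> g T k (restrict z {1..k})}"
  have "\<forall>\<^sub>F \<epsilon> in at_right 0. \<forall>j\<in>{1..N} - ?B. \<exists>K. \<forall>\<^sub>F T in sequentially. ?s \<epsilon> j T \<le> K * ln (real T)"
    using \<Theta>H bH less[OF b(1)] by (intro eventually_ball_finite ballI g_rarely_exceeds_threshold) auto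
  moreover have "\<forall>\<^sub>F \<epsilon> in at_right (0::real). 0 < \<epsilon>" by (simp add: eventually_at_right_less)
  ultimately have "\<forall>\<^sub>F \<epsilon> in at_right 0. 0 < \<epsilon> \<and> (\<forall>j\<in>{1..N} - ?B. \<exists>K. \<forall>\<^sub>F T in sequentially. ?s \<epsilon> j T \<le> K * ln (real T))"
    by eventually_elim blast
  then obtain \<epsilon>1 where \<epsilon>1: "0 < \<epsilon>1" "\<And>j. j \<in> {1..N} - ?B \<Longrightarrow> \<exists>K. \<forall>\<^sub>F T in sequentially. ?s \<epsilon>1 j T \<le> K * ln (real T)"
    using eventually_happens'[OF trivial_limit_at_right_real] by blast
  define r where "r = ?m b - \<epsilon>1"
  define Ds where "Ds = insert 1 {d \<in> (\<lambda>(x, y). ?m x - ?m y) ` (?B \<times> ?B). 0 < d}"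
  define \<epsilon> where "\<epsilon> = Min Ds / 3"
  have Ds: "finite Ds" "Ds \<noteq> {}" "\<And>d. d \<in> Ds \<Longrightarrow> 0 < d" unfolding Ds_def using fin by auto
  then have "0 < Min Ds" by (subst Min_gr_iff) auto
  then have \<epsilon>: "0 < \<epsilon>" by (simp add: \<epsilon>_def)
  have sep: "2 * \<epsilon> < ?m x - ?m y" if "x \<in> ?B" "y \<in> ?B" "?m y < ?m x" for x y
  proof -
    have "?m x - ?m y \<in> Ds" unfolding Ds_def using that by (auto intro!: image_eqI[of _ _ "(x, y)"])
    then have "Min Ds \<le> ?m x - ?m y" using Ds(1) by (intro Min_le)
    then show ?thesis using \<open>0 < Min Ds\<close> by (simp add: \<epsilon>_def)
  qed
  obtain D where D: "0 < D" "\<And>T. regret \<nu> f N M c (rotating_ucb N M h g) \<Theta> T \<le> D * (\<Sum>j\<in>{1..N}. expected_penalty \<Theta> r \<epsilon> T j)"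
    using regret_le_expected_penalties[OF \<Theta> sep, of r] by blast
  have "\<exists>K. \<forall>\<^sub>F T in sequentially. expected_penalty \<Theta> r \<epsilon> T j \<le> K * ln (real T)" if j: "j \<in> {1..N}" for j
  proof (cases "j \<in> ?B")
    case True
    have "r < ?m j" using b_min[OF True] \<epsilon>1(1) by (simp add: r_def)
    then show ?thesis using \<Theta>H j \<epsilon> by (intro expected_penalty_best[OF _ True]) auto
  next
    case False
    then obtain K where "\<forall>\<^sub>F T in sequentially. ?s \<epsilon>1 j T \<le> K * ln (real T)" using \<epsilon>1(2) j by blast
    then show ?thesis using \<Theta>H j unfolding r_def by (intro expected_penalty_other[OF _ False]) auto
  qed
  then obtain K where K: "\<And>j. j \<in> {1..N} \<Longrightarrow> \<forall>\<^sub>F T in sequentially. expected_penalty \<Theta> r \<epsilon> T j \<le> K j * ln (real T)"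
    by metis
  have "\<forall>\<^sub>F T in sequentially. \<forall>j\<in>{1..N}. expected_penalty \<Theta> r \<epsilon> T j \<le> K j * ln (real T)"
    using K by (intro eventually_ball_finite) auto
  then have "\<forall>\<^sub>F T in sequentially. regret \<nu> f N M c (rotating_ucb N M h g) \<Theta> T \<le> D * (\<Sum>j\<in>{1..N}. K j) * ln (real T)"
  proof eventually_elim
    case (elim T)
    have "regret \<nu> f N M c (rotating_ucb N M h g) \<Theta> T \<le> D * (\<Sum>j\<in>{1..N}. expected_penalty \<Theta> r \<epsilon> T j)" by (rule D(2))
    also have "\<dots> \<le> D * (\<Sum>j\<in>{1..N}. K j * ln (real T))"
      using D(1) elim by (intro mult_left_mono sum_mono) auto
    also have "\<dots> = D * (\<Sum>j\<in>{1..N}. K j) * ln (real T)" by (simp add: sum_distrib_right)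
    finally show ?case .
  qed
  then show ?thesis by blast
qed

theorem uniformly_good_rotating_ucb: "uniformly_good \<nu> H f N M c (rotating_ucb N M h g)"
  unfolding uniformly_good_def
proof (intro conjI ballI allI impI)
  show "decentralized_policy N M (rotating_ucb N M h g)" by (rule decentralized_rotating_ucb)
  fix \<Theta> and b :: real assume \<Theta>: "\<Theta> \<in> valid" and b: "0 < b"
  obtain K where K: "\<forall>\<^sub>F T in sequentially. regret \<nu> f N M c (rotating_ucb N M h g) \<Theta> T \<le> K * ln (real T)"
    using regret_rotating_ucb_at_most_logarithmic[OF \<Theta>] by blast
  have "regret \<nu> f N M c (rotating_ucb N M h g) \<Theta> \<in> O(\<lambda>T. ln (real T))"
  proof (rule bigoI)
    show "\<forall>\<^sub>F T in sequentially. norm (regret \<nu> f N M c (rotating_ucb N M h g) \<Theta> T) \<le> K * norm (ln (real T))"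
      using K eventually_ge_at_top[of 1]
      by eventually_elim (use regret_nonneg[OF decentralized_rotating_ucb \<Theta>] in simp)
  qed
  also have "(\<lambda>T. ln (real T)) \<in> o(\<lambda>T. real T powr b)" using b by real_asymp
  finally show "regret \<nu> f N M c (rotating_ucb N M h g) \<Theta> \<in> o(\<lambda>T. real T powr b)" .
qed

text \<open>Its regret is at most \<open>K ln T\<close>, and that of any competitor is at least \<open>L ln T\<close> with \<open>L > 0\<close>.\<close>
theorem optimal_rotating_ucb: "optimal_policy \<nu> H f N M c (rotating_ucb N M h g)"
  unfolding optimal_policy_def
proof (intro conjI ballI allI impI uniformly_good_rotating_ucb)
  fix \<pi>' \<Theta> assume good: "uniformly_good \<nu> H f N M c \<pi>'" and \<Theta>: "\<Theta> \<in> valid"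
  obtain K where K: "\<forall>\<^sub>F T in sequentially. regret \<nu> f N M c (rotating_ucb N M h g) \<Theta> T \<le> K * ln (real T)"
    using regret_rotating_ucb_at_most_logarithmic[OF \<Theta>] by blast
  obtain L where L: "0 < L" "\<forall>\<^sub>F T in sequentially. L * ln (real T) \<le> regret \<nu> f N M c \<pi>' \<Theta> T"
    using regret_at_least_logarithmic[OF \<Theta>] good by blast
  show "regret \<nu> f N M c (rotating_ucb N M h g) \<Theta> \<in> O(regret \<nu> f N M c \<pi>' \<Theta>)"
  proof (rule bigoI)
    show "\<forall>\<^sub>F T in sequentially. norm (regret \<nu> f N M c (rotating_ucb N M h g) \<Theta> T)
        \<le> \<bar>K\<bar> / L * norm (regret \<nu> f N M c \<pi>' \<Theta> T)"
      using K L(2) eventually_ge_at_top[of 1]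
    proof eventually_elim
      case (elim T)
      have ln0: "0 \<le> ln (real T)" using elim(3) by simp
      have "norm (regret \<nu> f N M c (rotating_ucb N M h g) \<Theta> T) \<le> K * ln (real T)"
        using elim(1) regret_nonneg[OF decentralized_rotating_ucb \<Theta>] by simp
      also have "\<dots> \<le> \<bar>K\<bar> / L * (L * ln (real T))" using L(1) ln0 by (simp add: mult_right_mono)
      also have "\<dots> \<le> \<bar>K\<bar> / L * norm (regret \<nu> f N M c \<pi>' \<Theta> T)"
        using L(1) elim(2) by (intro mult_left_mono) auto
      finally show ?case .
    qed
  qed
qed

end

theorem theorem1:
  fixes \<nu> :: "real measure" and H :: "'p set" and f :: "'p \<Rightarrow> real \<Rightarrow> real"
    and h :: "nat \<Rightarrow> (nat \<Rightarrow> real) \<Rightarrow> real" and g :: "nat \<Rightarrow> nat \<Rightarrow> (nat \<Rightarrow> real) \<Rightarrow> real"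
    and N M :: nat and c :: collision_model
  assumes players: "1 \<le> M" "M < N"
    and densities: "density_family \<nu> H f"
    and C1: "\<And>\<theta>. \<theta> \<in> H \<Longrightarrow> integrable (arm_law \<nu> f \<theta>) (\<lambda>s. s)"
    and C2: "\<And>\<theta> \<theta>'. \<theta> \<in> H \<Longrightarrow> \<theta>' \<in> H \<Longrightarrow> arm_mean \<nu> f \<theta> < arm_mean \<nu> f \<theta>' \<Longrightarrow>
               0 < kl_dist \<nu> f \<theta> \<theta>' \<and> kl_dist \<nu> f \<theta> \<theta>' < \<infinity>"
    and C3: "\<And>\<epsilon> \<theta> \<theta>'. 0 < \<epsilon> \<Longrightarrow> \<theta> \<in> H \<Longrightarrow> \<theta>' \<in> H \<Longrightarrow> arm_mean \<nu> f \<theta> < arm_mean \<nu> f \<theta>' \<Longrightarrow>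
               \<exists>\<delta>>0. \<forall>\<theta>''\<in>H. arm_mean \<nu> f \<theta>' \<le> arm_mean \<nu> f \<theta>'' \<and>
                              arm_mean \<nu> f \<theta>'' \<le> arm_mean \<nu> f \<theta>' + \<delta> \<longrightarrow>
                 \<bar>kl_dist \<nu> f \<theta> \<theta>' - kl_dist \<nu> f \<theta> \<theta>''\<bar> < ereal \<epsilon>"
    and C4: "\<And>\<theta> \<delta>. \<theta> \<in> H \<Longrightarrow> 0 < \<delta> \<Longrightarrow>
               \<exists>\<theta>'\<in>H. arm_mean \<nu> f \<theta> < arm_mean \<nu> f \<theta>' \<and> arm_mean \<nu> f \<theta>' < arm_mean \<nu> f \<theta> + \<delta>"
    and C5: "estimators \<nu> H f h g"
  shows
    "(\<exists>\<pi>. optimal_policy \<nu> H f N M c \<pi>) \<and>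
     (\<exists>L :: (nat \<Rightarrow> 'p) \<Rightarrow> real.
        (\<forall>\<Theta>\<in>param_sets \<nu> H f N M. 0 < L \<Theta>) \<and>
        (\<forall>\<pi>. uniformly_good \<nu> H f N M c \<pi> \<longrightarrow>
           (\<forall>\<Theta>\<in>param_sets \<nu> H f N M.
              ereal (L \<Theta>) \<le> liminf (\<lambda>T. ereal (regret \<nu> f N M c \<pi> \<Theta> T / ln (real T))))) \<and>
        (\<forall>\<pi>. optimal_policy \<nu> H f N M c \<pi> \<longrightarrow>
           (\<exists>U :: (nat \<Rightarrow> 'p) \<Rightarrow> real. \<forall>\<Theta>\<in>param_sets \<nu> H f N M.
              ereal (L \<Theta>) \<le> liminf (\<lambda>T. ereal (regret \<nu> f N M c \<pi> \<Theta> T / ln (real T))) \<and>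
              liminf (\<lambda>T. ereal (regret \<nu> f N M c \<pi> \<Theta> T / ln (real T)))
                \<le> limsup (\<lambda>T. ereal (regret \<nu> f N M c \<pi> \<Theta> T / ln (real T))) \<and>
              limsup (\<lambda>T. ereal (regret \<nu> f N M c \<pi> \<Theta> T / ln (real T))) \<le> ereal (U \<Theta>))))"
proof -
  interpret ucb_bandit \<nu> H f N M c h g
    by unfold_locales (fact densities C1 C2 C4 C5 players less_imp_le[OF players(2)])+
  let ?R = "\<lambda>\<pi> \<Theta> T. regret \<nu> f N M c \<pi> \<Theta> T" and ?P = "rotating_ucb N M h g"
  have ln_pos: "\<forall>\<^sub>F T in sequentially. 0 < ln (real T)" by real_asymp
  obtain L where L: "\<And>\<Theta>. \<Theta> \<in> valid \<Longrightarrow> 0 < L \<Theta>"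
    and low: "\<And>\<Theta> \<pi>. \<Theta> \<in> valid \<Longrightarrow> uniformly_good \<nu> H f N M c \<pi> \<Longrightarrow>
      \<forall>\<^sub>F T in sequentially. L \<Theta> * ln (real T) \<le> ?R \<pi> \<Theta> T"
    using regret_at_least_logarithmic by metis
  have liminf: "ereal (L \<Theta>) \<le> liminf (\<lambda>T. ereal (?R \<pi> \<Theta> T / ln (real T)))"
    if "\<Theta> \<in> valid" "uniformly_good \<nu> H f N M c \<pi>" for \<Theta> \<pi>
  proof (rule Liminf_bounded)
    show "\<forall>\<^sub>F T in sequentially. ereal (L \<Theta>) \<le> ereal (?R \<pi> \<Theta> T / ln (real T))"
      using low[OF that] ln_pos by eventually_elim (simp add: field_simps)
  qed
  have limsup: "\<exists>U. limsup (\<lambda>T. ereal (?R \<pi> \<Theta> T / ln (real T))) \<le> ereal U"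
    if \<Theta>: "\<Theta> \<in> valid" and opt: "optimal_policy \<nu> H f N M c \<pi>" for \<Theta> \<pi>
  proof -
    obtain K where K: "\<forall>\<^sub>F T in sequentially. ?R ?P \<Theta> T \<le> K * ln (real T)"
      using regret_rotating_ucb_at_most_logarithmic[OF \<Theta>] by blast
    have "?R \<pi> \<Theta> \<in> O(?R ?P \<Theta>)"
      using opt uniformly_good_rotating_ucb \<Theta> unfolding optimal_policy_def by blast
    then obtain C where C: "0 < C" "\<forall>\<^sub>F T in sequentially. norm (?R \<pi> \<Theta> T) \<le> C * norm (?R ?P \<Theta> T)"
      by (elim landau_o.bigE)
    have "\<forall>\<^sub>F T in sequentially. ereal (?R \<pi> \<Theta> T / ln (real T)) \<le> ereal (C * K)"
      using K C(2) ln_pos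
    proof eventually_elim
      case (elim T)
      have "?R \<pi> \<Theta> T \<le> C * ?R ?P \<Theta> T"
        using elim(2) regret_nonneg[OF decentralized_rotating_ucb \<Theta>, of T] by simp
      also have "\<dots> \<le> C * (K * ln (real T))" using elim(1) C(1) by (intro mult_left_mono) auto
      finally show ?case using elim(3) by (simp add: field_simps)
    qed
    then show ?thesis by (intro exI Limsup_bounded)
  qed
  have upper: "\<exists>U. \<forall>\<Theta>\<in>valid.
        ereal (L \<Theta>) \<le> liminf (\<lambda>T. ereal (?R \<pi> \<Theta> T / ln (real T))) \<and>
        liminf (\<lambda>T. ereal (?R \<pi> \<Theta> T / ln (real T))) \<le> limsup (\<lambda>T. ereal (?R \<pi> \<Theta> T / ln (real T))) \<and>
        limsup (\<lambda>T. ereal (?R \<pi> \<Theta> T / ln (real T))) \<le> ereal (U \<Theta>)"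
    if opt: "optimal_policy \<nu> H f N M c \<pi>" for \<pi>
  proof -
    have good: "uniformly_good \<nu> H f N M c \<pi>" using opt by (simp add: optimal_policy_def)
    obtain U where "\<And>\<Theta>. \<Theta> \<in> valid \<Longrightarrow> limsup (\<lambda>T. ereal (?R \<pi> \<Theta> T / ln (real T))) \<le> ereal (U \<Theta>)"
      using limsup[OF _ opt] by metis
    then show ?thesis
      using liminf[OF _ good] by (intro exI[of _ U]) (simp add: Liminf_le_Limsup)
  qed
  have "\<exists>\<pi>. optimal_policy \<nu> H f N M c \<pi>" using optimal_rotating_ucb by blast
  then show ?thesis
  proof (rule conjI, intro exI[of _ L] conjI)
    show "\<forall>\<Theta>\<in>valid. 0 < L \<Theta>" using L by blast
  qed (use liminf upper in blast)+
qed

end
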